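(* Assume the Generalized Riemann Hypothesis for Dirichlet $L$-functions. Let $m \geq 2$ be an even integer. Then for every odd prime $p$, $$f_m(p) = \frac{p}{4} + O_m(\sqrt{p}\log\log p).$$
   Context: For an integer $m\ge 2$ and an odd prime $p$, $$f_m(p) := \#\left\{k\in\mathbb Z : 1 \le k < \tfrac{p}{2},\ \left\{\tfrac{k^m}{p}\right\} > \tfrac{1}{2}\right\},$$ where $\{t\}$ denotes the fractional part of a real number $t$. Here $\log$ is the natural logarithm. $F = O_m(G)$ means $|F|\le cG$ for a constant $c>0$ depending only on $m$, not on $p$. The Generalized Riemann Hypothesis is the assertion that for every Dirichlet character $\chi$, all zeros of $L(s,\chi)$ in the strip $0<\operatorname{Re}(s)<1$ lie on the line $\operatorname{Re}(s)=\tfrac12$. *)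

theory Defs
  imports "HOL-Complex_Analysis.Complex_Analysis" "HOL-Computational_Algebra.Primes"
begin

text \<open>The value \<open>chi 1 = 1\<close> follows from multiplicativity and \<open>chi 1 \<noteq> 0\<close>.\<close>

definition dirichlet_character :: "nat \<Rightarrow> (int \<Rightarrow> complex) \<Rightarrow> bool" where
  "dirichlet_character q chi \<longleftrightarrow>
     q \<ge> 1 \<and>
     (\<forall>a b. chi (a * b) = chi a * chi b) \<and>
     (\<forall>a. chi (a + int q) = chi a) \<and>
     (\<forall>a. chi a \<noteq> 0 \<longleftrightarrow> coprime a (int q))"

definition principal_character :: "nat \<Rightarrow> int \<Rightarrow> complex" where
  "principal_character q a = (if coprime a (int q) then 1 else 0)"

text \<open>
  \<open>L(s, chi)\<close> is the analytic continuation of the Dirichlet series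
  \<open>\<Sum>n\<ge>1. chi(n) / n\<^sup>s\<close> (\<open>Re s > 1\<close>): to the whole plane if \<open>chi\<close> is not principal, and to
  the plane without the pole \<open>s = 1\<close> if it is. The domain is open and connected, so the
  continuation is unique on it; only the value at the pole, which is irrelevant, is left
  to the choice operator.
\<close>

definition dirichlet_L_domain :: "nat \<Rightarrow> (int \<Rightarrow> complex) \<Rightarrow> complex set" where
  "dirichlet_L_domain q chi = (if chi = principal_character q then - {1} else UNIV)"

definition dirichlet_L :: "nat \<Rightarrow> (int \<Rightarrow> complex) \<Rightarrow> complex \<Rightarrow> complex" where
  "dirichlet_L q chi =
     (SOME L. L holomorphic_on dirichlet_L_domain q chi \<and>
        (\<forall>s. Re s > 1 \<longrightarrow>
           (\<lambda>n. chi (int (Suc n)) / of_nat (Suc n) powr s) sums L s))"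

definition generalized_riemann_hypothesis :: bool where
  "generalized_riemann_hypothesis \<longleftrightarrow>
     (\<forall>q chi s. dirichlet_character q chi \<longrightarrow> 0 < Re s \<longrightarrow> Re s < 1 \<longrightarrow>
        dirichlet_L q chi s = 0 \<longrightarrow> Re s = 1 / 2)"

definition large_residue_count :: "nat \<Rightarrow> nat \<Rightarrow> nat" where
  "large_residue_count m p =
     card {k :: int. 1 \<le> k \<and> real_of_int k < real p / 2 \<and>
                     frac (real_of_int k ^ m / real p) > 1 / 2}"

end

theory Submission
  imports Defs "HOL-Number_Theory.Number_Theory"
begin

text \<open>
  Write \<open>w\<close> for the square wave modulo \<open>p\<close>: \<open>w(a) = 1\<close> if the residue of \<open>a\<close> lies below
  \<open>p/2\<close>, and \<open>w(a) = -1\<close> otherwise. For even \<open>m\<close> the numbers \<open>k\<close> and \<open>p - k\<close> have the same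
  \<open>m\<close>-th power modulo \<open>p\<close>, so the count equals \<open>(p - 1)/4\<close> minus a quarter of
  \<open>\<Sum>k=1..p-1. w(k\<^sup>m)\<close> (\<open>large_residue_count_eq\<close>). Detecting \<open>m\<close>-th powers by
  characters turns this sum into the sum of \<open>\<Sum>a. w(a) chi(a)\<close> over the characters with
  \<open>chi\<^sup>m = 1\<close> (\<open>power_sum_as_char_sums\<close>), of which there are at most \<open>m\<close>. Since \<open>w\<close> is odd,
  even characters contribute nothing. For odd \<open>chi\<close> the sum is an elementary factor times
  the Gauss sum of \<open>chi\<close> times \<open>L(1, cnj chi)\<close>, hence at most
  \<open>2 sqrt p |L(1, cnj chi)|\<close> (\<open>square_wave_char_sum_odd\<close>). It remains to bound \<open>L(1, chi)\<close>
  by a multiple of \<open>log log q\<close> under the Riemann hypothesis, which is a theorem of Littlewood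
  (\<open>littlewood_L1_bound\<close>).

  For that bound, put \<open>e = 1 / log log q\<close>. On \<open>Re s \<ge> 1 + e\<close> the logarithmic derivative
  \<open>L'/L\<close> is dominated termwise by that of the zeta function, hence is \<open>O(1/e)\<close>. If \<open>L\<close> has
  no zeros in the disc of radius \<open>3/2\<close> around \<open>2\<close>, then the Borel-Caratheodory inequality
  for \<open>log L\<close> and the polynomial bound for \<open>L\<close> give \<open>L'/L = O(log q)\<close> on the concentric circle of
  radius \<open>6/5\<close>. Three concentric circles interpolate between these bounds: moving from radius
  \<open>1 - e\<close> to radius \<open>1\<close> costs a factor \<open>(log q)\<close> to a power \<open>O(e)\<close>, which is bounded by the choice of
  \<open>e\<close>. So \<open>L'/L = O(1/e)\<close> on all of \<open>[1, 1 + e]\<close>, therefore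
  \<open>L(1) = O(L(1 + e)) = O(zeta(1 + e)) = O(1/e)\<close> (\<open>littlewood_disc\<close>).

  The disc of radius \<open>3/2\<close> lies in \<open>Re s > 1/2\<close>. The hypothesis excludes zeros with
  \<open>1/2 < Re s < 1\<close>, complete multiplicativity of the coefficients
  those with \<open>Re s > 1\<close> (\<open>dseries_nonzero\<close>), and the classical inequality
  \<open>3 + 4 cos t + cos 2t \<ge> 0\<close> those with \<open>Re s = 1\<close>, \<open>s \<noteq> 1\<close>
  (\<open>nonvanishing_line_one\<close>). A zero at \<open>s = 1\<close> would make
  the desired bound trivial, so it can be left out of consideration.

  The L-function is specified as some analytic continuation of its Dirichlet series, so
  the hypothesis says something about it only once a continuation has been constructed. This is done
  for Hurwitz zeta functions by a recursion on half-planes and transferred to all periodic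
  coefficient sequences (\<open>periodic_dseries_entire\<close>).
\<close>

section \<open>Dirichlet series with completely multiplicative coefficients\<close>

definition dseries :: "(nat \<Rightarrow> complex) \<Rightarrow> complex \<Rightarrow> complex" where
  "dseries a s = (\<Sum>n. a (Suc n) / of_nat (Suc n) powr s)"

lemma log_growth_bound:
  assumes "e > 0"
  shows "1 + ln (real (Suc n)) \<le> (1 + 1 / e) * real (Suc n) powr e"
proof -
  have "ln (real (Suc n)) \<le> (real (Suc n) powr e) / e"
    using assms by (intro ln_powr_bound) auto
  moreover have "1 \<le> real (Suc n) powr e"
    using assms by (intro ge_one_powr_ge_zero) auto
  ultimately show ?thesis by (simp add: algebra_simps)
qed

lemma norm_dterm:
  "norm (c / of_nat (Suc n) powr s) = norm c / real (Suc n) powr Re s"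
  by (simp add: norm_divide norm_powr_real_powr del: of_nat_Suc)

text \<open>The majorant \<open>1 + ln n\<close> covers bounded coefficients, the von Mangoldt function and the
  coefficients of the derivative at once.\<close>

lemma summable_dterm_bound:
  assumes "1 < r"
  shows "summable (\<lambda>n. (1 + ln (real (Suc n))) / real (Suc n) powr r)"
proof -
  define e where "e = (r - 1) / 2"
  have e: "e > 0" "e - r < -1" using assms by (auto simp: e_def field_simps)
  have "summable (\<lambda>n. real n powr (e - r))" using e by (simp add: summable_real_powr_iff)
  hence "summable (\<lambda>n. real (Suc n) powr (e - r))" by (subst summable_Suc_iff)
  hence "summable (\<lambda>n. (1 + 1 / e) * real (Suc n) powr (e - r))" by (rule summable_mult)
  thus ?thesis
  proof (rule summable_comparison_test'[where N = 0])
    fix n :: nat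
    have "(1 + ln (real (Suc n))) / real (Suc n) powr r \<le> (1 + 1 / e) * real (Suc n) powr e / real (Suc n) powr r"
      using log_growth_bound[OF e(1), of n] by (intro divide_right_mono) auto
    thus "norm ((1 + ln (real (Suc n))) / real (Suc n) powr r) \<le> (1 + 1 / e) * real (Suc n) powr (e - r)"
      by (simp add: powr_diff del: of_nat_Suc)
  qed
qed

lemma dseries_norm_summable:
  assumes c: "\<And>n. norm (c (Suc n)) \<le> 1 + ln (real (Suc n))" and "Re s > 1"
  shows "summable (\<lambda>n. norm (c (Suc n) / of_nat (Suc n) powr s))"
  using summable_dterm_bound[OF assms(2)]
proof (rule summable_comparison_test'[where N = 0])
  fix n
  show "norm (norm (c (Suc n) / of_nat (Suc n) powr s)) \<le> (1 + ln (real (Suc n))) / real (Suc n) powr Re s"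
    using c[of n] by (simp add: norm_dterm divide_right_mono del: of_nat_Suc)
qed

lemma dseries_sums:
  assumes c: "\<And>n. norm (c (Suc n)) \<le> 1 + ln (real (Suc n))" and "Re s > 1"
  shows "(\<lambda>n. c (Suc n) / of_nat (Suc n) powr s) sums dseries c s"
  unfolding dseries_def using dseries_norm_summable[OF assms]
  by (rule summable_sums[OF summable_norm_cancel])

lemma dseries_has_derivative:
  assumes c: "\<And>n. norm (c (Suc n)) \<le> 1 + ln (real (Suc n))" and s: "Re s > 1"
  shows "(\<lambda>n. - of_real (ln (real (Suc n))) * c (Suc n) / of_nat (Suc n) powr s) sums
            deriv (dseries c) s"
    and "(dseries c has_field_derivative deriv (dseries c) s) (at s)"
proof -
  let ?S = "{s. Re s > 1}"
  let ?f = "\<lambda>n s. c (Suc n) / of_nat (Suc n) powr s"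
  let ?f' = "\<lambda>n s. - of_real (ln (real (Suc n))) * c (Suc n) / of_nat (Suc n) powr s"
  have op: "open ?S" by (rule open_halfspace_Re_gt)
  have "\<exists>g g'. \<forall>x \<in> ?S. ((\<lambda>n. ?f n x) sums g x) \<and> ((\<lambda>n. ?f' n x) sums g' x)
          \<and> (g has_field_derivative g' x) (at x)"
  proof (rule series_and_derivative_comparison_local[OF op])
    fix n x assume "x \<in> ?S"
    show "(?f n has_field_derivative ?f' n x) (at x)"
      by (rule derivative_eq_intros refl | simp add: powr_def Ln_of_nat field_simps del: of_nat_Suc)+
  next
    fix x assume x: "x \<in> ?S"
    \<comment> \<open>the midpoint between the boundary line and \<open>x\<close>; the ball of radius \<open>d\<close> stays to its right\<close>
    define r where "r = (1 + Re x) / 2"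
    define d where "d = (Re x - 1) / 2"
    have r: "1 < r" "d > 0" using x by (auto simp: r_def d_def)
    have "norm (?f n y) \<le> (1 + ln (real (Suc n))) / real (Suc n) powr r" if "y \<in> ball x d" for n y
    proof -
      have "\<bar>Re (x - y)\<bar> < d" using that abs_Re_le_cmod[of "x - y"] by (auto simp: dist_norm)
      hence "r \<le> Re y" by (simp add: r_def d_def field_simps abs_if split: if_splits)
      thus ?thesis unfolding norm_dterm using c[of n]
        by (intro frac_le powr_mono) auto
    qed
    thus "\<exists>d h. 0 < d \<and> summable h \<and> (\<forall>\<^sub>F n in sequentially. \<forall>y\<in>ball x d \<inter> ?S. norm (?f n y) \<le> h n)"
      using r summable_dterm_bound[OF r(1)] by (intro exI[of _ d] exI) (auto intro!: always_eventually)
  qed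
  then obtain g g' where g: "\<And>x. x \<in> ?S \<Longrightarrow> (\<lambda>n. ?f n x) sums g x" 
     "\<And>x. x \<in> ?S \<Longrightarrow> (\<lambda>n. ?f' n x) sums g' x" "\<And>x. x \<in> ?S \<Longrightarrow> (g has_field_derivative g' x) (at x)"
    by blast
  have eq: "g x = dseries c x" if "x \<in> ?S" for x
    using g(1)[OF that] by (simp add: dseries_def sums_iff)
  have D: "(dseries c has_field_derivative g' s) (at s)"
    using has_field_derivative_transform_within_open[OF g(3) op] eq s by blast
  show "(\<lambda>n. ?f' n s) sums deriv (dseries c) s"
    using g(2)[of s] s DERIV_imp_deriv[OF D] by simp
  show "(dseries c has_field_derivative deriv (dseries c) s) (at s)"
    using D DERIV_imp_deriv[OF D] by simp
qed

lemma dseries_holomorphic: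
  assumes c: "\<And>n. norm (c (Suc n)) \<le> 1 + ln (real (Suc n))"
  shows "dseries c holomorphic_on {s. Re s > 1}"
  by (rule holomorphic_onI, rule field_differentiable_at_within)
     (use dseries_has_derivative(2)[of c, OF c] field_differentiable_def in blast)

lemma infsum_dseries:
  assumes c: "\<And>n. norm (c (Suc n)) \<le> 1 + ln (real (Suc n))" and s: "Re s > 1"
  shows "(\<lambda>n. norm (c n / of_nat n powr s)) summable_on {1..}"
    and "(\<Sum>\<^sub>\<infinity>n\<in>{1..}. c n / of_nat n powr s) = dseries c s"
proof -
  let ?f = "\<lambda>n. c n / of_nat n powr s"
  have im: "{1..} = range Suc" by (simp add: atLeast_Suc_greaterThan greaterThan_0)
  have a: "(\<lambda>n. norm ((?f \<circ> Suc) n)) summable_on UNIV"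
    using dseries_norm_summable[OF assms] by (intro summable_nonneg_imp_summable_on) (auto simp: o_def)
  
  show "(\<lambda>n. norm (?f n)) summable_on {1..}" unfolding im
    using a by (subst summable_on_reindex) (auto simp: o_def)
  have eq: "(\<Sum>\<^sub>\<infinity>n\<in>{1..}. ?f n) = (\<Sum>\<^sub>\<infinity>n. (?f \<circ> Suc) n)"
    unfolding im by (subst infsum_reindex) auto
  have "((?f \<circ> Suc) has_sum dseries c s) UNIV"
    using dseries_sums[OF assms] dseries_norm_summable[OF assms]
    by (intro norm_summable_imp_has_sum) (auto simp: o_def)
  hence "(\<Sum>\<^sub>\<infinity>n. (?f \<circ> Suc) n) = dseries c s" by (rule infsumI)
  thus "(\<Sum>\<^sub>\<infinity>n\<in>{1..}. ?f n) = dseries c s" using eq by simp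
qed

definition bounded_mult :: "(nat \<Rightarrow> complex) \<Rightarrow> bool" where
  "bounded_mult a \<longleftrightarrow> a 1 = 1 \<and> (\<forall>m n. a (m * n) = a m * a n) \<and> (\<forall>n. norm (a n) \<le> 1)"

lemma bounded_mult_growth:
  assumes "bounded_mult a"
  shows "norm (a (Suc n)) \<le> 1 + ln (real (Suc n))"
    and "norm (a (Suc n) * mangoldt (Suc n)) \<le> 1 + ln (real (Suc n))"
    and "norm (of_real (ln (real (Suc n))) * a (Suc n)) \<le> 1 + ln (real (Suc n))"
proof -
  have a: "norm (a (Suc n)) \<le> 1" using assms by (auto simp: bounded_mult_def)
  have l: "0 \<le> ln (real (Suc n))" by simp
  show "norm (a (Suc n)) \<le> 1 + ln (real (Suc n))" using a l by (rule order_trans[OF _ le_add_same_cancel1[THEN iffD2]])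
  have "norm (a (Suc n)) * mangoldt (Suc n) \<le> 1 * ln (real (Suc n))"
    using a mangoldt_le[of "Suc n"] by (intro mult_mono) (auto simp: mangoldt_nonneg)
  thus "norm (a (Suc n) * mangoldt (Suc n)) \<le> 1 + ln (real (Suc n))" by (simp add: norm_mult)
  have "ln (real (Suc n)) * norm (a (Suc n)) \<le> ln (real (Suc n)) * 1"
    using a l by (intro mult_left_mono) auto
  thus "norm (of_real (ln (real (Suc n))) * a (Suc n)) \<le> 1 + ln (real (Suc n))"
    by (simp add: norm_mult)
qed

lemma abs_summable_on_times:
  fixes f :: "'a \<Rightarrow> 'c :: {banach, real_normed_div_algebra}"
  assumes "(\<lambda>x. norm (f x)) summable_on A" "(\<lambda>y. norm (g y)) summable_on B"
  shows "(\<lambda>z. norm (case z of (x, y) \<Rightarrow> f x * g y)) summable_on A \<times> B"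
  unfolding Infinite_Sum.abs_summable_on_Sigma_iff using assms
  by (auto simp: norm_mult infsum_cmult_right' abs_mult infsum_nonneg
        intro!: summable_on_cmult_right summable_on_cmult_left)

text \<open>The Dirichlet product of \<open>a\<close> and \<open>a \<Lambda>\<close> has the coefficients \<open>a(n) \<Sum>d|n. \<Lambda>(d) = a(n) ln n\<close>,
  because \<open>a\<close> is completely multiplicative. These are, up to sign, those of the derivative.\<close>

lemma deriv_dseries_mult:
  assumes a: "bounded_mult a" and s: "Re s > 1"
  shows "deriv (dseries a) s = - (dseries a s * dseries (\<lambda>n. a n * mangoldt n) s)"
proof -
  let ?u = "\<lambda>n::nat. a n / of_nat n powr s"
  let ?v = "\<lambda>n::nat. a n * mangoldt n / of_nat n powr s"
  let ?w = "\<lambda>n::nat. of_real (ln (real n)) * a n / of_nat n powr s"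
  let ?D = "\<lambda>n::nat. {d. d dvd n}"
  let ?g = "\<lambda>(n, d). a n * mangoldt d / of_nat n powr s"
  note g = bounded_mult_growth[OF a]
  note U = infsum_dseries[of a, OF g(1) s] and V = infsum_dseries[of "\<lambda>n. a n * mangoldt n", OF g(2) s]
    and W = infsum_dseries[of "\<lambda>n. of_real (ln (real n)) * a n", OF g(3) s]
  have mult: "?v d * ?u e = ?g (d * e, d)" if "d \<ge> 1" "e \<ge> 1" for d e
  proof -
    have "of_nat (d * e) powr s = (of_nat d powr s * of_nat e powr s :: complex)"
    proof -
      have "Ln (of_nat (d * e)) = of_real (ln (real (d * e)))" using that by (intro Ln_of_nat) auto
      also have "ln (real (d * e)) = ln (real d) + ln (real e)" using that by (simp add: ln_mult)
      finally have "Ln (of_nat (d * e)) = Ln (of_nat d) + Ln (of_nat e)" using that by (simp add: Ln_of_nat)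
      thus ?thesis using that by (simp add: powr_def exp_add ring_distribs)
    qed
    moreover have "a (d * e) = a d * a e" using a by (simp add: bounded_mult_def)
    ultimately show ?thesis by (simp add: field_simps)
  qed
  have prod: "(\<lambda>x. norm (case x of (d,e) \<Rightarrow> ?v d * ?u e)) summable_on {1..} \<times> {1..}"
    by (rule abs_summable_on_times[OF V(1) U(1)])
  have "dseries (\<lambda>n. a n * mangoldt n) s * dseries a s = (\<Sum>\<^sub>\<infinity>d\<in>{1..}. ?v d) * (\<Sum>\<^sub>\<infinity>e\<in>{1..}. ?u e)"
    using U V by simp
  also have "\<dots> = (\<Sum>\<^sub>\<infinity>d\<in>{1..}. \<Sum>\<^sub>\<infinity>e\<in>{1..}. ?v d * ?u e)"
    by (simp only: infsum_cmult_left' infsum_cmult_right')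
  also have "\<dots> = (\<Sum>\<^sub>\<infinity>(d,e)\<in>{1..}\<times>{1..}. ?v d * ?u e)"
    using Infinite_Sum.abs_summable_summable[OF prod] by (rule infsum_Sigma'_banach)
  finally have 1: "((\<lambda>(d,e). ?v d * ?u e) has_sum (dseries (\<lambda>n. a n * mangoldt n) s * dseries a s)) ({1..}\<times>{1..})"
    using Infinite_Sum.abs_summable_summable[OF prod] by (simp add: has_sum_infsum)
  \<comment> \<open>collect the pairs \<open>(d, e)\<close> by the value of the product \<open>n = d * e\<close>\<close>
  let ?i = "\<lambda>(d, e). (d * e, d :: nat)" and ?j = "\<lambda>(n, d). (d, n div d :: nat)"
  have "((\<lambda>(d,e). ?v d * ?u e) has_sum (dseries (\<lambda>n. a n * mangoldt n) s * dseries a s)) ({1..}\<times>{1..})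
     \<longleftrightarrow> (?g has_sum (dseries (\<lambda>n. a n * mangoldt n) s * dseries a s)) (Sigma {1..} ?D)"
  proof (rule has_sum_reindex_bij_witness[of _ ?j ?i])
    fix x assume "x \<in> {1::nat..} \<times> {1::nat..}"
    thus "?j (?i x) = x" "?i x \<in> Sigma {1..} ?D" "?g (?i x) = (\<lambda>(d,e). ?v d * ?u e) x"
      using mult by auto
  next
    fix x assume "x \<in> Sigma {1..} ?D"
    thus "?i (?j x) = x" "?j x \<in> {1..} \<times> {1..}"
      by (auto simp: Suc_le_eq elim!: dvdE)
  qed auto
  with 1 have 2: "(?g has_sum (dseries (\<lambda>n. a n * mangoldt n) s * dseries a s)) (Sigma {1..} ?D)"
    by blast
  have "(\<lambda>(n, d). a n * mangoldt d / of_nat n powr s) summable_on Sigma {1..} ?D"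
    using 2 by (auto simp: summable_on_def)
  from infsum_Sigma'_banach[OF this]
  have "dseries (\<lambda>n. a n * mangoldt n) s * dseries a s
      = (\<Sum>\<^sub>\<infinity>n\<in>{1..}. \<Sum>\<^sub>\<infinity>d\<in>?D n. a n * mangoldt d / of_nat n powr s)"
    using infsumI[OF 2] by simp
  also have "\<dots> = (\<Sum>\<^sub>\<infinity>n\<in>{1..}. ?w n)"
  proof (rule infsum_cong)
    fix n :: nat assume n: "n \<in> {1..}"
    hence "(\<Sum>\<^sub>\<infinity>d\<in>?D n. a n * mangoldt d / of_nat n powr s) = (\<Sum>d\<in>?D n. a n * mangoldt d / of_nat n powr s)"
      by simp
    also have "\<dots> = a n * (\<Sum>d\<in>?D n. mangoldt d) / of_nat n powr s"
      by (simp add: sum_distrib_left sum_divide_distrib)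
    finally show "(\<Sum>\<^sub>\<infinity>d\<in>?D n. a n * mangoldt d / of_nat n powr s) = ?w n"
      using n by (subst (asm) mangoldt_sum) (auto simp: mult_ac)
  qed
  also have "\<dots> = dseries (\<lambda>n. of_real (ln (real n)) * a n) s" by (rule W(2))
  also have "\<dots> = - deriv (dseries a) s"
    using sums_minus[OF dseries_has_derivative(1)[of a, OF g(1) s]]
    by (simp add: dseries_def sums_iff del: of_nat_Suc)
  finally show ?thesis by (simp add: mult.commute)
qed

text \<open>The terms after the first add up to at most \<open>pi\<^sup>2/6 - 1 < 3/4\<close>.\<close>

lemma norm_dseries_2_ge:
  assumes a: "bounded_mult a"
  shows "norm (dseries a 2) \<ge> 1 / 4"
proof -
  have g: "\<And>n. norm (a (Suc n)) \<le> 1 + ln (real (Suc n))" by (rule bounded_mult_growth[OF a])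
  let ?f = "\<lambda>n. a (Suc n) / of_nat (Suc n) powr 2"
  have sq: "(\<lambda>n. 1 / (real n + 1)\<^sup>2) sums (pi\<^sup>2 / 6)" using inverse_squares_sums by (simp add: add.commute)
  hence "(\<lambda>n. 1 / (real (Suc n) + 1)\<^sup>2) sums (pi\<^sup>2 / 6 - 1)" by (subst sums_Suc_iff) simp
  hence sm: "summable (\<lambda>n. 1 / (real (Suc n) + 1)\<^sup>2)" "(\<Sum>n. 1 / (real (Suc n) + 1)\<^sup>2) = pi\<^sup>2 / 6 - 1"
    by (simp_all add: sums_iff)
  have s: "?f sums dseries a 2" by (rule dseries_sums[OF g]) auto
  hence "(\<lambda>n. ?f (Suc n)) sums (dseries a 2 - 1)" using a by (subst sums_Suc_iff) (simp add: bounded_mult_def)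
  hence "norm (dseries a 2 - 1) = norm (\<Sum>n. ?f (Suc n))" by (simp add: sums_iff)
  also have "\<dots> \<le> (\<Sum>n. 1 / (real (Suc n) + 1)\<^sup>2)"
  proof (rule norm_suminf_le[OF _ sm(1)])
    fix n
    have "norm (a (Suc (Suc n))) \<le> 1" using a by (auto simp: bounded_mult_def)
    thus "norm (?f (Suc n)) \<le> 1 / (real (Suc n) + 1)\<^sup>2"
      unfolding norm_dterm by (simp add: powr_numeral divide_right_mono add_ac)
  qed
  also have "\<dots> = pi\<^sup>2 / 6 - 1" by (rule sm(2))
  also have "\<dots> \<le> (3.2)\<^sup>2 / 6 - 1"
    using pi_less_4 pi_approx by (intro diff_right_mono divide_right_mono power_mono) auto
  also have "\<dots> \<le> 3 / 4" by (simp add: power2_eq_square)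
  finally have "norm (1 - dseries a 2) \<le> 3 / 4" by (simp add: norm_minus_commute)
  thus ?thesis using norm_triangle_ineq2[of 1 "1 - dseries a 2"] by simp
qed

text \<open>The equation \<open>D' = - D P\<close> makes \<open>D exp(Q)\<close> constant for a primitive \<open>Q\<close> of \<open>P\<close>; the
  constant is not zero because \<open>D(2)\<close> is not. This replaces the Euler product.\<close>

lemma dseries_nonzero:
  assumes a: "bounded_mult a" and s: "Re s > 1"
  shows "dseries a s \<noteq> 0"
proof -
  let ?S = "{s. Re s > 1}"
  let ?P = "dseries (\<lambda>n. a n * mangoldt n)"
  note g = bounded_mult_growth[OF a]
  have S: "convex ?S" "open ?S" by (auto intro: convex_halfspace_Re_gt open_halfspace_Re_gt)
  obtain Q where Q: "\<And>z. z \<in> ?S \<Longrightarrow> (Q has_field_derivative ?P z) (at z)"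
  proof -
    have "?P holomorphic_on ?S" by (rule dseries_holomorphic) (rule g(2))
    from holomorphic_convex_primitive'[OF S(1,2) this] obtain Q
      where "\<And>z. z \<in> ?S \<Longrightarrow> (Q has_field_derivative ?P z) (at z within ?S)" by blast
    thus ?thesis using that at_within_open[OF _ S(2)] by auto
  qed
  have "((\<lambda>z. dseries a z * exp (Q z)) has_field_derivative 0) (at z within ?S)" if z: "z \<in> ?S" for z
  proof -
    have "((\<lambda>z. dseries a z * exp (Q z)) has_field_derivative
            (dseries a z * (exp (Q z) * ?P z) + deriv (dseries a) z * exp (Q z))) (at z)"
      using z by (auto intro!: derivative_eq_intros Q dseries_has_derivative(2) g(1))
    thus ?thesis using deriv_dseries_mult[OF a, of z] z
      by (auto simp: algebra_simps intro: has_field_derivative_at_within)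
  qed
  then obtain c where c: "\<And>z. z \<in> ?S \<Longrightarrow> dseries a z * exp (Q z) = c"
    using has_field_derivative_zero_constant[OF S(1), of "\<lambda>z. dseries a z * exp (Q z)"] by blast
  have "dseries a 2 \<noteq> 0" using norm_dseries_2_ge[OF a] by auto
  hence "c \<noteq> 0" using c[of 2] by auto
  thus ?thesis using c[of s] s by auto
qed

lemma logderiv_dseries:
  assumes a: "bounded_mult a" and s: "Re s > 1"
  shows "deriv (dseries a) s / dseries a s = - dseries (\<lambda>n. a n * mangoldt n) s"
  using deriv_dseries_mult[OF assms] dseries_nonzero[OF assms] by simp

lemma bounded_mult_one: "bounded_mult (\<lambda>_. 1)"
  by (simp add: bounded_mult_def)

text \<open>Both series are dominated termwise by the ones with \<open>a = 1\<close>, that is, by the zeta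
  function and its logarithmic derivative on the real axis.\<close>

lemma norm_logderiv_dseries_le:
  assumes a: "bounded_mult a" and r: "1 < r" "r \<le> Re s"
  shows "norm (deriv (dseries a) s / dseries a s) \<le> Re (dseries mangoldt (of_real r))"
    and "norm (dseries a s) \<le> Re (dseries (\<lambda>_. 1) (of_real r))"
proof -
  have gen: "norm (dseries c s) \<le> Re (dseries (\<lambda>n. of_real (b n)) (of_real r))"
    if c: "\<And>n. norm (c n) \<le> b n" and b: "\<And>n. b (Suc n) \<le> 1 + ln (real (Suc n))" for b :: "nat \<Rightarrow> real" and c
  proof -
    have b0: "0 \<le> b n" for n using norm_ge_zero c order_trans by blast
    have b': "norm (of_real (b (Suc n)) :: complex) \<le> 1 + ln (real (Suc n))" for n
      using b[of n] b0[of "Suc n"] by simp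
    have B: "(\<lambda>n. Re (of_real (b (Suc n)) / of_nat (Suc n) powr of_real r)) sums Re (dseries (\<lambda>n. of_real (b n)) (of_real r))"
      using r by (intro sums_Re dseries_sums b') auto
    have eq: "Re (of_real (b (Suc n)) / of_nat (Suc n) powr of_real r) = b (Suc n) / real (Suc n) powr r" for n
    proof -
      have "(of_nat (Suc n) :: complex) powr of_real r = of_real (real (Suc n) powr r)"
        by (subst powr_of_real [symmetric]) auto
      thus ?thesis by (simp only: Re_complex_of_real flip: of_real_divide)
    qed
    have "norm (\<Sum>n. c (Suc n) / of_nat (Suc n) powr s) \<le> (\<Sum>n. b (Suc n) / real (Suc n) powr r)"
    proof (rule norm_suminf_le)
      fix n show "norm (c (Suc n) / of_nat (Suc n) powr s) \<le> b (Suc n) / real (Suc n) powr r"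
        unfolding norm_dterm using c r b0 by (intro frac_le powr_mono) auto
      show "summable (\<lambda>n. b (Suc n) / real (Suc n) powr r)" using B[unfolded eq] by (simp only: sums_iff)
    qed
    thus ?thesis using B[unfolded eq] by (simp only: sums_iff dseries_def[of c])
  qed
  have a1: "norm (a n) \<le> 1" for n using a by (auto simp: bounded_mult_def)
  show "norm (dseries a s) \<le> Re (dseries (\<lambda>_. 1) (of_real r))"
    using gen[of a "\<lambda>_. 1"] a1 by simp
  have "norm (a n * mangoldt n) \<le> mangoldt n" for n
    using mult_right_mono[OF a1[of n] mangoldt_nonneg[of n]] by (simp add: norm_mult)
  moreover have "mangoldt (Suc n) \<le> 1 + ln (real (Suc n))" for n using mangoldt_le[of "Suc n"] by simp
  ultimately have "norm (dseries (\<lambda>n. a n * mangoldt n) s) \<le> Re (dseries mangoldt (of_real r))"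
    using gen[of "\<lambda>n. a n * mangoldt n" mangoldt] by simp
  thus "norm (deriv (dseries a) s / dseries a s) \<le> Re (dseries mangoldt (of_real r))"
    using r by (subst logderiv_dseries[OF a]) auto
qed

section \<open>Analytic continuation of periodic Dirichlet series\<close>

text \<open>The falling factorial \<open>(1 - s)(- s)(- s - 1)\<dots>\<close> with \<open>k\<close> factors, which arises from
  differentiating \<open>u powr (1 - s)\<close> \<open>k\<close> times.\<close>

definition ffact_coeff :: "nat \<Rightarrow> complex \<Rightarrow> complex" where
  "ffact_coeff k s = (\<Prod>j<k. 1 - s - of_nat j)"

definition taylor_rem :: "nat \<Rightarrow> complex \<Rightarrow> real \<Rightarrow> complex" where
  "taylor_rem K s y = of_real (y + 1) powr (1 - s)
      - (\<Sum>k\<le>K. ffact_coeff k s / fact k * of_real y powr (1 - s - of_nat k))"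

definition hurwitz_series :: "real \<Rightarrow> complex \<Rightarrow> complex" where
  "hurwitz_series x s = (\<Sum>n. 1 / of_real (real n + x) powr s)"

text \<open>A remainder of order \<open>K\<close> decays like \<open>y powr (- Re s - K)\<close>, so that its sum over \<open>y = n + x\<close>
  converges for \<open>Re s > 1 - K\<close>: every further Taylor term gains one unit of half-plane.\<close>

lemma norm_taylor_rem_le:
  assumes y: "y > 0" and s: "Re s + real K \<ge> 0"
  shows "norm (taylor_rem K s y) \<le> norm (ffact_coeff (Suc K) s) * y powr (- Re s - real K)"
proof -
  define f where "f = (\<lambda>i u. ffact_coeff i s * u powr (1 - s - of_nat i))"
  define S :: "complex set" where "S = closed_segment (of_real y) (of_real (y + 1))"
  have S: "\<exists>t. x = of_real t \<and> y \<le> t" if "x \<in> S" for x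
    using that y unfolding S_def closed_segment_of_real by (auto simp: closed_segment_eq_real_ivl)
  have "norm (f 0 (of_real (y + 1)) - (\<Sum>i\<le>K. f i (of_real y) * (of_real (y + 1) - of_real y) ^ i / fact i))
     \<le> norm (ffact_coeff (Suc K) s) * y powr (- Re s - real K) * norm (of_real (y + 1) - of_real y :: complex) ^ Suc K / fact K"
  proof (rule complex_Taylor[where S = S])
    show "convex S" by (simp add: S_def)
    show "of_real y \<in> S" "of_real (y + 1) \<in> S" by (auto simp: S_def)
    fix i x assume x: "x \<in> S"
    obtain t where t: "x = of_real t" "y \<le> t" using S[OF x] by blast
    have nx: "x \<notin> \<real>\<^sub>\<le>\<^sub>0" using t y by auto
    show "(f i has_field_derivative f (Suc i) x) (at x within S)" unfolding f_def ffact_coeff_def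
      by (rule derivative_eq_intros refl nx | simp add: algebra_simps)+
    have "norm (f (Suc K) x) = norm (ffact_coeff (Suc K) s) * t powr (- Re s - real K)"
      using t y by (simp add: f_def norm_mult norm_powr_real_powr)
    also have "\<dots> \<le> norm (ffact_coeff (Suc K) s) * y powr (- Re s - real K)"
      using t y s by (intro mult_left_mono powr_mono2') auto
    finally show "norm (f (Suc K) x) \<le> norm (ffact_coeff (Suc K) s) * y powr (- Re s - real K)" .
  qed
  also have "f 0 (of_real (y + 1)) - (\<Sum>i\<le>K. f i (of_real y) * (of_real (y + 1) - of_real y) ^ i / fact i)
      = taylor_rem K s y"
    by (simp add: f_def taylor_rem_def ffact_coeff_def)
  also have "norm (ffact_coeff (Suc K) s) * y powr (- Re s - real K) * norm (of_real (y + 1) - of_real y :: complex) ^ Suc K / fact K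
     \<le> norm (ffact_coeff (Suc K) s) * y powr (- Re s - real K) / 1"
    by (intro frac_le) (simp_all add: fact_ge_1)
  finally show ?thesis by simp
qed

lemma taylor_rem_series_holomorphic:
  assumes x: "x > 0"
  shows "\<exists>E. E holomorphic_on {s. Re s > 1 - real K} \<and>
     (\<forall>s. Re s > 1 - real K \<longrightarrow> (\<lambda>n. taylor_rem K s (real n + x)) sums E s)"
proof -
  let ?S = "{s. Re s > 1 - real K}"
  let ?f = "\<lambda>n s. taylor_rem K s (real n + x)"
  have op: "open ?S" by (rule open_halfspace_Re_gt)
  have hol: "?f n holomorphic_on UNIV" for n
    unfolding taylor_rem_def ffact_coeff_def using x
    by (intro holomorphic_intros) (auto simp flip: of_nat_Suc)
  have "\<exists>g g'. \<forall>z \<in> ?S. ((\<lambda>n. ?f n z) sums g z) \<and> ((\<lambda>n. deriv (?f n) z) sums g' z)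
          \<and> (g has_field_derivative g' z) (at z)"
  proof (rule series_and_derivative_comparison_local[OF op])
    fix n z assume "z \<in> ?S"
    show "(?f n has_field_derivative deriv (?f n) z) (at z)"
      by (rule holomorphic_derivI[OF hol]) auto
  next
    fix z assume z: "z \<in> ?S"
    define d where "d = (Re z + real K - 1) / 2"
    define r where "r = Re z - d"
    define C where "C = (\<Prod>j<Suc K. 1 + (norm z + d) + real j)"
    have r: "- r - real K < -1" "d > 0" using z by (auto simp: r_def d_def field_simps)
    have "norm (?f n w) \<le> C * real n powr (- r - real K)" if w: "w \<in> ball z d" and n: "n \<ge> 1" for n w
    proof -
      have d: "norm (z - w) < d" using w by (simp add: dist_norm)
      have "\<bar>Re (z - w)\<bar> < d" using d abs_Re_le_cmod[of "z - w"] by linarith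
      hence rw: "r \<le> Re w" by (simp add: r_def)
      have nw: "norm w \<le> norm z + d" using d norm_triangle_ineq2[of w z] by (simp add: norm_minus_commute)
      have "norm (ffact_coeff (Suc K) w) = (\<Prod>j<Suc K. norm (1 - w - of_nat j))"
        by (simp add: ffact_coeff_def prod_norm norm_mult)
      also have "\<dots> \<le> C" unfolding C_def
      proof (intro prod_mono conjI norm_ge_zero)
        fix j
        show "norm (1 - w - of_nat j) \<le> 1 + (norm z + d) + real j"
          using norm_triangle_ineq4[of "1 - w" "of_nat j"] norm_triangle_ineq4[of 1 w] nw by simp
      qed
      finally have c: "norm (ffact_coeff (Suc K) w) \<le> C" .
      have "norm (?f n w) \<le> norm (ffact_coeff (Suc K) w) * (real n + x) powr (- Re w - real K)"
        using x r rw by (intro norm_taylor_rem_le) auto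
      also have "\<dots> \<le> C * (real n powr (- r - real K))"
      proof (intro mult_mono c)
        have "(real n + x) powr (- Re w - real K) \<le> (real n) powr (- Re w - real K)"
          using n x r rw by (intro powr_mono2') auto
        also have "\<dots> \<le> real n powr (- r - real K)" using n rw by (intro powr_mono) auto
        finally show "(real n + x) powr (- Re w - real K) \<le> real n powr (- r - real K)" .
      qed (use order_trans[OF norm_ge_zero c] in auto)
      finally show ?thesis .
    qed
    moreover have "summable (\<lambda>n. C * real n powr (- r - real K))"
      using r by (intro summable_mult) (simp add: summable_real_powr_iff)
    ultimately show "\<exists>d h. 0 < d \<and> summable h \<and> (\<forall>\<^sub>F n in sequentially. \<forall>y\<in>ball z d \<inter> ?S. norm (?f n y) \<le> h n)"
      using r by (intro exI[of _ d] exI[of _ "\<lambda>n. C * real n powr (- r - real K)"] conjI eventually_sequentiallyI[of 1]) auto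
  qed
  then obtain g g' where g: "\<And>z. z \<in> ?S \<Longrightarrow> (\<lambda>n. ?f n z) sums g z" 
     "\<And>z. z \<in> ?S \<Longrightarrow> (g has_field_derivative g' z) (at z)"
    by blast
  have "g holomorphic_on ?S" using g(2) holomorphic_on_open[OF op, of g] by blast
  thus ?thesis using g(1) by blast
qed

lemma hurwitz_series_sums:
  assumes x: "x > 0" and s: "Re s > 1"
  shows "(\<lambda>n. 1 / of_real (real n + x) powr s) sums hurwitz_series x s"
  unfolding hurwitz_series_def
proof (rule summable_sums, rule summable_comparison_test_ev)
  show "summable (\<lambda>n. real n powr (- Re s))" using s by (simp add: summable_real_powr_iff)
  have "norm (1 / of_real (real n + x) powr s) \<le> real n powr (- Re s)" if n: "n \<ge> 1" for n
  proof -
    have "norm (1 / of_real (real n + x) powr s) = (real n + x) powr (- Re s)"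
      using x by (simp add: norm_divide norm_powr_real_powr powr_minus_divide flip: of_real_add)
    also have "\<dots> \<le> real n powr (- Re s)" using n x s by (intro powr_mono2') auto
    finally show ?thesis .
  qed
  thus "\<forall>\<^sub>F n in sequentially. norm (1 / of_real (real n + x) powr s) \<le> real n powr (- Re s)"
    by (rule eventually_sequentiallyI)
qed

text \<open>Summing the Taylor expansion of \<open>(y + 1) powr (1 - s)\<close> around \<open>y\<close> over \<open>y = n + x\<close>, the left-hand
  sides telescope and the terms of the expansion become Hurwitz series at \<open>s, s + 1, \<dots>\<close>.
  Solved for the first one, this expresses it by its shifts to the right.\<close>

lemma hurwitz_recursion:
  assumes x: "x > 0" and K: "K \<ge> 1"
  shows "\<exists>E. E holomorphic_on {s. Re s > 1 - real K} \<and> E 1 = 0 \<and>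
    (\<forall>s. Re s > 1 \<longrightarrow> (s - 1) * hurwitz_series x s =
        of_real x powr (1 - s) + E s
        + (\<Sum>k=2..K. ffact_coeff k s / fact k * hurwitz_series x (s + of_nat (k - 1))))"
proof -
  obtain E where hol: "E holomorphic_on {s. Re s > 1 - real K}"
    and E: "\<And>s. Re s > 1 - real K \<Longrightarrow> (\<lambda>n. taylor_rem K s (real n + x)) sums E s"
    using taylor_rem_series_holomorphic[OF x, of K] by blast
  have split: "{..K} = insert 0 (insert 1 {2..K})" using K by auto
  have "taylor_rem K 1 (real n + x) = 0" for n
  proof -
    have "(\<Sum>k\<in>{2..K}. ffact_coeff k 1 / fact k * of_real (real n + x) powr (1 - 1 - of_nat k)) = 0"
      by (rule sum.neutral) (auto simp: ffact_coeff_def intro!: prod_zero)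
    moreover have "of_real (real n + x) \<noteq> (0::complex)" "of_real (real n + x + 1) \<noteq> (0::complex)"
      using x by (simp_all only: of_real_eq_0_iff)
    ultimately show ?thesis unfolding taylor_rem_def split by (simp add: ffact_coeff_def del: of_real_add)
  qed
  hence E1: "E 1 = 0" using E[of 1] K by (simp add: sums_iff)
  have "(s - 1) * hurwitz_series x s = of_real x powr (1 - s) + E s
        + (\<Sum>k=2..K. ffact_coeff k s / fact k * hurwitz_series x (s + of_nat (k - 1)))" if s: "Re s > 1" for s
  proof -
    let ?f = "\<lambda>n. of_real (real n + x) powr (1 - s) :: complex"
    let ?t = "\<lambda>k n. ffact_coeff k s / fact k * (1 / of_real (real n + x) powr (s + of_nat (k - 1)))"
    have "?f \<longlonglongrightarrow> 0"
    proof (rule Lim_null_comparison)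
      show "\<forall>\<^sub>F n in sequentially. norm (?f n) \<le> (real n + x) powr (1 - Re s)"
        using x by (intro always_eventually allI) (simp add: norm_powr_real_powr flip: of_real_add)
      show "(\<lambda>n. (real n + x) powr (1 - Re s)) \<longlonglongrightarrow> 0"
        using s by (intro tendsto_neg_powr filterlim_tendsto_add_at_top[OF tendsto_const filterlim_real_sequentially, THEN filterlim_compose[OF _ filterlim_ident], of x] | simp add: add.commute)+
    qed
    from telescope_sums[OF this] have 1: "(\<lambda>n. ?f (Suc n) - ?f n) sums (0 - ?f 0)" .
    have 2: "(\<lambda>n. \<Sum>k=1..K. ?t k n) sums (\<Sum>k=1..K. ffact_coeff k s / fact k * hurwitz_series x (s + of_nat (k - 1)))"
      by (intro sums_sum sums_mult hurwitz_series_sums x) (use s in auto)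
    have "(\<lambda>n. (?f (Suc n) - ?f n) - (\<Sum>k=1..K. ?t k n)) sums
       (0 - ?f 0 - (\<Sum>k=1..K. ffact_coeff k s / fact k * hurwitz_series x (s + of_nat (k - 1))))"
      by (rule sums_diff[OF 1 2])
    also have "(\<lambda>n. (?f (Suc n) - ?f n) - (\<Sum>k=1..K. ?t k n)) = (\<lambda>n. taylor_rem K s (real n + x))"
    proof
      fix n
      have "?t k n = ffact_coeff k s / fact k * of_real (real n + x) powr (1 - s - of_nat k)" if "k \<in> {1..K}" for k
      proof -
        have "1 - s - of_nat k = - (s + of_nat (k - 1))" using that by (simp add: of_nat_diff)
        thus ?thesis by (simp only: powr_minus_divide)
      qed
      hence eq: "(\<Sum>k=1..K. ?t k n) = (\<Sum>k=1..K. ffact_coeff k s / fact k * of_real (real n + x) powr (1 - s - of_nat k))"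
        by (intro sum.cong) auto
      have "{..K} = insert 0 {1..K}" by auto
      thus "(?f (Suc n) - ?f n) - (\<Sum>k=1..K. ?t k n) = taylor_rem K s (real n + x)"
        unfolding eq taylor_rem_def by (simp add: ffact_coeff_def add_ac)
    qed
    finally have "E s = 0 - ?f 0 - (\<Sum>k=1..K. ffact_coeff k s / fact k * hurwitz_series x (s + of_nat (k - 1)))"
      using E[of s] s K sums_unique2 by force
    moreover have "{1..K} = insert 1 {2..K}" using K by auto
    ultimately show ?thesis by (simp add: ffact_coeff_def algebra_simps)
  qed
  thus ?thesis using hol E1 by blast
qed

text \<open>The recursion extends the function from \<open>Re s > - N\<close> to \<open>Re s > - N - 1\<close>. The pole of the
  shifted series at \<open>s + k - 1 = 1\<close> is cancelled by the last factor of the falling factorial,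
  which is why all statements are about \<open>(s - 1)\<close> times the series.\<close>

lemma hurwitz_extend:
  assumes x: "x > 0"
  shows "\<exists>h. h holomorphic_on {s. Re s > - real N} \<and> h 1 = 1 \<and>
    (\<forall>s. Re s > 1 \<longrightarrow> h s = (s - 1) * hurwitz_series x s)"
proof (induction N)
  case 0
  obtain E where E: "E holomorphic_on {s. Re s > 0}" "E 1 = 0"
    "\<And>s. Re s > 1 \<Longrightarrow> (s - 1) * hurwitz_series x s = of_real x powr (1 - s) + E s"
    using hurwitz_recursion[OF x, of 1] by auto
  show ?case using E x
    by (intro exI[of _ "\<lambda>s. of_real x powr (1 - s) + E s"]) (auto intro!: holomorphic_intros)
next
  case (Suc N)
  define K where "K = N + 2"
  obtain h where h: "h holomorphic_on {s. Re s > - real N}" "h 1 = 1"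
    "\<And>s. Re s > 1 \<Longrightarrow> h s = (s - 1) * hurwitz_series x s" using Suc by blast
  obtain E where E: "E holomorphic_on {s. Re s > 1 - real K}" "E 1 = 0"
    "\<And>s. Re s > 1 \<Longrightarrow> (s - 1) * hurwitz_series x s = of_real x powr (1 - s) + E s
        + (\<Sum>k=2..K. ffact_coeff k s / fact k * hurwitz_series x (s + of_nat (k - 1)))"
    using hurwitz_recursion[OF x, of K] by (auto simp: K_def)
  define H where "H = (\<lambda>s. of_real x powr (1 - s) + E s
     - (\<Sum>k=2..K. ffact_coeff (k - 1) s / fact k * h (s + of_nat (k - 1))))"
  have K: "1 - real K = - real (Suc N)" by (simp add: K_def)
  have "H holomorphic_on {s. Re s > - real (Suc N)}"
    unfolding H_def ffact_coeff_def
  proof (intro holomorphic_intros)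
    show "E holomorphic_on {s. Re s > - real (Suc N)}" using E(1) by (simp only: K)
    fix k assume "k \<in> {2..K}"
    thus "(\<lambda>s. h (s + of_nat (k - 1))) holomorphic_on {s. Re s > - real (Suc N)}"
      by (intro holomorphic_on_compose_gen[OF _ h(1), unfolded o_def] holomorphic_intros) auto
  qed (use x in auto)
  moreover have "(\<Sum>k=2..K. ffact_coeff (k - 1) 1 / fact k * h (1 + of_nat (k - 1))) = 0"
    by (rule sum.neutral) (auto simp: ffact_coeff_def intro!: prod_zero)
  hence "H 1 = 1" using E(2) x by (simp add: H_def)
  moreover have "H s = (s - 1) * hurwitz_series x s" if s: "Re s > 1" for s
  proof -
    have "ffact_coeff k s / fact k * hurwitz_series x (s + of_nat (k - 1))
        = - (ffact_coeff (k - 1) s / fact k * h (s + of_nat (k - 1)))" if "k \<in> {2..K}" for k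
    proof -
      obtain j where k: "k = Suc j" using \<open>k \<in> {2..K}\<close> not0_implies_Suc[of k] by auto
      have "ffact_coeff (Suc j) s = ffact_coeff j s * (1 - s - of_nat j)" by (simp add: ffact_coeff_def)
      note A = this
      have B: "h (s + of_nat j) = (s + of_nat j - 1) * hurwitz_series x (s + of_nat j)"
        by (rule h(3)) (use s in auto)
      show ?thesis unfolding k diff_Suc_1 A B by (simp add: field_simps del: fact_Suc)
    qed
    thus ?thesis unfolding E(3)[OF s] H_def by (simp add: sum_negf)
  qed
  ultimately show ?case by blast
qed

lemma hurwitz_entire:
  assumes x: "x > 0"
  shows "\<exists>H. H holomorphic_on UNIV \<and> H 1 = 1 \<and>
    (\<forall>s. Re s > 1 \<longrightarrow> H s = (s - 1) * hurwitz_series x s)"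
proof -
  obtain h where h: "\<And>N. h N holomorphic_on {s. Re s > - real N}" "\<And>N. h N 1 = 1"
    "\<And>N s. Re s > 1 \<Longrightarrow> h N s = (s - 1) * hurwitz_series x s"
    using hurwitz_extend[OF x] by metis
  have eq: "h M s = h N s" if "Re s > - real N" "N \<le> M" for M N s
  proof (rule analytic_continuation_open[of "{s. Re s > 1}" "{s. Re s > - real N}" "h M" "h N"])
    show "h M holomorphic_on {s. Re s > - real N}"
      by (rule holomorphic_on_subset[OF h(1)]) (use that in auto)
    have "2 \<in> {s. Re s > 1}" by simp
    thus "{s. Re s > 1} \<noteq> {}" by blast
  qed (use that h in \<open>auto simp: open_halfspace_Re_gt convex_halfspace_Re_gt convex_connected\<close>)
  define H where "H = (\<lambda>s. h (nat \<lceil>- Re s\<rceil> + 1) s)"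
  have Heq: "H s = h N s" if "Re s > - real N" for N s
  proof -
    have "Re s > - real (nat \<lceil>- Re s\<rceil> + 1)" by linarith
    thus ?thesis unfolding H_def using eq that by (metis nat_le_linear)
  qed
  have "H field_differentiable (at s)" for s
  proof -
    obtain N :: nat where N: "- Re s < real N" using reals_Archimedean2 by blast
    have "h N field_differentiable (at s)"
      by (rule holomorphic_on_imp_differentiable_at[OF h(1) open_halfspace_Re_gt]) (use N in auto)
    then obtain D where D: "(h N has_field_derivative D) (at s)" by (auto simp: field_differentiable_def)
    have "(H has_field_derivative D) (at s)"
      by (rule has_field_derivative_transform_within_open[OF D open_halfspace_Re_gt[of "- real N"]])
         (use N Heq in auto)
    thus ?thesis by (auto simp: field_differentiable_def)
  qed
  hence "H holomorphic_on UNIV" by (auto simp: holomorphic_on_def)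
  moreover have "H 1 = 1" using Heq[of 0 1] h(2) by simp
  moreover have "H s = (s - 1) * hurwitz_series x s" if "Re s > 1" for s
    using Heq[of 0 s] h(3) that by simp
  ultimately show ?thesis by blast
qed

text \<open>Splitting into residue classes writes the series as a combination of Hurwitz series. The
  value at \<open>1\<close> is the residue; it vanishes exactly if the mean of the coefficients does.\<close>

lemma periodic_dseries_entire:
  assumes q: "q \<ge> 1" and per: "\<And>n. a (n + q) = a n" and bd: "\<And>n. norm (a n :: complex) \<le> 1"
  shows "\<exists>H. H holomorphic_on UNIV \<and> H 1 = (\<Sum>r<q. a (Suc r)) / of_nat q \<and>
    (\<forall>s. Re s > 1 \<longrightarrow> H s = (s - 1) * dseries a s)"
proof -
  have "\<exists>H. H holomorphic_on UNIV \<and> H 1 = 1 \<and>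
    (\<forall>s. Re s > 1 \<longrightarrow> H s = (s - 1) * hurwitz_series (real (Suc r) / real q) s)" for r
    by (rule hurwitz_entire) (use q in auto)
  then obtain h where h: "\<And>r. h r holomorphic_on UNIV" "\<And>r. h r 1 = 1"
    "\<And>r s. Re s > 1 \<Longrightarrow> h r s = (s - 1) * hurwitz_series (real (Suc r) / real q) s" by metis
  define H where "H = (\<lambda>s. of_nat q powr (- s) * (\<Sum>r<q. a (Suc r) * h r s))"
  have per': "a (Suc (k * q + r)) = a (Suc r)" for k r
    by (induction k) (use per in \<open>auto simp: add_ac\<close>, metis add.commute add.left_commute add_Suc_right per)
  have "H holomorphic_on UNIV" unfolding H_def using q by (intro holomorphic_intros h) auto
  moreover have "H 1 = (\<Sum>r<q. a (Suc r)) / of_nat q"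
    using q by (simp add: H_def h powr_minus field_simps)
  moreover have "H s = (s - 1) * dseries a s" if s: "Re s > 1" for s
  proof -
    let ?f = "\<lambda>n. a (Suc n) / of_nat (Suc n) powr s"
    have "norm (a (Suc n)) \<le> 1 + ln (real (Suc n))" for n
      using bd[of "Suc n"] by (smt (verit) ln_ge_zero_iff of_nat_0_less_iff of_nat_1 of_nat_mono le_add1 plus_1_eq_Suc zero_less_Suc)
    hence "?f sums dseries a s" using s by (intro dseries_sums) auto
    hence 1: "(\<lambda>k. sum ?f {k * q..<k * q + q}) sums dseries a s" using q by (intro sums_group) auto
    have "sum ?f {k * q..<k * q + q} = (\<Sum>r<q. a (Suc r) * (of_nat q powr (- s) * (1 / of_real (real k + real (Suc r) / real q) powr s)))" for k
    proof -
      have "sum ?f {k * q..<k * q + q} = (\<Sum>r<q. ?f (k * q + r))"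
        by (rule sum.reindex_bij_witness[of _ "\<lambda>r. k * q + r" "\<lambda>n. n - k * q"]) auto
      also have "\<dots> = (\<Sum>r<q. a (Suc r) * (of_nat q powr (- s) * (1 / of_real (real k + real (Suc r) / real q) powr s)))"
      proof (rule sum.cong)
        fix r
        have "(of_nat (Suc (k * q + r)) :: complex) = of_real (real q) * of_real (real k + real (Suc r) / real q)"
          using q by (simp add: field_simps)
        hence "of_nat (Suc (k * q + r)) powr s = of_real (real q) powr s * of_real (real k + real (Suc r) / real q) powr s"
          by (simp only:) (rule powr_times_real; simp)
        thus "?f (k * q + r) = a (Suc r) * (of_nat q powr (- s) * (1 / of_real (real k + real (Suc r) / real q) powr s))"
          by (simp add: per' powr_minus_divide del: of_nat_Suc)
      qed simp
      finally show ?thesis .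
    qed
    moreover have "(\<lambda>k. \<Sum>r<q. a (Suc r) * (of_nat q powr (- s) * (1 / of_real (real k + real (Suc r) / real q) powr s)))
        sums (\<Sum>r<q. a (Suc r) * (of_nat q powr (- s) * hurwitz_series (real (Suc r) / real q) s))"
      by (intro sums_sum sums_mult hurwitz_series_sums s) (use q in auto)
    ultimately have "dseries a s = (\<Sum>r<q. a (Suc r) * (of_nat q powr (- s) * hurwitz_series (real (Suc r) / real q) s))"
      using 1 sums_unique2 by simp
    thus ?thesis unfolding H_def by (simp add: h(3)[OF s] sum_distrib_left mult_ac)
  qed
  ultimately show ?thesis by blast
qed

section \<open>Non-vanishing on the line of real part one\<close>

text \<open>The limit is the order of the zero of \<open>f\<close> at \<open>z\<close>.\<close>

lemma logderiv_residue:
  assumes hol: "f holomorphic_on S" and S: "open S" "connected S" and z: "z \<in> S"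
    and nz: "w \<in> S" "f w \<noteq> 0"
  shows "\<exists>k::nat. ((\<lambda>w. (w - z) * (deriv f w / f w)) \<longlongrightarrow> of_nat k) (at z) \<and> (k = 0 \<longleftrightarrow> f z \<noteq> 0)"
proof (cases "f z = 0")
  case False
  have c1: "f \<midarrow>z\<rightarrow> f z" using hol S z by (meson continuous_on_eq_continuous_at holomorphic_on_imp_continuous_on isCont_def)
  have "deriv f holomorphic_on S" by (rule holomorphic_deriv[OF hol S(1)])
  hence c2: "deriv f \<midarrow>z\<rightarrow> deriv f z" using S z by (meson continuous_on_eq_continuous_at holomorphic_on_imp_continuous_on isCont_def)
  have "((\<lambda>w. (w - z) * (deriv f w / f w)) \<longlongrightarrow> (z - z) * (deriv f z / f z)) (at z)"
    using False by (intro tendsto_intros c1 c2)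
  thus ?thesis using False by (intro exI[of _ 0]) auto
next
  case True
  have "\<not> f constant_on S"
    using True z nz by (metis constant_on_def)
  then obtain g r n where gr: "0 < n" "0 < r" "ball z r \<subseteq> S" "g holomorphic_on ball z r"
    "\<And>w. w \<in> ball z r \<Longrightarrow> f w = (w - z) ^ n * g w" "\<And>w. w \<in> ball z r \<Longrightarrow> g w \<noteq> 0"
    using holomorphic_factor_zero_nonconstant[OF hol S z True] by metis
  have zb: "z \<in> ball z r" using gr(2) by simp
  have eq: "(w - z) * (deriv f w / f w) = of_nat n + (w - z) * (deriv g w / g w)"
    if w: "w \<in> ball z r" "w \<noteq> z" for w
  proof -
    have g': "(g has_field_derivative deriv g w) (at w)"
      by (rule holomorphic_derivI[OF gr(4) _ w(1)]) auto
    have "((\<lambda>w. (w - z) ^ n * g w) has_field_derivative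
       (of_nat n * (w - z) ^ (n - 1) * g w + (w - z) ^ n * deriv g w)) (at w)"
      by (rule derivative_eq_intros g' refl | simp)+
    hence "(f has_field_derivative (of_nat n * (w - z) ^ (n - 1) * g w + (w - z) ^ n * deriv g w)) (at w)"
      by (rule has_field_derivative_transform_within_open[of _ _ _ "ball z r"]) (use w gr(5) in auto)
    hence d: "deriv f w = of_nat n * (w - z) ^ (n - 1) * g w + (w - z) ^ n * deriv g w"
      by (rule DERIV_imp_deriv)
    obtain m where m: "n = Suc m" using gr(1) gr0_conv_Suc by blast
    have "w - z \<noteq> 0" using w by simp
    thus ?thesis unfolding d gr(5)[OF w(1)] m using gr(6)[OF w(1)] by (simp add: divide_simps) (simp add: algebra_simps)
  qed
  have c1: "g \<midarrow>z\<rightarrow> g z" using gr(4) zb by (meson continuous_on_eq_continuous_at holomorphic_on_imp_continuous_on isCont_def open_ball)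
  have "deriv g holomorphic_on ball z r" using gr(4) by (intro holomorphic_deriv) auto
  hence c2: "deriv g \<midarrow>z\<rightarrow> deriv g z" using zb by (meson continuous_on_eq_continuous_at holomorphic_on_imp_continuous_on isCont_def open_ball)
  have "((\<lambda>w. of_nat n + (w - z) * (deriv g w / g w)) \<longlongrightarrow> of_nat n + (z - z) * (deriv g z / g z)) (at z)"
    using gr(6)[OF zb] by (intro tendsto_intros c1 c2)
  hence "((\<lambda>w. of_nat n + (w - z) * (deriv g w / g w)) \<longlongrightarrow> of_nat n) (at z)" by simp
  hence "((\<lambda>w. (w - z) * (deriv f w / f w)) \<longlongrightarrow> of_nat n) (at z)"
    by (rule Lim_transform_within_open[where s = "ball z r"]) (use zb eq in auto)
  thus ?thesis using True gr(1) by (intro exI[of _ n]) auto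
qed

text \<open>Approaching a point of the line \<open>Re s = 1\<close> from the right, the logarithmic derivative
  sees the order \<open>k\<close> of the zero of \<open>H\<close> there, and at the point \<open>1\<close> in addition the factor
  \<open>1/(s - 1)\<close> that distinguishes the series from \<open>H\<close>.\<close>

lemma dseries_logderiv_limit:
  assumes a: "bounded_mult a" and hol: "H holomorphic_on UNIV"
    and H: "\<And>s. Re s > 1 \<Longrightarrow> H s = (s - 1) * dseries a s" and z: "Re z = 1"
  shows "\<exists>k::nat. ((\<lambda>t. of_real t * (deriv (dseries a) (z + of_real t) / dseries a (z + of_real t)))
            \<longlongrightarrow> of_nat k - (if z = 1 then 1 else 0)) (at_right (0::real)) \<and> (k = 0 \<longleftrightarrow> H z \<noteq> 0)"
proof -
  have "H 2 \<noteq> 0" using H[of 2] dseries_nonzero[OF a, of 2] by simp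
  then obtain k where k: "((\<lambda>w. (w - z) * (deriv H w / H w)) \<longlongrightarrow> of_nat k) (at z)" "k = 0 \<longleftrightarrow> H z \<noteq> 0"
    using logderiv_residue[OF hol open_UNIV connected_UNIV, of z 2] by auto
  let ?F = "at_right (0::real)"
  have lim: "filterlim (\<lambda>t. z + of_real t) (at z) ?F"
  proof (rule filterlim_atI)
    have "((\<lambda>t. z + of_real t) \<longlongrightarrow> z + of_real 0) ?F" by (intro tendsto_intros)
    thus "((\<lambda>t. z + of_real t) \<longlongrightarrow> z) ?F" by simp
    show "\<forall>\<^sub>F t in ?F. z + of_real t \<noteq> z"
      using eventually_at_right_less[of "0::real"] by eventually_elim auto
  qed
  have 1: "((\<lambda>t. of_real t * (deriv H (z + of_real t) / H (z + of_real t))) \<longlongrightarrow> of_nat k) ?F"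
    using filterlim_compose[OF k(1) lim] by simp
  have 2: "((\<lambda>t. of_real t / (z + of_real t - 1)) \<longlongrightarrow> (if z = 1 then 1 else 0)) ?F"
  proof (cases "z = 1")
    case True
    have "\<forall>\<^sub>F t in ?F. 1 = complex_of_real t / (z + of_real t - 1)"
      using eventually_at_right_less[of "0::real"] by eventually_elim (auto simp: True)
    thus ?thesis using True by (auto intro: Lim_transform_eventually[OF tendsto_const])
  next
    case False
    have "((\<lambda>t. of_real t / (z + of_real t - 1)) \<longlongrightarrow> of_real 0 / (z + of_real 0 - 1)) ?F"
      using False by (intro tendsto_intros) auto
    thus ?thesis using False by simp
  qed
  have "\<forall>\<^sub>F t in ?F. of_real t * (deriv H (z + of_real t) / H (z + of_real t)) - of_real t / (z + of_real t - 1)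
     = of_real t * (deriv (dseries a) (z + of_real t) / dseries a (z + of_real t))"
    using eventually_at_right_less[of "0::real"]
  proof eventually_elim
    case (elim t)
    define w where "w = z + of_real t"
    have w: "Re w > 1" using z elim by (auto simp: w_def)
    have w1: "w \<noteq> 1" using w by auto
    have "((\<lambda>s. (s - 1) * dseries a s) has_field_derivative (dseries a w + (w - 1) * deriv (dseries a) w)) (at w)"
      by (rule derivative_eq_intros dseries_has_derivative(2)[of a, OF bounded_mult_growth(1)[OF a] w] refl | simp)+
    hence "(H has_field_derivative (dseries a w + (w - 1) * deriv (dseries a) w)) (at w)"
      by (rule has_field_derivative_transform_within_open[OF _ open_halfspace_Re_gt[of 1]])
         (use w H in auto)
    hence "deriv H w = dseries a w + (w - 1) * deriv (dseries a) w" by (rule DERIV_imp_deriv)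
    thus ?case unfolding w_def[symmetric] H[OF w] using w1 dseries_nonzero[OF a w]
      by (simp add: divide_simps) (simp add: algebra_simps)
  qed
  from Lim_transform_eventually[OF tendsto_diff[OF 1 2] this] k(2) show ?thesis by blast
qed

text \<open>The logarithmic derivatives are minus the series with coefficients \<open>\<Lambda>\<close>, \<open>a \<Lambda>\<close> and \<open>a\<^sup>2 \<Lambda>\<close>.
  Each term of the combined series is a non-negative multiple of \<open>Re (3 + 4 w + w\<^sup>2)\<close> with
  \<open>w = 0\<close> or \<open>|w| = 1\<close>; in the latter case this is \<open>2 (1 + Re w)\<^sup>2\<close>.\<close>

lemma mertens_positivity:
  assumes a: "bounded_mult a" and u: "\<And>n. a n = 0 \<or> norm (a n) = 1" and t: "t > 0"
  shows "Re (3 * (deriv (dseries (\<lambda>_. 1)) (1 + of_real t) / dseries (\<lambda>_. 1) (1 + of_real t))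
       + 4 * (deriv (dseries a) (1 + \<i> * of_real y + of_real t) / dseries a (1 + \<i> * of_real y + of_real t))
       + deriv (dseries (\<lambda>n. (a n)\<^sup>2)) (1 + 2 * \<i> * of_real y + of_real t) / dseries (\<lambda>n. (a n)\<^sup>2) (1 + 2 * \<i> * of_real y + of_real t)) \<le> 0"
proof -
  have a2: "bounded_mult (\<lambda>n. (a n)\<^sup>2)"
    using a by (auto simp: bounded_mult_def power_mult_distrib norm_power power_le_one)
  note one = bounded_mult_one
  define s1 s2 s3 :: complex where "s1 = 1 + of_real t" and "s2 = 1 + \<i> * of_real y + of_real t"
    and "s3 = 1 + 2 * \<i> * of_real y + of_real t"
  have s: "Re s1 > 1" "Re s2 > 1" "Re s3 > 1" using t by (auto simp: s1_def s2_def s3_def)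
  have S: "(\<lambda>n. b (Suc n) * mangoldt (Suc n) / of_nat (Suc n) powr s) sums (- (deriv (dseries b) s / dseries b s))"
    if "bounded_mult b" "Re s > 1" for b s
    using dseries_sums[of "\<lambda>n. b n * mangoldt n", OF bounded_mult_growth(2)[OF that(1)] that(2)]
      logderiv_dseries[OF that] by simp
  let ?T = "\<lambda>n. Re (3 * (1 * mangoldt (Suc n) / of_nat (Suc n) powr s1)
     + 4 * (a (Suc n) * mangoldt (Suc n) / of_nat (Suc n) powr s2)
     + ((a (Suc n))\<^sup>2 * mangoldt (Suc n) / of_nat (Suc n) powr s3))"
  have sums: "?T sums Re (3 * - (deriv (dseries (\<lambda>_. 1)) s1 / dseries (\<lambda>_. 1) s1)
      + 4 * - (deriv (dseries a) s2 / dseries a s2)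
      + - (deriv (dseries (\<lambda>n. (a n)\<^sup>2)) s3 / dseries (\<lambda>n. (a n)\<^sup>2) s3))"
    by (intro sums_Re sums_add sums_mult S[OF one s(1)] S[OF a s(2)] S[OF a2 s(3)])
  have "?T n \<ge> 0" for n
  proof -
    define N where "N = Suc n"
    define w where "w = a N / of_nat N powr (\<i> * of_real y)"
    define c where "c = mangoldt N / real N powr (1 + t)"
    have N: "N > 0" by (simp add: N_def)
    have c: "c \<ge> 0" by (simp add: c_def mangoldt_nonneg)
    have p1: "of_nat N powr s1 = of_real (real N powr (1 + t))"
      using N by (simp add: s1_def powr_of_real [symmetric])
    have "norm w = norm (a N)" using N by (simp add: w_def norm_divide norm_powr_real_powr)
    hence w: "w = 0 \<or> norm w = 1" using u[of N] by auto
    have p2: "of_nat N powr s2 = of_nat N powr s1 * of_nat N powr (\<i> * of_real y)"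
      by (simp add: s1_def s2_def powr_add mult_ac)
    have p3: "of_nat N powr s3 = of_nat N powr s1 * (of_nat N powr (\<i> * of_real y))\<^sup>2"
      using N by (simp add: s1_def s3_def powr_def power2_eq_square algebra_simps flip: exp_add)
    have "3 * (1 * mangoldt N / of_nat N powr s1)
      + 4 * (a N * mangoldt N / of_nat N powr s2) + ((a N)\<^sup>2 * mangoldt N / of_nat N powr s3)
      = of_real c * (3 + 4 * w + w\<^sup>2)"
      unfolding p2 p3 unfolding p1 c_def w_def using N
      by (simp add: field_simps power2_eq_square)
    moreover have "Re (3 + 4 * w + w\<^sup>2) \<ge> 0" using w
    proof
      assume "norm w = 1"
      hence "(Re w)\<^sup>2 + (Im w)\<^sup>2 = 1" by (metis cmod_power2 one_power2)
      hence "Re (3 + 4 * w + w\<^sup>2) = 2 * (1 + Re w)\<^sup>2"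
        by (simp add: power2_eq_square algebra_simps)
      thus ?thesis by simp
    qed simp
    ultimately show ?thesis using c unfolding N_def[symmetric] by simp
  qed
  hence "0 \<le> suminf ?T" using sums by (intro suminf_nonneg) (auto simp: sums_iff)
  thus ?thesis using sums unfolding s1_def [symmetric] s2_def [symmetric] s3_def [symmetric]
    by (simp add: sums_iff)
qed

text \<open>Multiply the inequality by \<open>t\<close> and let \<open>t\<close> tend to \<open>0\<close>. The zeta function contributes \<open>-3\<close>,
  a zero of order \<open>k\<close> contributes \<open>4 k\<close>, and the third factor, having no pole at
  \<open>1 + 2 i y\<close> with \<open>y \<noteq> 0\<close>, a non-negative number. Hence \<open>4 k \<le> 3\<close>.\<close>

lemma nonvanishing_line_one:
  assumes a: "bounded_mult a" and u: "\<And>n. a n = 0 \<or> norm (a n) = 1"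
    and q: "q \<ge> 1" and per: "\<And>n. a (n + q) = a n"
    and hol: "H holomorphic_on UNIV" and H: "\<And>s. Re s > 1 \<Longrightarrow> H s = (s - 1) * dseries a s"
    and y: "y \<noteq> 0"
  shows "H (1 + \<i> * of_real y) \<noteq> 0"
proof -
  have a2: "bounded_mult (\<lambda>n. (a n)\<^sup>2)"
    using a by (auto simp: bounded_mult_def power_mult_distrib norm_power power_le_one)
  note one = bounded_mult_one
  obtain H1 where H1: "H1 holomorphic_on UNIV" "H1 1 = 1" "\<And>s. Re s > 1 \<Longrightarrow> H1 s = (s - 1) * dseries (\<lambda>_. 1) s"
    using periodic_dseries_entire[of 1 "\<lambda>_. 1"] by auto
  obtain H2 where H2: "H2 holomorphic_on UNIV" "\<And>s. Re s > 1 \<Longrightarrow> H2 s = (s - 1) * dseries (\<lambda>n. (a n)\<^sup>2) s"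
    using periodic_dseries_entire[OF q, of "\<lambda>n. (a n)\<^sup>2"] per a2 by (auto simp: bounded_mult_def)
  obtain k1 where k1: "((\<lambda>t. of_real t * (deriv (dseries (\<lambda>_. 1)) (1 + of_real t) / dseries (\<lambda>_. 1) (1 + of_real t)))
            \<longlongrightarrow> of_nat k1 - 1) (at_right (0::real))" "k1 = 0"
    using dseries_logderiv_limit[OF one H1(1,3), of 1] H1(2) by auto
  obtain k where k: "((\<lambda>t. of_real t * (deriv (dseries a) (1 + \<i> * of_real y + of_real t) / dseries a (1 + \<i> * of_real y + of_real t)))
            \<longlongrightarrow> of_nat k) (at_right (0::real))" "k = 0 \<longleftrightarrow> H (1 + \<i> * of_real y) \<noteq> 0"
    using dseries_logderiv_limit[OF a hol H, of "1 + \<i> * of_real y"] y by (auto simp: complex_eq_iff)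
  obtain k2 where k2: "((\<lambda>t. of_real t * (deriv (dseries (\<lambda>n. (a n)\<^sup>2)) (1 + 2 * \<i> * of_real y + of_real t) / dseries (\<lambda>n. (a n)\<^sup>2) (1 + 2 * \<i> * of_real y + of_real t)))
            \<longlongrightarrow> of_nat k2) (at_right (0::real))"
    using dseries_logderiv_limit[OF a2 H2, of "1 + 2 * \<i> * of_real y"] y by (auto simp: complex_eq_iff)
  let ?A = "\<lambda>t. deriv (dseries (\<lambda>_. 1)) (1 + of_real t) / dseries (\<lambda>_. 1) (1 + of_real t)"
  let ?B = "\<lambda>t. deriv (dseries a) (1 + \<i> * of_real y + of_real t) / dseries a (1 + \<i> * of_real y + of_real t)"
  let ?C = "\<lambda>t. deriv (dseries (\<lambda>n. (a n)\<^sup>2)) (1 + 2 * \<i> * of_real y + of_real t) / dseries (\<lambda>n. (a n)\<^sup>2) (1 + 2 * \<i> * of_real y + of_real t)"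
  have "((\<lambda>t. Re (3 * (of_real t * ?A t) + 4 * (of_real t * ?B t) + of_real t * ?C t))
     \<longlongrightarrow> Re (3 * (of_nat k1 - 1) + 4 * of_nat k + of_nat k2)) (at_right (0::real))"
    by (intro tendsto_Re tendsto_add tendsto_mult[OF tendsto_const] k1(1) k(1) k2)
  moreover have "\<forall>\<^sub>F t in at_right (0::real). Re (3 * (of_real t * ?A t) + 4 * (of_real t * ?B t) + of_real t * ?C t) \<le> 0"
    using eventually_at_right_less[of "0::real"]
  proof eventually_elim
    case (elim t)
    have "t * Re (3 * ?A t + 4 * ?B t + ?C t) \<le> 0"
      using mertens_positivity[OF a u elim, of y] elim by (intro mult_nonneg_nonpos) auto
    also have "t * Re (3 * ?A t + 4 * ?B t + ?C t) = Re (of_real t * (3 * ?A t + 4 * ?B t + ?C t))"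
      by simp
    also have "of_real t * (3 * ?A t + 4 * ?B t + ?C t) = 3 * (of_real t * ?A t) + 4 * (of_real t * ?B t) + of_real t * ?C t"
      by (simp only: distrib_left mult_ac)
    finally show ?case .
  qed
  ultimately have "Re (3 * (of_nat k1 - 1) + 4 * of_nat k + of_nat k2) \<le> 0"
    by (intro tendsto_upperbound) auto
  hence "k = 0" using k1(2) by simp
  thus ?thesis using k(2) by simp
qed

section \<open>Summation by parts: the half-plane of conditional convergence\<close>

lemma sum_by_parts:
  fixes a b :: "nat \<Rightarrow> 'a :: comm_ring_1"
  shows "(\<Sum>n<N. a n * b n) = (\<Sum>n<N. (\<Sum>j\<le>n. a j) * (b n - b (Suc n))) + (\<Sum>j<N. a j) * b N"
  by (induction N) (simp_all add: algebra_simps lessThan_Suc_atMost[symmetric])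

lemma sums_by_parts:
  fixes a b :: "nat \<Rightarrow> complex"
  assumes bd: "\<And>N. norm (\<Sum>j<N. a j) \<le> B" and b: "b \<longlonglongrightarrow> 0"
    and s: "(\<lambda>n. (\<Sum>j\<le>n. a j) * (b n - b (Suc n))) sums x"
  shows "(\<lambda>n. a n * b n) sums x"
proof -
  have "(\<lambda>N. (\<Sum>j<N. a j) * b N) \<longlonglongrightarrow> 0"
  proof (rule Lim_null_comparison)
    show "\<forall>\<^sub>F N in sequentially. norm ((\<Sum>j<N. a j) * b N) \<le> B * norm (b N)"
      by (intro always_eventually allI) (simp add: norm_mult mult_right_mono bd)
    show "(\<lambda>N. B * norm (b N)) \<longlonglongrightarrow> 0" using tendsto_mult_right_zero[OF tendsto_norm_zero[OF b]] .
  qed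
  from tendsto_add[OF s[unfolded sums_def] this] show ?thesis
    unfolding sums_def sum_by_parts[symmetric] by simp
qed

lemma norm_powr_diff_le:
  assumes s: "Re s > 0"
  shows "norm (of_nat (Suc n) powr (- s) - of_nat (Suc (Suc n)) powr (- s)) \<le> norm s * real (Suc n) powr (- Re s - 1)"
proof -
  let ?x = "of_real (real (Suc n)) :: complex" and ?y = "of_real (real (Suc (Suc n))) :: complex"
  have "norm (?x powr (- s) - ?y powr (- s)) \<le> norm s * real (Suc n) powr (- Re s - 1) * norm (?x - ?y)"
  proof (rule field_differentiable_bound[of "closed_segment ?x ?y" _ "\<lambda>u. - s * u powr (- s - 1)"])
    fix u assume "u \<in> closed_segment ?x ?y"
    then obtain t where t: "u = of_real t" "t \<ge> real (Suc n)"
      unfolding closed_segment_of_real by (auto simp: closed_segment_eq_real_ivl)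
    have "u \<notin> \<real>\<^sub>\<le>\<^sub>0" using t by (auto simp: complex_nonpos_Reals_iff)
    thus "((\<lambda>u. u powr (- s)) has_field_derivative - s * u powr (- s - 1)) (at u within closed_segment ?x ?y)"
      by (auto intro!: derivative_eq_intros)
    have "norm (- s * u powr (- s - 1)) = norm s * t powr (- Re s - 1)"
      using t by (simp add: norm_mult norm_powr_real_powr)
    also have "\<dots> \<le> norm s * real (Suc n) powr (- Re s - 1)"
      using t s by (intro mult_left_mono powr_mono2') auto
    finally show "norm (- s * u powr (- s - 1)) \<le> norm s * real (Suc n) powr (- Re s - 1)" .
  qed auto
  also have "norm (?x - ?y) = 1" by simp
  finally show ?thesis by simp
qed

text \<open>After summation by parts the series converges locally uniformly for \<open>Re s > 0\<close>; there it
  agrees with the entire function \<open>L\<close> by uniqueness of analytic continuation.\<close>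

lemma bounded_partial_sums_dseries:
  fixes a :: "nat \<Rightarrow> complex"
  assumes bd: "\<And>N. norm (\<Sum>j<N. a (Suc j)) \<le> B"
    and hol: "L holomorphic_on UNIV" and L: "\<And>s. Re s > 1 \<Longrightarrow> (\<lambda>n. a (Suc n) / of_nat (Suc n) powr s) sums L s"
    and s: "Re s > 0"
  shows "(\<lambda>n. (\<Sum>j\<le>n. a (Suc j)) * (of_nat (Suc n) powr (- s) - of_nat (Suc (Suc n)) powr (- s))) sums L s"
proof -
  let ?S = "{s. Re s > 0}"
  let ?f = "\<lambda>n s. (\<Sum>j\<le>n. a (Suc j)) * (of_nat (Suc n) powr (- s) - of_nat (Suc (Suc n)) powr (- s))"
  have B: "B \<ge> 0" using bd[of 0] by simp
  have bd': "norm (\<Sum>j\<le>n. a (Suc j)) \<le> B" for n using bd[of "Suc n"] by (simp add: lessThan_Suc_atMost)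
  have op: "open ?S" by (rule open_halfspace_Re_gt)
  have hf: "?f n holomorphic_on UNIV" for n
    by (intro holomorphic_intros) (auto simp del: of_nat_Suc)
  have "\<exists>g g'. \<forall>z \<in> ?S. ((\<lambda>n. ?f n z) sums g z) \<and> ((\<lambda>n. deriv (?f n) z) sums g' z)
          \<and> (g has_field_derivative g' z) (at z)"
  proof (rule series_and_derivative_comparison_local[OF op])
    fix n z assume "z \<in> ?S"
    show "(?f n has_field_derivative deriv (?f n) z) (at z)"
      by (rule holomorphic_derivI[OF hf]) auto
  next
    fix z assume z: "z \<in> ?S"
    define d where "d = Re z / 2"
    have d: "d > 0" using z by (simp add: d_def)
    let ?h = "\<lambda>n. B * ((norm z + d) * real (Suc n) powr (- d - 1))"
    have "norm (?f n w) \<le> ?h n" if w: "w \<in> ball z d" for w n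
    proof -
      have nd: "norm (z - w) < d" using w by (simp add: dist_norm)
      have "Re (z - w) < d" using nd complex_Re_le_cmod[of "z - w"] by linarith
      hence rw: "d \<le> Re w" by (simp add: d_def)
      have nw: "norm w \<le> norm z + d" using nd norm_triangle_ineq2[of w z] by (simp add: norm_minus_commute)
      have "norm (?f n w) \<le> B * (norm w * real (Suc n) powr (- Re w - 1))"
        unfolding norm_mult using bd'[of n] norm_powr_diff_le[of w n] rw d B by (intro mult_mono) auto
      also have "\<dots> \<le> ?h n"
        using nw rw B d by (intro mult_left_mono mult_mono powr_mono) auto
      finally show ?thesis .
    qed
    moreover have "summable (\<lambda>n. real n powr (- d - 1))" using d by (simp add: summable_real_powr_iff)
    hence "summable (\<lambda>n. real (Suc n) powr (- d - 1))" by (subst summable_Suc_iff)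
    hence "summable ?h" by (intro summable_mult)
    ultimately show "\<exists>d h. 0 < d \<and> summable h \<and> (\<forall>\<^sub>F n in sequentially. \<forall>y\<in>ball z d \<inter> ?S. norm (?f n y) \<le> h n)"
      using d by (intro exI[of _ d] exI[of _ ?h] conjI always_eventually) auto
  qed
  then obtain g g' where g: "\<And>z. z \<in> ?S \<Longrightarrow> (\<lambda>n. ?f n z) sums g z" 
     "\<And>z. z \<in> ?S \<Longrightarrow> (g has_field_derivative g' z) (at z)"
    by blast
  have hg: "g holomorphic_on ?S" using g(2) holomorphic_on_open[OF op, of g] by blast
  have "g z = L z" if z: "z \<in> {s. Re s > 1}" for z
  proof -
    have "(\<lambda>n. of_nat (Suc n) powr (- z)) \<longlonglongrightarrow> 0"
    proof (rule Lim_null_comparison)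
      show "\<forall>\<^sub>F n in sequentially. norm (of_nat (Suc n) powr (- z) :: complex) \<le> real (Suc n) powr (- Re z)"
        by (intro always_eventually allI) (simp add: norm_powr_real_powr del: of_nat_Suc)
      show "(\<lambda>n. real (Suc n) powr (- Re z)) \<longlonglongrightarrow> 0"
        by (rule tendsto_neg_powr[OF _ filterlim_compose[OF filterlim_real_sequentially filterlim_Suc]]) (use z in auto)
    qed
    from sums_by_parts[OF bd this g(1)[of z]] have "(\<lambda>n. a (Suc n) * of_nat (Suc n) powr (- z)) sums g z"
      using z by simp
    thus ?thesis using L[of z] z by (simp add: powr_minus_divide sums_iff del: of_nat_Suc)
  qed
  have "g s = L s"
  proof (rule analytic_continuation_open[of "{s. Re s > 1}" ?S g L])
    have "2 \<in> {s. Re s > 1}" by simp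
    thus "{s. Re s > 1} \<noteq> {}" by blast
    show "open {s. Re s > 1}" "open ?S" by (rule open_halfspace_Re_gt)+
    show "connected ?S" by (intro convex_connected convex_halfspace_Re_gt)
    show "L holomorphic_on ?S" by (rule holomorphic_on_subset[OF hol]) simp
    show "s \<in> ?S" using s by simp
    show "\<And>z. z \<in> {s. Re s > 1} \<Longrightarrow> g z = L z" by fact
  qed (use hg in auto)
  thus ?thesis using g(1)[of s] s by simp
qed

text \<open>The constant depends neither on the coefficients nor on \<open>B\<close>, so for characters modulo \<open>q\<close>
  the bound is linear in \<open>q\<close>. In the disc, \<open>Re s \<ge> 2/3\<close> and \<open>|s| \<le> 4\<close>.\<close>

lemma bounded_partial_sums_dseries_le:
  "\<exists>C>0. \<forall>a B L s. (\<forall>N. norm (\<Sum>j<N. a (Suc j)) \<le> B) \<longrightarrow> L holomorphic_on UNIV \<longrightarrow>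
    (\<forall>s. Re s > 1 \<longrightarrow> (\<lambda>n. a (Suc n) / of_nat (Suc n) powr s) sums L s) \<longrightarrow> s \<in> ball (2::complex) (4/3)
    \<longrightarrow> norm (L s :: complex) \<le> C * B"
proof -
  let ?t = "\<lambda>n. 4 * real (Suc n) powr (- 2/3 - 1)"
  have "summable (\<lambda>n. real n powr (- 2/3 - 1))" by (simp add: summable_real_powr_iff)
  hence "summable (\<lambda>n. real (Suc n) powr (- 2/3 - 1))" by (subst summable_Suc_iff)
  hence sm: "summable ?t" by (intro summable_mult)
  have "norm (L s) \<le> (suminf ?t) * B"
    if bd: "\<And>N. norm (\<Sum>j<N. a (Suc j)) \<le> B" and hol: "L holomorphic_on UNIV"
    and L: "\<And>s. Re s > 1 \<Longrightarrow> (\<lambda>n. a (Suc n) / of_nat (Suc n) powr s) sums L s" 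
    and s: "s \<in> ball (2::complex) (4/3)" for a B and L :: "complex \<Rightarrow> complex" and s
  proof -
    let ?f = "\<lambda>n s. (\<Sum>j\<le>n. a (Suc j)) * (of_nat (Suc n) powr (- s) - of_nat (Suc (Suc n)) powr (- s))"
    have B: "B \<ge> 0" using bd[of 0] by simp
    have bd': "norm (\<Sum>j\<le>n. a (Suc j)) \<le> B" for n using bd[of "Suc n"] by (simp add: lessThan_Suc_atMost)
    have ns: "norm (2 - s) < 4/3" using s by (simp add: dist_norm)
    have rs: "Re s \<ge> 2/3" using ns abs_Re_le_cmod[of "2 - s"] by simp
    have s4: "norm s \<le> 4" using ns norm_triangle_ineq2[of s 2] by (simp add: norm_minus_commute)
    have sums: "(\<lambda>n. ?f n s) sums L s"
      by (rule bounded_partial_sums_dseries[OF bd hol L]) (use rs in auto)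
    have "norm (suminf (\<lambda>n. ?f n s)) \<le> (\<Sum>n. ?t n * B)"
    proof (rule norm_suminf_le[OF _ summable_mult2[OF sm]])
      fix n
      have "norm (?f n s) \<le> B * (norm s * real (Suc n) powr (- Re s - 1))"
        unfolding norm_mult using bd'[of n] norm_powr_diff_le[of s n] rs B by (intro mult_mono) auto
      also have "\<dots> \<le> B * ?t n"
        using rs s4 B by (intro mult_left_mono mult_mono powr_mono) auto
      finally show "norm (?f n s) \<le> ?t n * B" by (simp only: mult.commute)
    qed
    thus ?thesis using sums suminf_mult2[OF sm, of B] by (simp add: sums_iff)
  qed
  moreover have "suminf ?t > 0" using sm by (intro suminf_pos) auto
  ultimately show ?thesis by blast
qed

text \<open>After summation by parts, the terms are bounded by a multiple of \<open>1/(n + 1)\<^sup>2\<close> uniformly in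
  \<open>0 \<le> r \<le> 1\<close>: the only critical part \<open>r\<^sup>n (1 - r)\<close> is at most \<open>1/n\<close>. So the sum is
  continuous up to \<open>r = 1\<close>, where it is the series of \<open>bounded_partial_sums_dseries\<close> at \<open>s = 1\<close>.\<close>

lemma abel_mean_tendsto:
  fixes a :: "nat \<Rightarrow> complex"
  assumes bd: "\<And>N. norm (\<Sum>j<N. a (Suc j)) \<le> B"
    and hol: "L holomorphic_on UNIV" and L: "\<And>s. Re s > 1 \<Longrightarrow> (\<lambda>n. a (Suc n) / of_nat (Suc n) powr s) sums L s"
  shows "((\<lambda>r::real. \<Sum>n. a (Suc n) * (of_real r ^ Suc n / of_nat (Suc n))) \<longlongrightarrow> L 1) (at_left 1)"
proof -
  let ?S = "\<lambda>n. (\<Sum>j\<le>n. a (Suc j))"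
  let ?b = "\<lambda>n r. r ^ Suc n / real (Suc n)"
  let ?f = "\<lambda>n r. ?S n * of_real (?b n r - ?b (Suc n) r)"
  have B: "B \<ge> 0" using bd[of 0] by simp
  have bd': "norm (?S n) \<le> B" for n using bd[of "Suc n"] by (simp add: lessThan_Suc_atMost)
  \<comment> \<open>the uniform majorant for the M-test\<close>
  let ?h = "\<lambda>n. B * (2 * (1 / real (Suc n) ^ 2))"
  have diff: "\<bar>?b n r - ?b (Suc n) r\<bar> \<le> 2 * (1 / real (Suc n) ^ 2)" if r: "r \<in> {0..1}" for n r
  proof -
    have "real (Suc n) * r ^ Suc n \<le> (\<Sum>k<Suc n. r ^ k)"
    proof -
      have "(\<Sum>k<Suc n. r ^ Suc n) \<le> (\<Sum>k<Suc n. r ^ k)"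
        using r by (intro sum_mono power_decreasing) auto
      thus ?thesis by simp
    qed
    hence "(1 - r) * (real (Suc n) * r ^ Suc n) \<le> (1 - r) * (\<Sum>k<Suc n. r ^ k)"
      using r by (intro mult_left_mono) auto
    also have "\<dots> = 1 - r ^ Suc n" by (simp only: one_diff_power_eq)
    also have "\<dots> \<le> 1" using r by simp
    finally have 1: "r ^ Suc n * (1 - r) \<le> 1 / real (Suc n)" by (simp add: field_simps)
    have 2: "r ^ Suc n * (1 / real (Suc n) - 1 / real (Suc (Suc n))) \<le> 1 * (1 / real (Suc n) - 1 / real (Suc (Suc n)))"
      using r by (intro mult_right_mono power_le_one) (auto simp: field_simps)
    have 3: "1 / real (Suc n) - 1 / real (Suc (Suc n)) \<le> 1 / real (Suc n) ^ 2"
    proof -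
      have "1 / real (Suc n) - 1 / real (Suc (Suc n)) = 1 / (real (Suc n) * real (Suc (Suc n)))"
        by (simp add: field_simps)
      also have "\<dots> \<le> 1 / (real (Suc n) * real (Suc n))"
        by (intro frac_le mult_left_mono mult_pos_pos) auto
      finally show ?thesis by (simp only: power2_eq_square)
    qed
    have 4: "r ^ Suc n * (1 - r) / real (Suc (Suc n)) \<le> 1 / real (Suc n) ^ 2"
    proof -
      have "r ^ Suc n * (1 - r) / real (Suc (Suc n)) \<le> 1 / real (Suc n) / real (Suc n)"
        using 1 r by (intro frac_le) auto
      thus ?thesis by (simp add: power2_eq_square)
    qed
    have eq: "?b n r - ?b (Suc n) r = r ^ Suc n * (1 / real (Suc n) - 1 / real (Suc (Suc n))) + r ^ Suc n * (1 - r) / real (Suc (Suc n))"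
      by (simp add: field_simps del: of_nat_Suc)
    have "0 \<le> r ^ Suc n * (1 / real (Suc n) - 1 / real (Suc (Suc n)))" "0 \<le> r ^ Suc n * (1 - r) / real (Suc (Suc n))"
      using r by (intro mult_nonneg_nonneg divide_nonneg_nonneg; simp add: frac_le)+
    moreover have "\<bar>u + v\<bar> \<le> 2 * c" if "0 \<le> u" "0 \<le> v" "u \<le> 1 * x" "x \<le> c" "v \<le> c" for u v x c :: real
      using that by simp
    ultimately show ?thesis unfolding eq using 2 3 4 by blast
  qed
  have bnd: "norm (?f n r) \<le> ?h n" if r: "r \<in> {0..1}" for n r
    unfolding norm_mult norm_of_real using bd'[of n] diff[OF r, of n] B by (intro mult_mono) auto
  have "summable (\<lambda>n. 1 / real (Suc n) ^ 2)" using inverse_squares_sums by (simp add: sums_iff)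
  hence sm: "summable ?h" by (intro summable_mult)
  have ul: "uniform_limit {0..1} (\<lambda>N r. \<Sum>n<N. ?f n r) (\<lambda>r. \<Sum>n. ?f n r) sequentially"
    by (rule Weierstrass_m_test[OF bnd sm])
  have cont: "continuous_on {0..1} (\<lambda>r. \<Sum>n. ?f n r)"
    by (rule uniform_limit_theorem[OF _ ul]) (auto intro!: continuous_intros always_eventually simp del: of_nat_Suc)
  have "((\<lambda>r. \<Sum>n. ?f n r) \<longlongrightarrow> (\<Sum>n. ?f n 1)) (at 1 within {0..1})"
    using cont unfolding continuous_on_def by (rule bspec) simp
  hence lim: "((\<lambda>r. \<Sum>n. ?f n r) \<longlongrightarrow> (\<Sum>n. ?f n 1)) (at_left 1)"
    by (simp add: at_within_Icc_at_left)
  have fsums: "(\<lambda>n. ?f n r) sums (\<Sum>n. ?f n r)" if "r \<in> {0..1}" for r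
    by (rule summable_sums, rule summable_comparison_test'[OF sm]) (use bnd that in auto)
  have "(\<lambda>n. ?S n * (of_nat (Suc n) powr (- 1) - of_nat (Suc (Suc n)) powr (- 1))) sums L 1"
    by (rule bounded_partial_sums_dseries[OF bd hol L]) auto
  moreover have "(\<lambda>n. ?S n * (of_nat (Suc n) powr (- 1) - of_nat (Suc (Suc n)) powr (- 1))) = (\<lambda>n. ?f n 1)"
    by (simp add: powr_minus_divide del: of_nat_Suc)
  ultimately have L1: "(\<Sum>n. ?f n 1) = L 1" by (simp add: sums_iff)
  have "(\<Sum>n. a (Suc n) * (of_real r ^ Suc n / of_nat (Suc n))) = (\<Sum>n. ?f n r)" if r: "r \<in> {0<..<1}" for r
  proof -
    have "(\<lambda>n. complex_of_real (?b n r)) \<longlonglongrightarrow> 0"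
    proof (rule Lim_null_comparison)
      show "\<forall>\<^sub>F n in sequentially. norm (complex_of_real (?b n r)) \<le> r ^ n"
      proof (intro always_eventually allI)
        fix n
        have "r ^ Suc n / real (Suc n) \<le> r ^ n / 1" using r by (intro frac_le) (auto simp: mult_le_cancel_right1)
        thus "norm (complex_of_real (?b n r)) \<le> r ^ n" using r by (simp only: norm_of_real) simp
      qed
      show "(\<lambda>n. r ^ n) \<longlonglongrightarrow> 0" using r by (intro LIMSEQ_realpow_zero) auto
    qed
    from sums_by_parts[OF bd this, of "\<Sum>n. ?f n r"] fsums[of r] r
    have "(\<lambda>n. a (Suc n) * complex_of_real (?b n r)) sums (\<Sum>n. ?f n r)" by simp
    thus ?thesis by (simp add: sums_iff)
  qed
  hence "\<forall>\<^sub>F r in at_left 1. (\<Sum>n. ?f n r) = (\<Sum>n. a (Suc n) * (of_real r ^ Suc n / of_nat (Suc n)))"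
    using eventually_at_left_real[of 0 1] by (auto elim!: eventually_mono)
  from Lim_transform_eventually[OF lim this] show ?thesis unfolding L1 .
qed

section \<open>A bound at the point one from a zero-free disc\<close>

text \<open>The map \<open>u \<mapsto> u / (2 A - u)\<close> sends the half-plane \<open>Re u < A\<close> into the unit disc and
  fixes \<open>0\<close>, so the Schwarz lemma applies to its composition with \<open>f\<close>.\<close>

lemma borel_caratheodory:
  assumes hol: "f holomorphic_on ball c R" and f0: "f c = 0" and A: "A > 0"
    and le: "\<And>z. z \<in> ball c R \<Longrightarrow> Re (f z) < A" and r: "norm (z - c) \<le> r" "0 < r" "r < R"
  shows "norm (f z) \<le> 2 * A * r / (R - r)"
proof -
  have R: "R > 0" using r by simp
  define g where "g = (\<lambda>w. f (c + of_real R * w) / (of_real (2 * A) - f (c + of_real R * w)))"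
  have inb: "c + of_real R * w \<in> ball c R" if "norm w < 1" for w
    using that R by (simp add: dist_norm norm_mult)
  have less: "norm (f v) < norm (of_real (2 * A) - f v)" if "v \<in> ball c R" for v
  proof -
    have "(Re (f v))\<^sup>2 < (2 * A - Re (f v))\<^sup>2"
      using le[OF that] A by (simp add: power2_eq_square algebra_simps)
    hence "(norm (f v))\<^sup>2 < (norm (of_real (2 * A) - f v))\<^sup>2"
      by (simp add: cmod_power2)
    thus ?thesis by (rule power2_less_imp_less) simp
  qed
  have hg: "g holomorphic_on ball 0 1" unfolding g_def
  proof (intro holomorphic_intros holomorphic_on_compose_gen[OF _ hol, unfolded o_def])
    fix w :: complex assume "w \<in> ball 0 1"
    thus "of_real (2 * A) - f (c + of_real R * w) \<noteq> 0" using less[OF inb[of w]] by auto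
  qed (use inb in auto)
  have g1: "norm (g w) < 1" if "norm w < 1" for w
    using less[OF inb[OF that]] unfolding g_def norm_divide
    by (subst divide_less_eq_1_pos) (use norm_ge_zero le_less_trans in blast)+
  define w where "w = (z - c) / of_real R"
  have zw: "z = c + of_real R * w" using R by (simp add: w_def)
  have nw: "norm w = norm (z - c) / R" using R by (simp add: w_def norm_divide)
  have w1: "norm w < 1" using r R by (simp add: nw)
  have gw: "norm (g w) \<le> norm w"
    using Schwarz_Lemma(1)[OF hg _ g1 w1] f0 by (simp add: g_def)
  have ne: "of_real (2 * A) - f z \<noteq> 0" using less[OF inb[OF w1]] zw by auto
  have "g w * (of_real (2 * A) - f z) = f z" using ne by (simp add: g_def zw)
  hence "norm (f z) = norm (g w) * norm (of_real (2 * A) - f z)" by (metis norm_mult)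
  also have "\<dots> \<le> norm w * (2 * A + norm (f z))"
    using gw norm_triangle_ineq4[of "of_real (2 * A)" "f z"] A by (intro mult_mono) auto
  finally have "norm (f z) \<le> norm (z - c) / R * (2 * A + norm (f z))" by (simp add: nw)
  also have "\<dots> \<le> r / R * (2 * A + norm (f z))"
    using r A R by (intro mult_right_mono divide_right_mono) auto
  finally show ?thesis using r R by (simp add: field_simps)
qed

text \<open>A weak form of Hadamard's three circles theorem with an integral exponent: apply the maximum
  principle to \<open>f(z) / z\<^sup>N\<close> on the annulus.\<close>

lemma three_circles_power:
  assumes hol: "f holomorphic_on ball 0 R" and r: "0 < r1" "r1 < r3" "r3 < R"
    and B1: "\<And>z. norm z = r1 \<Longrightarrow> norm (f z) \<le> B"
    and B3: "\<And>z. norm z = r3 \<Longrightarrow> norm (f z) \<le> B * (r3 / r1) ^ N"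
    and z: "r1 \<le> norm z" "norm z \<le> r3"
  shows "norm (f z) \<le> B * (norm z / r1) ^ N"
proof -
  define S :: "complex set" where "S = cball 0 r3 - ball 0 r1"
  define g where "g = (\<lambda>z. f z / z ^ N)"
  have clS: "closed S" by (auto simp: S_def)
  have S0: "w \<noteq> 0" if "w \<in> S" for w using that r by (auto simp: S_def)
  have hg: "g holomorphic_on S" unfolding g_def
    by (intro holomorphic_intros holomorphic_on_subset[OF hol]) (use r S0 in \<open>auto simp: S_def\<close>)
  have fr: "norm w = r1 \<or> norm w = r3" if w: "w \<in> frontier S" for w
  proof (rule ccontr)
    assume n: "\<not> (norm w = r1 \<or> norm w = r3)"
    have wS: "w \<in> S" using w clS by (auto simp: frontier_def closure_closed)
    have "open (ball 0 r3 - cball 0 r1 :: complex set)" by (intro open_Diff) auto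
    moreover have "ball 0 r3 - cball 0 r1 \<subseteq> S" by (auto simp: S_def)
    ultimately have "ball 0 r3 - cball 0 r1 \<subseteq> interior S" by (rule interior_maximal[rotated])
    moreover have "w \<in> ball 0 r3 - cball 0 r1" using wS n by (auto simp: S_def)
    ultimately show False using w by (auto simp: frontier_def)
  qed
  have "norm (g z) \<le> B / r1 ^ N"
  proof (rule maximum_modulus_frontier[of g S])
    show "g holomorphic_on interior S" using hg interior_subset by (rule holomorphic_on_subset)
    show "continuous_on (closure S) g" using hg clS by (simp add: holomorphic_on_imp_continuous_on)
    show "bounded S" unfolding S_def by (rule bounded_diff) auto
    show "z \<in> S" using z by (auto simp: S_def)
    fix w assume "w \<in> frontier S"
    from fr[OF this] show "norm (g w) \<le> B / r1 ^ N"
    proof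
      assume "norm w = r1"
      thus ?thesis using B1[of w] r by (simp add: g_def norm_divide norm_power divide_right_mono)
    next
      assume w: "norm w = r3"
      have "norm (g w) \<le> B * (r3 / r1) ^ N / r3 ^ N"
        using B3[of w] r w by (simp add: g_def norm_divide norm_power divide_right_mono)
      also have "\<dots> = B / r1 ^ N" using r by (simp add: power_divide)
      finally show ?thesis .
    qed
  qed
  moreover have "z \<noteq> 0" using z r by auto
  ultimately show ?thesis by (simp add: g_def norm_divide norm_power field_simps)
qed

text \<open>The parameter \<open>N\<close> must be so large that \<open>(6/5)\<^sup>N\<close> beats the bound for \<open>L'/L\<close> on the outer
  circle. As \<open>ln (8 M)\<close> will be of the size of \<open>log q\<close>, an \<open>N\<close> of the size of \<open>log log q = 1/e\<close>
  suffices, and then the exponential factor in the conclusion is bounded.\<close>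

lemma littlewood_disc:
  fixes L :: "complex \<Rightarrow> complex"
  assumes hol: "L holomorphic_on UNIV" and nz: "\<And>s. s \<in> ball 2 (3/2) \<Longrightarrow> L s \<noteq> 0"
    and L2: "norm (L 2) \<ge> 1 / 4" and M: "M \<ge> 1" "\<And>s. s \<in> ball 2 (4/3) \<Longrightarrow> norm (L s) \<le> M"
    and e: "0 < e" "e \<le> 1/2" and K: "K \<ge> 1"
    and ld: "\<And>s. Re s \<ge> 1 + e \<Longrightarrow> norm (deriv L s / L s) \<le> K / e"
    and N: "(6/5) ^ N \<ge> 600 * ln (8 * M)"
  shows "norm (L 1) \<le> norm (L (1 + of_real e)) * exp (K * exp (2 * e * real N))"
proof -
  define l where "l = ln (8 * M)"
  have l: "l > 0" using M by (simp add: l_def)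
  have "\<exists>F. F holomorphic_on ball 2 (3/2) \<and> (\<forall>s \<in> ball 2 (3/2). L s = exp (F s))"
    using contractible_imp_holomorphic_log[OF holomorphic_on_subset[OF hol] convex_imp_contractible nz] 
    by (metis convex_ball subset_UNIV)
  then obtain F0 where F0: "F0 holomorphic_on ball 2 (3/2)" "\<And>s. s \<in> ball 2 (3/2) \<Longrightarrow> L s = exp (F0 s)"
    by blast
  define F where "F = (\<lambda>s. F0 s - F0 2)"
  have hF: "F holomorphic_on ball 2 (3/2)" unfolding F_def by (intro holomorphic_intros F0)
  have LF: "L s = L 2 * exp (F s)" if "s \<in> ball 2 (3/2)" for s
    using that F0(2)[of s] F0(2)[of 2] by (simp add: F_def exp_diff)
  have nL2: "L 2 \<noteq> 0" using L2 by auto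
  have ReF: "Re (F s) < l" if s: "s \<in> ball 2 (4/3)" for s
  proof -
    have "1 / 4 * exp (Re (F s)) \<le> norm (L 2) * norm (exp (F s))"
      using L2 by (simp add: mult_right_mono)
    also have "\<dots> = norm (L s)" using s by (subst LF[of s]) (auto simp: norm_mult)
    also have "\<dots> \<le> M" using M(2) s by blast
    also have "M < 2 * M" using M by simp
    finally have "exp (Re (F s)) < 8 * M" by simp
    thus ?thesis using M by (simp add: l_def ln_ge_iff exp_less_cancel_iff flip: ) (metis exp_gt_zero ln_exp ln_less_cancel_iff order.strict_trans)
  qed
  have Fb: "norm (F s) \<le> 30 * l" if s: "s \<in> cball 2 (5/4)" for s
  proof -
    have "norm (F s) \<le> 2 * l * (5/4) / (4/3 - 5/4)"
    proof (rule borel_caratheodory[where f = F and c = 2])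
      show "F holomorphic_on ball 2 (4/3)" by (rule holomorphic_on_subset[OF hF]) auto
    qed (use ReF l s in \<open>auto simp: F_def dist_norm norm_minus_commute\<close>)
    thus ?thesis by simp
  qed
  have dF: "(F has_field_derivative deriv L s / L s) (at s)" if s: "s \<in> ball 2 (3/2)" for s
  proof -
    have D: "(F has_field_derivative deriv F s) (at s)" by (rule holomorphic_derivI[OF hF _ s]) auto
    have "((\<lambda>s. L 2 * exp (F s)) has_field_derivative L 2 * (exp (F s) * deriv F s)) (at s)"
      by (intro DERIV_cmult DERIV_fun_exp D)
    hence "(L has_field_derivative L 2 * (exp (F s) * deriv F s)) (at s)"
      by (rule has_field_derivative_transform_within_open[of _ _ _ "ball 2 (3/2)"]) (use s LF[symmetric] in auto)
    hence "deriv L s = L s * deriv F s" using LF[OF s] by (simp add: DERIV_imp_deriv)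
    thus ?thesis using D nz[OF s] by simp
  qed
  define f where "f = (\<lambda>z. deriv L (2 + z) / L (2 + z))"
  have dist2: "dist 2 (2 + z) = norm z" for z :: complex by (simp add: dist_norm)
  have hf: "f holomorphic_on ball 0 (3/2)" unfolding f_def
    by (intro holomorphic_intros holomorphic_on_compose_gen[OF _ hol, unfolded o_def]
         holomorphic_on_compose_gen[OF _ holomorphic_deriv[OF hol open_UNIV], unfolded o_def])
       (use nz in \<open>auto simp: dist2\<close>)
  have outer: "norm (f z) \<le> 600 * l" if z: "norm z = 6/5" for z
  proof -
    \<comment> \<open>Cauchy's estimate on the circles of radius \<open>5/4 - 6/5 = 1/20\<close>\<close>
    have sub: "cball (2 + z) (1/20) \<subseteq> cball 2 (5/4)"
    proof
      fix w assume "w \<in> cball (2 + z) (1/20)"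
      thus "w \<in> cball 2 (5/4)"
        using dist_triangle[of 2 w "2 + z"] z by (simp add: dist2)
    qed
    have "cball 2 (5/4) \<subseteq> ball (2::complex) (3/2)" by (simp add: cball_subset_ball_iff)
    with sub have sub2: "cball (2 + z) (1/20) \<subseteq> ball 2 (3/2)" by (rule subset_trans)
    have "norm ((deriv ^^ 1) F (2 + z)) \<le> fact 1 * (30 * l) / (1/20) ^ 1"
    proof (rule Cauchy_inequality)
      show "F holomorphic_on ball (2 + z) (1/20)"
        by (rule holomorphic_on_subset[OF hF]) (rule subset_trans[OF ball_subset_cball sub2])
      show "continuous_on (cball (2 + z) (1/20)) F"
        by (rule holomorphic_on_imp_continuous_on, rule holomorphic_on_subset[OF hF sub2])
      fix x assume "norm (2 + z - x) = 1/20"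
      hence "x \<in> cball (2 + z) (1/20)" by (simp add: dist_norm)
      thus "norm (F x) \<le> 30 * l" using sub by (intro Fb) blast
    qed auto
    moreover have "deriv F (2 + z) = f z" using dF[of "2 + z"] z by (simp add: f_def DERIV_imp_deriv dist2)
    ultimately show ?thesis by simp
  qed
  have inner: "norm (f z) \<le> K / e" if "norm z \<le> 1 - e" for z
    unfolding f_def using abs_Re_le_cmod[of z] that by (intro ld) auto
  have disc: "norm (f z) \<le> K / e * exp (2 * e * real N)" if z: "norm z \<le> 1" for z
  proof (cases "norm z \<le> 1 - e")
    case True
    have "K / e * 1 \<le> K / e * exp (2 * e * real N)" using K e by (intro mult_left_mono) auto
    thus ?thesis using inner[OF True] by simp
  next
    case False
    have "norm (f z) \<le> K / e * (norm z / (1 - e)) ^ N"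
    proof (rule three_circles_power[OF hf])
      fix w :: complex assume w: "norm w = 6/5"
      have "600 * l \<le> 1 * (6/5) ^ N" using N by (simp add: l_def)
      also have "\<dots> \<le> K / e * (6/5 / (1 - e)) ^ N"
        using K e by (intro mult_mono power_mono) (auto simp: field_simps)
      finally show "norm (f w) \<le> K / e * (6/5 / (1 - e)) ^ N" using outer[OF w] by simp
    qed (use e z False inner in auto)
    also have "\<dots> \<le> K / e * (exp (2 * e)) ^ N"
    proof (intro mult_left_mono power_mono)
      have "norm z / (1 - e) \<le> 1 / (1 - e)" using z e by (intro divide_right_mono) auto
      also have "\<dots> \<le> 1 + 2 * e" using e by (simp add: field_simps)
      also have "\<dots> \<le> exp (2 * e)" by (rule exp_ge_add_one_self)
      finally show "norm z / (1 - e) \<le> exp (2 * e)" .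
    qed (use e K in auto)
    also have "exp (2 * e) ^ N = exp (2 * e * real N)" by (simp add: exp_of_nat_mult[symmetric] mult_ac)
    finally show ?thesis .
  qed
  have "norm (F 1 - F (1 + of_real e)) \<le> K / e * exp (2 * e * real N) * norm (1 - (1 + of_real e) :: complex)"
  proof (rule field_differentiable_bound[of "cball 2 1" F "\<lambda>s. deriv L s / L s"])
    fix s :: complex assume s: "s \<in> cball 2 1"
    show "(F has_field_derivative deriv L s / L s) (at s within cball 2 1)"
      by (rule has_field_derivative_at_within[OF dF]) (use s in auto)
    show "norm (deriv L s / L s) \<le> K / e * exp (2 * e * real N)"
      using disc[of "s - 2"] s by (simp add: f_def dist_norm norm_minus_commute)
  next
    have "dist 2 (1 + of_real e :: complex) = norm (of_real (1 - e) :: complex)" by (simp add: dist_norm)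
    also have "\<dots> \<le> 1" using e unfolding norm_of_real by simp
    finally show "1 + of_real e \<in> cball (2::complex) 1" by simp
  qed (auto simp: dist_norm)
  also have "\<dots> = K * exp (2 * e * real N)" using e by simp
  finally have d: "Re (F 1 - F (1 + of_real e)) \<le> K * exp (2 * e * real N)"
    by (rule order_trans[OF complex_Re_le_cmod])
  have in1: "1 \<in> ball (2::complex) (3/2)" by (simp add: dist_norm)
  have "dist 2 (1 + of_real e :: complex) = norm (of_real (1 - e) :: complex)" by (simp add: dist_norm)
  also have "\<dots> < 3/2" using e unfolding norm_of_real by simp
  finally have in2: "1 + of_real e \<in> ball (2::complex) (3/2)" by simp
  have "L 1 = L (1 + of_real e) * exp (F 1 - F (1 + of_real e))"
    unfolding LF[OF in1] LF[OF in2] by (simp add: exp_diff)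
  hence "norm (L 1) = norm (L (1 + of_real e)) * exp (Re (F 1 - F (1 + of_real e)))"
    by (simp add: norm_mult)
  also have "\<dots> \<le> norm (L (1 + of_real e)) * exp (K * exp (2 * e * real N))"
    using d by (intro mult_left_mono) auto
  finally show ?thesis .
qed

section \<open>Dirichlet characters and their L-functions\<close>

lemma char_one: assumes "dirichlet_character q chi" shows "chi 1 = 1"
proof -
  have "chi 1 = chi 1 * chi 1" using assms by (metis dirichlet_character_def mult_1)
  moreover have "chi 1 \<noteq> 0" using assms by (metis coprime_1_left dirichlet_character_def)
  ultimately show ?thesis by simp
qed

lemma char_mult: "dirichlet_character q chi \<Longrightarrow> chi (a * b) = chi a * chi b"
  by (simp add: dirichlet_character_def)

lemma periodic_int_mult:
  fixes F :: "int \<Rightarrow> 'a"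
  assumes "\<And>a. F (a + q) = F a"
  shows "F (a + k * q) = F a"
proof -
  have nn: "F (a + int n * q) = F a" for n a
    by (induction n) (use assms in \<open>auto simp: algebra_simps\<close>, metis add.assoc add.commute assms)
  show ?thesis
  proof (cases "k \<ge> 0")
    case True thus ?thesis using nn[of a "nat k"] by simp
  next
    case False thus ?thesis using nn[of "a + k * q" "nat (- k)"] by simp
  qed
qed

lemma periodic_int_mod:
  fixes F :: "int \<Rightarrow> 'a"
  assumes "\<And>a. F (a + q) = F a"
  shows "F (a mod q) = F a"
  using periodic_int_mult[of F q "a mod q" "a div q", OF assms] by (simp add: mod_div_mult_eq)

lemma char_periodic: "dirichlet_character q chi \<Longrightarrow> chi (a + int q) = chi a"
  by (simp add: dirichlet_character_def)

lemma char_zero_iff: "dirichlet_character q chi \<Longrightarrow> chi a = 0 \<longleftrightarrow> \<not> coprime a (int q)"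
  by (auto simp: dirichlet_character_def)

text \<open>By Euler's theorem the values are roots of unity.\<close>

lemma char_norm:
  assumes "dirichlet_character q chi" and "coprime a (int q)"
  shows "norm (chi a) = 1"
proof -
  have q: "q \<ge> 1" using assms by (simp add: dirichlet_character_def)
  define b where "b = nat (a mod int q)"
  have b: "int b = a mod int q" using q by (simp add: b_def)
  have ab: "chi (int b) = chi a" unfolding b by (rule periodic_int_mod) (rule char_periodic[OF assms(1)])
  have "coprime (int b) (int q)" using assms(2) q by (simp add: b)
  hence "[b ^ totient q = 1] (mod q)" by (intro euler_theorem) simp
  hence "[int (b ^ totient q) = 1] (mod int q)" by (metis cong_int_iff of_nat_1)
  hence "chi (int (b ^ totient q)) = chi 1"
    by (metis (mono_tags) cong_def periodic_int_mod[of chi "int q", OF char_periodic[OF assms(1)]])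
  moreover have "chi (int b ^ k) = chi (int b) ^ k" for k
    by (induction k) (use char_one[OF assms(1)] char_mult[OF assms(1)] in auto)
  ultimately have "chi a ^ totient q = 1" using char_one[OF assms(1)] ab by simp
  hence "norm (chi a) ^ totient q = 1" by (metis norm_one norm_power)
  moreover have "totient q > 0" using q by simp
  ultimately show ?thesis by (metis norm_ge_zero power_eq_1_iff gr0_implies_Suc less_numeral_extra(3) power_eq_iff_eq_base power_one zero_le_one)
qed

lemma char_norm_le: "dirichlet_character q chi \<Longrightarrow> norm (chi a) \<le> 1"
  using char_norm[of q chi a] char_zero_iff[of q chi a] by (cases "coprime a (int q)") auto

lemma char_bounded_mult:
  assumes "dirichlet_character q chi"
  shows "bounded_mult (\<lambda>n. chi (int n))"
  using char_one[OF assms] char_mult[OF assms] char_norm_le[OF assms] by (simp add: bounded_mult_def)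

lemma char_cnj:
  assumes "dirichlet_character q chi"
  shows "dirichlet_character q (\<lambda>a. cnj (chi a))"
  using assms by (simp add: dirichlet_character_def)

lemma sum_residues_mult:
  fixes F :: "int \<Rightarrow> 'a :: comm_monoid_add"
  assumes q: "q \<ge> 1" and per: "\<And>a. F (a + q) = F a" and b: "coprime b q"
  shows "(\<Sum>a\<in>{0..<q}. F (b * a)) = (\<Sum>a\<in>{0..<q}. F a)"
proof -
  have inj: "inj_on (\<lambda>a. (b * a) mod q) {0..<q}"
  proof (rule inj_onI)
    fix x y assume xy: "x \<in> {0..<q}" "y \<in> {0..<q}" "(b * x) mod q = (b * y) mod q"
    hence "[b * x = b * y] (mod q)" by (simp add: cong_def)
    hence "[x = y] (mod q)" using b by (simp add: cong_mult_lcancel)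
    thus "x = y" using xy by (simp add: cong_def)
  qed
  have "(\<lambda>a. (b * a) mod q) ` {0..<q} \<subseteq> {0..<q}" using q by auto
  hence im: "(\<lambda>a. (b * a) mod q) ` {0..<q} = {0..<q}" by (rule endo_inj_surj[OF finite_atLeastLessThan_int _ inj])
  have "(\<Sum>a\<in>{0..<q}. F a) = (\<Sum>a\<in>(\<lambda>a. (b * a) mod q) ` {0..<q}. F a)" by (simp add: im)
  also have "\<dots> = (\<Sum>a\<in>{0..<q}. F ((b * a) mod q))" by (simp add: sum.reindex[OF inj])
  also have "\<dots> = (\<Sum>a\<in>{0..<q}. F (b * a))" using periodic_int_mod[of F q, OF per] by simp
  finally show ?thesis ..
qed

lemma sum_int_interval: "(\<Sum>a\<in>{0..<int q}. F a) = (\<Sum>n<q. F (int n))"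
  by (rule sum.reindex_bij_witness[of _ int nat]) auto

text \<open>Multiplication by some \<open>b\<close> with \<open>chi b \<noteq> 1\<close> permutes the residues.\<close>

lemma char_sum_zero:
  assumes chi: "dirichlet_character q chi" and np: "chi \<noteq> principal_character q"
  shows "(\<Sum>a\<in>{0..<int q}. chi a) = 0"
proof -
  obtain b where b: "chi b \<noteq> principal_character q b" using np by auto
  hence cb: "coprime b (int q)" using char_zero_iff[OF chi, of b] by (auto simp: principal_character_def)
  hence b1: "chi b \<noteq> 1" using b by (simp add: principal_character_def)
  have q: "int q \<ge> 1" using chi by (simp add: dirichlet_character_def)
  have "(\<Sum>a\<in>{0..<int q}. chi a) = (\<Sum>a\<in>{0..<int q}. chi (b * a))"
    by (rule sum_residues_mult[OF q _ cb, symmetric]) (rule char_periodic[OF chi])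
  also have "\<dots> = chi b * (\<Sum>a\<in>{0..<int q}. chi a)" by (simp add: char_mult[OF chi] sum_distrib_left)
  finally have "(1 - chi b) * (\<Sum>a\<in>{0..<int q}. chi a) = 0" by (simp add: algebra_simps)
  thus ?thesis using b1 by simp
qed

lemma char_partial_sums:
  assumes chi: "dirichlet_character q chi" and np: "chi \<noteq> principal_character q"
  shows "norm (\<Sum>j<N. chi (int (Suc j))) \<le> 2 * real q"
proof -
  have q: "q \<ge> 1" using chi by (simp add: dirichlet_character_def)
  have per: "chi (int (k * q + r)) = chi (int r)" for k r
    using periodic_int_mult[of chi "int q" "int r" "int k", OF char_periodic[OF chi]] by (simp add: add_ac)
  have z: "(\<Sum>n<q. chi (int n)) = 0" using char_sum_zero[OF assms] by (simp add: sum_int_interval)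
  have shift: "(\<Sum>n<i + M. f n) = (\<Sum>n<i. f n) + (\<Sum>n<M. f (n + i))" for f :: "nat \<Rightarrow> complex" and i M
    by (induction M) (simp_all add: add_ac)
  have split: "(\<Sum>n<k * q + r. chi (int n)) = (\<Sum>n<r. chi (int n))" for k r
  proof (induction k)
    case (Suc k)
    have "(\<Sum>n<Suc k * q + r. chi (int n)) = (\<Sum>n<q. chi (int n)) + (\<Sum>n<k * q + r. chi (int (n + q)))"
      using shift[of "\<lambda>n. chi (int n)" q "k * q + r"] by (simp add: add_ac)
    also have "(\<Sum>n<k * q + r. chi (int (n + q))) = (\<Sum>n<k * q + r. chi (int n))"
      using char_periodic[OF chi] by simp
    finally show ?case using Suc z by simp
  qed simp
  have "(\<Sum>j<N. chi (int (Suc j))) = (\<Sum>j<Suc N. chi (int j)) - chi 0"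
    by (subst sum.lessThan_Suc_shift) simp
  also have "(\<Sum>j<Suc N. chi (int j)) = (\<Sum>j<Suc N mod q. chi (int j))"
    using split[of "Suc N div q" "Suc N mod q"] by simp
  finally have "norm (\<Sum>j<N. chi (int (Suc j))) \<le> norm (\<Sum>j<Suc N mod q. chi (int j)) + norm (chi 0)"
    using norm_triangle_ineq4 by simp
  also have "norm (\<Sum>j<Suc N mod q. chi (int j)) \<le> (\<Sum>j<Suc N mod q. 1)"
    by (intro sum_norm_le char_norm_le[OF chi])
  also have "\<dots> \<le> real q" using q by (simp add: less_imp_le)
  also have "norm (chi 0) \<le> 1" by (rule char_norm_le[OF chi])
  also have "real q + 1 \<le> 2 * real q" using q by simp
  finally show ?thesis by simp
qed

text \<open>For a non-principal character the entire function \<open>H\<close> that continues \<open>(s - 1)\<close> times the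
  series vanishes at \<open>1\<close>, so \<open>H(s) / (s - 1)\<close> is entire. Hence the choice in the definition
  of \<open>dirichlet_L\<close> is made from a non-empty set.\<close>

lemma dirichlet_L_spec:
  assumes chi: "dirichlet_character q chi" and np: "chi \<noteq> principal_character q"
  shows "dirichlet_L q chi holomorphic_on UNIV"
    and "\<And>s. Re s > 1 \<Longrightarrow> (\<lambda>n. chi (int (Suc n)) / of_nat (Suc n) powr s) sums dirichlet_L q chi s"
    and "\<And>s. Re s > 1 \<Longrightarrow> dirichlet_L q chi s = dseries (\<lambda>n. chi (int n)) s"
proof -
  have q: "q \<ge> 1" using chi by (simp add: dirichlet_character_def)
  let ?a = "\<lambda>n. chi (int n)"
  note bm = char_bounded_mult[OF chi]
  obtain H where H: "H holomorphic_on UNIV" "H 1 = (\<Sum>r<q. ?a (Suc r)) / of_nat q"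
     "\<And>s. Re s > 1 \<Longrightarrow> H s = (s - 1) * dseries ?a s"
    using periodic_dseries_entire[OF q, of ?a] char_periodic[OF chi] char_norm_le[OF chi] by auto
  have "(\<Sum>r<q. ?a (Suc r)) = (\<Sum>r<Suc q. ?a r) - ?a 0" by (subst sum.lessThan_Suc_shift) simp
  also have "\<dots> = (\<Sum>r<q. ?a r)" using char_periodic[OF chi, of 0] by simp
  also have "\<dots> = 0" using char_sum_zero[OF assms] by (simp add: sum_int_interval)
  finally have H1: "H 1 = 0" using H(2) by simp
  define G where "G = (\<lambda>s. if s = 1 then deriv H 1 else (H s - H 1) / (s - 1))"
  have G: "G holomorphic_on UNIV" unfolding G_def by (rule pole_lemma[OF H(1)]) simp
  have "(\<lambda>n. chi (int (Suc n)) / of_nat (Suc n) powr s) sums G s" if s: "Re s > 1" for s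
  proof -
    have "s \<noteq> 1" using s by auto
    hence "G s = dseries ?a s" using H(3)[OF s] H1 by (simp add: G_def)
    thus ?thesis using dseries_sums[of ?a s, OF bounded_mult_growth(1)[OF bm] s] by simp
  qed
  moreover have "dirichlet_L_domain q chi = UNIV" using np by (simp add: dirichlet_L_domain_def)
  ultimately have ex: "\<exists>L. L holomorphic_on dirichlet_L_domain q chi \<and>
        (\<forall>s. Re s > 1 \<longrightarrow> (\<lambda>n. chi (int (Suc n)) / of_nat (Suc n) powr s) sums L s)"
    using G by auto
  from someI_ex[OF this] np show 1: "dirichlet_L q chi holomorphic_on UNIV"
    and 2: "\<And>s. Re s > 1 \<Longrightarrow> (\<lambda>n. chi (int (Suc n)) / of_nat (Suc n) powr s) sums dirichlet_L q chi s"
    unfolding dirichlet_L_def by (auto simp: dirichlet_L_domain_def)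
  show "\<And>s. Re s > 1 \<Longrightarrow> dirichlet_L q chi s = dseries ?a s"
    using 2 by (simp add: dseries_def sums_iff)
qed

section \<open>Gauss sums and the square wave\<close>

definition unit_root :: "nat \<Rightarrow> int \<Rightarrow> complex" where
  "unit_root p x = cis (2 * pi * real_of_int x / real p)"

lemma unit_root_add: "unit_root p (x + y) = unit_root p x * unit_root p y"
  by (simp add: unit_root_def cis_mult add_divide_distrib ring_distribs)

lemma unit_root_0 [simp]: "unit_root p 0 = 1" by (simp add: unit_root_def)

lemma unit_root_minus: "unit_root p (- x) = cnj (unit_root p x)"
  by (simp add: unit_root_def cis_cnj)

lemma norm_unit_root [simp]: "norm (unit_root p x) = 1" by (simp add: unit_root_def)

lemma unit_root_periodic: assumes "p > 0" shows "unit_root p (x + int p) = unit_root p x"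
proof -
  have "unit_root p (int p) = 1" using assms by (simp add: unit_root_def)
  thus ?thesis by (simp add: unit_root_add)
qed

lemma unit_root_power: "unit_root p (int n * x) = unit_root p x ^ n"
  by (induction n) (simp_all add: unit_root_add ring_distribs)

lemma unit_root_eq_1_iff: assumes "p > 0" shows "unit_root p x = 1 \<longleftrightarrow> int p dvd x"
proof
  assume "unit_root p x = 1"
  hence "cos (2 * pi * real_of_int x / real p) = 1" by (simp add: unit_root_def complex_eq_iff)
  then obtain k :: int where "2 * pi * real_of_int x / real p = real_of_int k * 2 * pi"
    using cos_one_2pi_int by auto
  hence "real_of_int x = real_of_int (k * int p)" using assms by (simp add: field_simps)
  hence "x = k * int p" by (simp only: of_int_eq_iff)
  thus "int p dvd x" by simp
next
  assume "int p dvd x"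
  then obtain k where "x = int p * k" by blast
  thus "unit_root p x = 1"
    using periodic_int_mult[of "unit_root p" "int p" 0 k, OF unit_root_periodic[OF assms]]
    by (simp add: mult.commute)
qed

lemma sum_unit_root:
  assumes "p > 0"
  shows "(\<Sum>n\<in>{0..<int p}. unit_root p (n * x)) = (if int p dvd x then of_nat p else 0)"
proof (cases "int p dvd x")
  case True
  have "unit_root p (n * x) = 1" for n using True assms by (simp add: unit_root_eq_1_iff)
  thus ?thesis using True by simp
next
  case False
  have "(\<Sum>n\<in>{0..<int p}. unit_root p (n * x)) = (\<Sum>n<p. unit_root p x ^ n)"
    by (simp add: sum_int_interval unit_root_power)
  also have "\<dots> = (unit_root p x ^ p - 1) / (unit_root p x - 1)"
    using False assms by (intro geometric_sum) (simp add: unit_root_eq_1_iff)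
  also have "unit_root p x ^ p = unit_root p (int p * x)" by (simp only: unit_root_power)
  also have "\<dots> = 1" using assms by (simp add: unit_root_eq_1_iff)
  finally show ?thesis using False by simp
qed

definition gauss_sum :: "nat \<Rightarrow> (int \<Rightarrow> complex) \<Rightarrow> complex" where
  "gauss_sum p chi = (\<Sum>a\<in>{0..<int p}. chi a * unit_root p a)"

text \<open>For \<open>n\<close> divisible by \<open>p\<close> both sides vanish, so the identity holds for every \<open>n\<close>.\<close>

lemma gauss_sum_twist:
  assumes p: "prime p" and chi: "dirichlet_character p chi" and np: "chi \<noteq> principal_character p"
  shows "(\<Sum>a\<in>{0..<int p}. chi a * unit_root p (n * a)) = cnj (chi n) * gauss_sum p chi"
proof (cases "coprime n (int p)")
  case True
  have p0: "p > 0" using p prime_gt_0_nat by blast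
  let ?F = "\<lambda>a. chi a * unit_root p a"
  have per: "?F (a + int p) = ?F a" for a
    using char_periodic[OF chi] unit_root_periodic[OF p0] by simp
  have "gauss_sum p chi = (\<Sum>a\<in>{0..<int p}. ?F (n * a))"
    unfolding gauss_sum_def by (rule sum_residues_mult[of "int p" ?F n, OF _ per True, symmetric]) (use p0 in auto)
  also have "\<dots> = chi n * (\<Sum>a\<in>{0..<int p}. chi a * unit_root p (n * a))"
    by (simp add: char_mult[OF chi] sum_distrib_left mult.assoc)
  finally have "cnj (chi n) * gauss_sum p chi = (cnj (chi n) * chi n) * (\<Sum>a\<in>{0..<int p}. chi a * unit_root p (n * a))"
    by (simp add: mult.assoc)
  also have "cnj (chi n) * chi n = 1"
    using char_norm[OF chi True] complex_norm_square[of "chi n"] by (simp add: mult.commute)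
  finally show ?thesis by simp
next
  case False
  hence d: "int p dvd n" using p by (metis coprime_commute prime_imp_coprime prime_nat_int_transfer)
  have p0: "p > 0" using p prime_gt_0_nat by blast
  have "unit_root p (n * a) = 1" for a using d p0 by (simp add: unit_root_eq_1_iff)
  thus ?thesis using char_sum_zero[OF chi np] char_zero_iff[OF chi, of n] False by simp
qed

text \<open>Parseval: sum the squared modulus of \<open>gauss_sum_twist\<close> over all \<open>n\<close> in two ways.\<close>

lemma norm_gauss_sum:
  assumes p: "prime p" and chi: "dirichlet_character p chi" and np: "chi \<noteq> principal_character p"
  shows "norm (gauss_sum p chi) = sqrt (real p)"
proof -
  let ?I = "{0..<int p}"
  have p0: "p > 1" using p prime_gt_1_nat by blast
  have cop: "coprime a (int p) \<longleftrightarrow> a \<noteq> 0" if "a \<in> ?I" for a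
  proof (cases "a = 0")
    case False
    hence "\<not> int p dvd a" using that by (auto dest: zdvd_imp_le)
    hence "coprime (int p) a" using p by (intro prime_imp_coprime) auto
    thus ?thesis using False by (simp add: coprime_commute)
  qed (use p0 in auto)
  have nrm: "chi a * cnj (chi a) = (if a = 0 then 0 else 1)" if "a \<in> ?I" for a
    using char_norm[OF chi, of a] char_zero_iff[OF chi, of a] cop[OF that] complex_norm_square[of "chi a"] by auto
  have I: "?I = insert 0 {1..<int p}" using p0 by auto
  have cnt: "(\<Sum>a\<in>?I. if a = 0 then 0 else 1 :: complex) = of_nat (p - 1)"
    unfolding I by (subst sum.insert) (use p0 in \<open>auto simp: of_nat_diff\<close>)
  let ?G = "\<lambda>n. (\<Sum>a\<in>?I. chi a * unit_root p (n * a))"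
  have "(\<Sum>n\<in>?I. ?G n * cnj (?G n)) = (\<Sum>n\<in>?I. (chi n * cnj (chi n)) * (gauss_sum p chi * cnj (gauss_sum p chi)))"
    by (simp add: gauss_sum_twist[OF assms] mult_ac)
  also have "\<dots> = (\<Sum>n\<in>?I. if n = 0 then 0 else 1) * (gauss_sum p chi * cnj (gauss_sum p chi))"
    using nrm by (simp only: sum_distrib_right cong: sum.cong)
  finally have 1: "(\<Sum>n\<in>?I. ?G n * cnj (?G n)) = of_nat (p - 1) * (gauss_sum p chi * cnj (gauss_sum p chi))"
    by (simp only: cnt)
  have "(\<Sum>n\<in>?I. ?G n * cnj (?G n)) = (\<Sum>n\<in>?I. \<Sum>a\<in>?I. \<Sum>b\<in>?I. chi a * cnj (chi b) * unit_root p (n * (a - b)))"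
    unfolding cnj_sum sum_product
    by (intro sum.cong refl) (simp add: unit_root_minus[symmetric] right_diff_distrib unit_root_add[of _ _ "- _", simplified] mult_ac)
  also have "\<dots> = (\<Sum>a\<in>?I. \<Sum>n\<in>?I. \<Sum>b\<in>?I. chi a * cnj (chi b) * unit_root p (n * (a - b)))"
    by (rule sum.swap)
  also have "\<dots> = (\<Sum>a\<in>?I. \<Sum>b\<in>?I. \<Sum>n\<in>?I. chi a * cnj (chi b) * unit_root p (n * (a - b)))"
    by (intro sum.cong refl sum.swap)
  also have "\<dots> = (\<Sum>a\<in>?I. \<Sum>b\<in>?I. chi a * cnj (chi b) * (if a = b then of_nat p else 0))"
  proof (intro sum.cong refl)
    fix a b assume ab: "a \<in> ?I" "b \<in> ?I"
    have "int p dvd (a - b) \<longleftrightarrow> a = b"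
      using ab by (metis atLeastLessThan_iff dvd_0_right eq_iff_diff_eq_0 mod_eq_dvd_iff mod_pos_pos_trivial)
    thus "(\<Sum>n\<in>?I. chi a * cnj (chi b) * unit_root p (n * (a - b))) = chi a * cnj (chi b) * (if a = b then of_nat p else 0)"
      using p0 by (simp add: sum_distrib_left[symmetric] sum_unit_root)
  qed
  also have "\<dots> = (\<Sum>a\<in>?I. chi a * cnj (chi a) * of_nat p)"
    by (intro sum.cong refl) (simp add: if_distrib cong: if_cong)
  also have "\<dots> = (\<Sum>a\<in>?I. if a = 0 then 0 else 1) * of_nat p"
    using nrm by (simp only: sum_distrib_right cong: sum.cong)
  finally have "of_nat (p - 1) * (gauss_sum p chi * cnj (gauss_sum p chi)) = of_nat (p - 1) * complex_of_nat p"
    using 1 by (simp only: cnt)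
  hence "gauss_sum p chi * cnj (gauss_sum p chi) = of_nat p" using p0 by (simp del: of_nat_diff)
  hence "complex_of_real ((norm (gauss_sum p chi))\<^sup>2) = of_real (real p)"
    by (simp only: complex_norm_square of_real_of_nat_eq)
  hence "(norm (gauss_sum p chi))\<^sup>2 = real p" by (simp only: of_real_eq_iff)
  thus ?thesis by (metis norm_ge_zero real_sqrt_unique)
qed

text \<open>With \<open>t = pi a / p\<close>, the number \<open>1 - exp(2 i t)\<close> has modulus \<open>2 sin t\<close> and argument
  \<open>t - pi/2\<close>, which is in the range of the principal branch.\<close>

lemma Im_Ln_one_minus_unit_root:
  assumes "0 < a" "a < int p"
  shows "Im (Ln (1 - unit_root p a)) = pi * (real_of_int a / real p - 1 / 2)"
    and "Re (1 - unit_root p a) > 0"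
proof -
  have p: "p > 0" using assms by auto
  define t where "t = pi * real_of_int a / real p"
  have t: "0 < t" "t < pi" using assms p by (auto simp: t_def field_simps)
  have st: "sin t > 0" using t by (rule sin_gt_zero)
  have ur: "unit_root p a = cis (2 * t)" by (simp add: unit_root_def t_def mult.assoc)
  have c: "cos (2 * t) = 1 - 2 * (sin t)\<^sup>2" by (rule cos_double_sin)
  show "Re (1 - unit_root p a) > 0" using st by (simp add: ur c)
  have "1 - unit_root p a = of_real (2 * sin t) * cis (t - pi / 2)"
    by (simp add: ur complex_eq_iff c sin_double cos_diff sin_diff power2_eq_square)
  also have "\<dots> = exp (of_real (ln (2 * sin t)) + \<i> * of_real (t - pi / 2))"
    using st by (simp add: exp_add cis_conv_exp exp_of_real flip: of_real_exp)
  finally have "Ln (1 - unit_root p a) = of_real (ln (2 * sin t)) + \<i> * of_real (t - pi / 2)"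
    using t by (simp only:) (rule Ln_exp; simp)
  hence "Im (Ln (1 - unit_root p a)) = t - pi / 2" by simp
  thus "Im (Ln (1 - unit_root p a)) = pi * (real_of_int a / real p - 1 / 2)"
    by (simp add: t_def algebra_simps)
qed

text \<open>At multiples of \<open>p\<close> the value is \<open>- 1/2\<close> instead of the customary \<open>0\<close>; characters vanish there.\<close>

definition sawtooth :: "nat \<Rightarrow> int \<Rightarrow> real" where
  "sawtooth p a = real_of_int (a mod int p) / real p - 1 / 2"

lemma odd_char_nonprincipal: "chi (- 1) = - 1 \<Longrightarrow> chi \<noteq> principal_character q"
  by (auto simp: principal_character_def)

text \<open>Expand \<open>cnj (chi n)\<close> by additive characters in the Abel mean of \<open>\<Sum>n. cnj (chi n) / n\<close>. This
  gives a combination of logarithms of \<open>1 - exp(2 pi i a / p)\<close>, of which an odd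
  character only sees the imaginary parts, that is, the sawtooth.\<close>

lemma gauss_sum_times_L1:
  assumes p: "prime p" and chi: "dirichlet_character p chi" and odd: "chi (- 1) = - 1"
  shows "gauss_sum p chi * dirichlet_L p (\<lambda>a. cnj (chi a)) 1
       = - (\<i> * of_real pi) * (\<Sum>a\<in>{0..<int p}. chi a * of_real (sawtooth p a))"
proof -
  let ?I = "{0..<int p}" and ?L = "dirichlet_L p (\<lambda>a. cnj (chi a))"
  let ?E = "unit_root p"
  have p0: "p > 1" using p prime_gt_1_nat by blast
  note np = odd_char_nonprincipal[of chi p, OF odd]
  have np': "(\<lambda>a. cnj (chi a)) \<noteq> principal_character p"
    using odd_char_nonprincipal[of "\<lambda>a. cnj (chi a)" p] odd by simp
  note cc = char_cnj[OF chi]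
  have chi0: "chi 0 = 0" using char_zero_iff[OF chi, of 0] p0 by simp
  have lim1: "((\<lambda>r::real. \<Sum>n. cnj (chi (int (Suc n))) * (of_real r ^ Suc n / of_nat (Suc n))) \<longlongrightarrow> ?L 1) (at_left 1)"
    by (rule abel_mean_tendsto[of "\<lambda>n. cnj (chi (int n))", OF char_partial_sums[OF cc np'] dirichlet_L_spec(1,2)[OF cc np']])
  have S: "(\<lambda>n. (of_real r * ?E a) ^ Suc n / of_nat (Suc n)) sums (- Ln (1 - of_real r * ?E a))"
    if r: "r \<in> {0<..<1}" for r a
  proof -
    let ?z = "of_real r * ?E a"
    have "norm ?z < 1" using r by (simp add: norm_mult)
    hence "(\<lambda>n. - ((- (- ?z)) ^ n) / of_nat n) sums Ln (1 + - ?z)" by (intro Ln_series') simp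
    hence "(\<lambda>n. - (?z ^ n / of_nat n)) sums Ln (1 - ?z)" by simp
    hence "(\<lambda>n. ?z ^ n / of_nat n) sums - Ln (1 - ?z)" using sums_minus by fastforce
    thus ?thesis by (subst sums_Suc_iff) simp
  qed
  have key: "gauss_sum p chi * (\<Sum>n. cnj (chi (int (Suc n))) * (of_real r ^ Suc n / of_nat (Suc n)))
      = - (\<Sum>a\<in>?I. chi a * Ln (1 - of_real r * ?E a))" if r: "r \<in> {0<..<1}" for r
  proof -
    have s: "(\<lambda>n. \<Sum>a\<in>?I. chi a * ((of_real r * ?E a) ^ Suc n / of_nat (Suc n)))
       sums (\<Sum>a\<in>?I. chi a * (- Ln (1 - of_real r * ?E a)))"
      by (intro sums_sum sums_mult S r)
    have eq: "(\<Sum>a\<in>?I. chi a * ((of_real r * ?E a) ^ Suc n / of_nat (Suc n)))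
       = gauss_sum p chi * (cnj (chi (int (Suc n))) * (of_real r ^ Suc n / of_nat (Suc n)))" for n
    proof -
      have "(\<Sum>a\<in>?I. chi a * ((of_real r * ?E a) ^ Suc n / of_nat (Suc n)))
        = (\<Sum>a\<in>?I. chi a * ?E (int (Suc n) * a)) * (of_real r ^ Suc n / of_nat (Suc n))"
        unfolding sum_distrib_right unit_root_power power_mult_distrib by (intro sum.cong refl) simp
      thus ?thesis unfolding gauss_sum_twist[OF p chi np] by (simp add: mult_ac)
    qed
    have g0: "gauss_sum p chi \<noteq> 0" using norm_gauss_sum[OF p chi np] p0 by auto
    have "(\<lambda>n. cnj (chi (int (Suc n))) * (of_real r ^ Suc n / of_nat (Suc n)))
       sums ((\<Sum>a\<in>?I. chi a * (- Ln (1 - of_real r * ?E a))) / gauss_sum p chi)"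
      using sums_divide[OF s[unfolded eq], of "gauss_sum p chi"] g0 by simp
    hence "(\<Sum>n. cnj (chi (int (Suc n))) * (of_real r ^ Suc n / of_nat (Suc n)))
        = (\<Sum>a\<in>?I. chi a * (- Ln (1 - of_real r * ?E a))) / gauss_sum p chi" by (simp only: sums_iff)
    thus ?thesis using g0 by (simp add: sum_negf)
  qed
  have lim2: "((\<lambda>r::real. - (\<Sum>a\<in>?I. chi a * Ln (1 - of_real r * ?E a))) \<longlongrightarrow> - (\<Sum>a\<in>?I. chi a * Ln (1 - ?E a))) (at_left 1)"
  proof (intro tendsto_minus tendsto_sum)
    fix a assume a: "a \<in> ?I"
    show "((\<lambda>r::real. chi a * Ln (1 - of_real r * ?E a)) \<longlongrightarrow> chi a * Ln (1 - ?E a)) (at_left 1)"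
    proof (cases "a = 0")
      case False
      have "Re (1 - ?E a) > 0" using a False by (intro Im_Ln_one_minus_unit_root) auto
      hence "1 - of_real 1 * ?E a \<notin> \<real>\<^sub>\<le>\<^sub>0" by (auto simp: complex_nonpos_Reals_iff)
      hence "((\<lambda>r::real. chi a * Ln (1 - of_real r * ?E a)) \<longlongrightarrow> chi a * Ln (1 - of_real 1 * ?E a)) (at_left 1)"
        by (intro tendsto_intros)
      thus ?thesis by simp
    qed (simp add: chi0)
  qed
  have "\<forall>\<^sub>F r in at_left 1. gauss_sum p chi * (\<Sum>n. cnj (chi (int (Suc n))) * (of_real r ^ Suc n / of_nat (Suc n)))
      = - (\<Sum>a\<in>?I. chi a * Ln (1 - of_real r * ?E a))"
    by (rule eventually_mono[OF eventually_at_left_real[of 0 1]]) (simp, rule key)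
  from Lim_transform_eventually[OF tendsto_mult[OF tendsto_const lim1] this]
  have eq1: "gauss_sum p chi * ?L 1 = - (\<Sum>a\<in>?I. chi a * Ln (1 - ?E a))"
    using lim2 by (intro tendsto_unique[of "at_left (1::real)"]) auto
  have per: "chi (a + int p) * Ln (1 - ?E (a + int p)) = chi a * Ln (1 - ?E a)" for a
    using char_periodic[OF chi] unit_root_periodic[of p] p0 by simp
  have neg: "chi (- a) = - chi a" for a using char_mult[OF chi, of "-1" a] odd by simp
  have "(\<Sum>a\<in>?I. chi a * Ln (1 - ?E a)) = (\<Sum>a\<in>?I. chi (- 1 * a) * Ln (1 - ?E (- 1 * a)))"
    by (rule sum_residues_mult[of "int p" "\<lambda>a. chi a * Ln (1 - ?E a)", OF _ per, symmetric]) (use p0 in auto)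
  also have "\<dots> = - (\<Sum>a\<in>?I. chi a * Ln (cnj (1 - ?E a)))"
    by (simp add: neg unit_root_minus sum_negf)
  finally have "2 * (\<Sum>a\<in>?I. chi a * Ln (1 - ?E a)) = (\<Sum>a\<in>?I. chi a * (Ln (1 - ?E a) - Ln (cnj (1 - ?E a))))"
    by (simp add: right_diff_distrib sum_subtractf)
  also have "\<dots> = (\<Sum>a\<in>?I. chi a * (2 * \<i> * of_real pi * of_real (sawtooth p a)))"
  proof (intro sum.cong refl)
    fix a assume a: "a \<in> ?I"
    show "chi a * (Ln (1 - ?E a) - Ln (cnj (1 - ?E a))) = chi a * (2 * \<i> * of_real pi * of_real (sawtooth p a))"
    proof (cases "a = 0")
      case False
      note L = Im_Ln_one_minus_unit_root[of a p]
      have R: "Re (1 - ?E a) > 0" using a False by (intro L) auto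
      hence "Ln (cnj (1 - ?E a)) = cnj (Ln (1 - ?E a))"
        by (intro cnj_Ln[symmetric]) (auto simp: complex_nonpos_Reals_iff)
      hence "Ln (1 - ?E a) - Ln (cnj (1 - ?E a)) = of_real (2 * Im (Ln (1 - ?E a))) * \<i>"
        by (simp only: complex_diff_cnj)
      also have "Im (Ln (1 - ?E a)) = pi * sawtooth p a" using L(1) a False by (simp add: sawtooth_def)
      finally show ?thesis by (simp add: mult_ac)
    qed (simp add: chi0)
  qed
  also have "\<dots> = 2 * (\<i> * of_real pi) * (\<Sum>a\<in>?I. chi a * of_real (sawtooth p a))"
    by (simp add: sum_distrib_left mult_ac)
  finally show ?thesis unfolding eq1 by (simp add: mult.assoc)
qed

text \<open>The value at multiples of \<open>p\<close> is \<open>1\<close>, which is harmless since characters vanish there.\<close>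

definition square_wave :: "nat \<Rightarrow> int \<Rightarrow> real" where
  "square_wave p a = (if 2 * (a mod int p) < int p then 1 else - 1)"

lemma square_wave_sawtooth:
  assumes "odd p" "\<not> int p dvd a"
  shows "square_wave p a = 2 * (sawtooth p (2 * a) - 2 * sawtooth p a)"
proof -
  define r where "r = a mod int p"
  have p: "p > 0" using assms by (auto intro: Nat.gr0I)
  have r: "0 \<le> r" "r < int p" using p by (auto simp: r_def)
  have "2 * a mod int p = 2 * r mod int p" by (simp add: r_def mod_mult_right_eq)
  moreover have "2 * r \<noteq> int p" using assms(1) by (metis dvd_triv_left even_of_nat)
  moreover have "2 * r mod int p = (if 2 * r < int p then 2 * r else 2 * r - int p)"
  proof (cases "2 * r < int p")
    case False
    have "2 * r mod int p = (2 * r - int p) mod int p" by simp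
    also have "\<dots> = 2 * r - int p" using r False by (intro mod_pos_pos_trivial) auto
    finally show ?thesis using False by simp
  qed (use r in simp)
  ultimately show ?thesis using p
    by (auto simp: square_wave_def sawtooth_def r_def[symmetric] field_simps)
qed

text \<open>By \<open>square_wave_sawtooth\<close> the sum is \<open>2 (Q - 2 P)\<close>, where \<open>P\<close> and \<open>Q\<close> are the sums of
  \<open>chi(a)\<close> against the sawtooth at \<open>a\<close> and at \<open>2 a\<close>. Substituting \<open>2 a\<close> for \<open>a\<close> shows
  \<open>chi(2) Q = P\<close>, and \<open>P\<close> is known from \<open>gauss_sum_times_L1\<close>.\<close>

lemma square_wave_char_sum_odd:
  assumes p: "prime p" "odd p" and chi: "dirichlet_character p chi" and odd: "chi (- 1) = - 1"
  shows "norm (\<Sum>a\<in>{0..<int p}. of_real (square_wave p a) * chi a)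
       \<le> 2 * sqrt (real p) * norm (dirichlet_L p (\<lambda>a. cnj (chi a)) 1)"
proof -
  let ?I = "{0..<int p}"
  define P where "P = (\<Sum>a\<in>?I. chi a * of_real (sawtooth p a))"
  define Q where "Q = (\<Sum>a\<in>?I. chi a * of_real (sawtooth p (2 * a)))"
  define W where "W = (\<Sum>a\<in>?I. of_real (square_wave p a) * chi a)"
  have p0: "p > 1" using p prime_gt_1_nat by blast
  have c2: "coprime 2 (int p)" using p(2) by simp
  have per: "chi (a + int p) * of_real (sawtooth p (a + int p)) = chi a * of_real (sawtooth p a)" for a
    using char_periodic[OF chi] by (simp add: sawtooth_def)
  have "P = (\<Sum>a\<in>?I. chi (2 * a) * of_real (sawtooth p (2 * a)))"
    unfolding P_def by (rule sum_residues_mult[of "int p" "\<lambda>a. chi a * of_real (sawtooth p a)", OF _ per c2, symmetric]) (use p0 in auto)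
  also have "\<dots> = chi 2 * Q"
    by (simp add: Q_def char_mult[OF chi] sum_distrib_left mult.assoc)
  finally have P2: "chi 2 * Q = P" ..
  have "W = (\<Sum>a\<in>?I. 2 * (chi a * of_real (sawtooth p (2 * a)) - 2 * (chi a * of_real (sawtooth p a))))"
    unfolding W_def
  proof (intro sum.cong refl)
    fix a
    show "of_real (square_wave p a) * chi a = 2 * (chi a * of_real (sawtooth p (2 * a)) - 2 * (chi a * of_real (sawtooth p a)))"
    proof (cases "int p dvd a")
      case True
      hence "chi a = 0" using char_zero_iff[OF chi, of a] p0 by (auto simp: coprime_absorb_right)
      thus ?thesis by simp
    qed (simp add: square_wave_sawtooth[OF p(2)] algebra_simps)
  qed
  also have "\<dots> = 2 * (Q - 2 * P)"
    by (simp add: P_def Q_def sum_distrib_left sum_subtractf)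
  finally have W: "W = 2 * (Q - 2 * P)" .
  have "chi 2 * W = 2 * (chi 2 * Q - 2 * chi 2 * P)" unfolding W by (simp add: algebra_simps)
  hence "chi 2 * W = 2 * (P - 2 * chi 2 * P)" by (simp only: P2)
  hence "chi 2 * W = 2 * P * (1 - 2 * chi 2)" by (simp add: algebra_simps)
  hence "norm (chi 2) * norm W = 2 * norm P * norm (1 - 2 * chi 2)" by (metis norm_mult norm_numeral)
  moreover have "norm (1 - 2 * chi 2) \<le> 3"
    using norm_triangle_ineq4[of 1 "2 * chi 2"] char_norm[OF chi c2] by (simp add: norm_mult)
  ultimately have "norm W \<le> 2 * norm P * 3" 
    using char_norm[OF chi c2] mult_left_mono[of "norm (1 - 2 * chi 2)" 3 "norm P"] by (simp add: mult_ac)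
  also have "norm P = sqrt (real p) * norm (dirichlet_L p (\<lambda>a. cnj (chi a)) 1) / pi"
  proof -
    have "norm (gauss_sum p chi) * norm (dirichlet_L p (\<lambda>a. cnj (chi a)) 1) = norm (- (\<i> * of_real pi) * P)"
      using gauss_sum_times_L1[OF p(1) chi odd] unfolding P_def by (metis norm_mult)
    thus ?thesis using norm_gauss_sum[OF p(1) chi odd_char_nonprincipal[of chi p, OF odd]]
      by (simp add: norm_mult field_simps)
  qed
  also have "2 * (sqrt (real p) * norm (dirichlet_L p (\<lambda>a. cnj (chi a)) 1) / pi) * 3
     = 2 * sqrt (real p) * norm (dirichlet_L p (\<lambda>a. cnj (chi a)) 1) * (3 / pi)" by simp
  also have "\<dots> \<le> 2 * sqrt (real p) * norm (dirichlet_L p (\<lambda>a. cnj (chi a)) 1) * 1"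
    using pi_gt3 by (intro mult_left_mono) (auto simp: field_simps)
  finally show ?thesis by (simp add: W_def)
qed

lemma square_wave_char_sum_even:
  assumes p: "prime p" "odd p" and chi: "dirichlet_character p chi" and even: "chi (- 1) = 1"
  shows "(\<Sum>a\<in>{0..<int p}. of_real (square_wave p a) * chi a) = 0"
proof -
  let ?I = "{0..<int p}" and ?F = "\<lambda>a. of_real (square_wave p a) * chi a"
  have p0: "p > 1" using p prime_gt_1_nat by blast
  have per: "?F (a + int p) = ?F a" for a
    using char_periodic[OF chi] by (simp add: square_wave_def)
  have "(\<Sum>a\<in>?I. ?F a) = (\<Sum>a\<in>?I. ?F (- 1 * a))"
    by (rule sum_residues_mult[of "int p" ?F, OF _ per, symmetric]) (use p0 in auto)
  also have "\<dots> = (\<Sum>a\<in>?I. - ?F a)"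
  proof (intro sum.cong refl)
    fix a
    have ch: "chi (- 1 * a) = chi a" unfolding char_mult[OF chi] even by simp
    show "?F (- 1 * a) = - ?F a"
    proof (cases "int p dvd a")
      case True
      hence "chi a = 0" using char_zero_iff[OF chi, of a] p0 by (auto simp: coprime_absorb_right)
      thus ?thesis using ch by simp
    next
      case False
      define r where "r = a mod int p"
      have r: "0 < r" "r < int p" using p0 False pos_mod_bound[of "int p" a] pos_mod_sign[of "int p" a]
        by (auto simp: r_def dvd_eq_mod_eq_0 order_less_le)
      have "(- a) mod int p = int p - r" using False by (simp add: r_def zmod_zminus1_eq_if dvd_eq_mod_eq_0)
      moreover have "2 * r \<noteq> int p" using p(2) by (metis dvd_triv_left even_of_nat)
      ultimately have "square_wave p (- a) = - square_wave p a"
        by (auto simp: square_wave_def r_def[symmetric])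
      thus ?thesis using ch by simp
    qed
  qed
  finally have "(\<Sum>a\<in>?I. ?F a) = - (\<Sum>a\<in>?I. ?F a)" by (simp add: sum_negf)
  thus ?thesis by simp
qed

section \<open>Counting power residues by characters\<close>

lemma unit_root_cong:
  assumes "p > 0" "[x = y] (mod int p)"
  shows "unit_root p x = unit_root p y"
  using periodic_int_mod[of "unit_root p" "int p" x, OF unit_root_periodic[OF assms(1)]]
    periodic_int_mod[of "unit_root p" "int p" y, OF unit_root_periodic[OF assms(1)]] assms(2)
  by (simp add: cong_def)

text \<open>Any exponent serves: two of them differ by a multiple of \<open>p - 1\<close>.\<close>

definition dlog :: "nat \<Rightarrow> nat \<Rightarrow> int \<Rightarrow> nat" where
  "dlog p g a = (SOME i. [int g ^ i = a] (mod int p))"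

definition primroot_char :: "nat \<Rightarrow> nat \<Rightarrow> nat \<Rightarrow> int \<Rightarrow> complex" where
  "primroot_char p g j a = (if coprime a (int p) then unit_root (p - 1) (int j * int (dlog p g a)) else 0)"

lemma primroot_coprime_power:
  assumes p: "prime p" and g: "residue_primroot p g"
  shows "coprime (int g ^ i) (int p)"
  using g by (simp add: residue_primroot_def coprime_commute)

lemma dlog_cong:
  assumes p: "prime p" and g: "residue_primroot p g" and a: "coprime a (int p)"
  shows "[int g ^ dlog p g a = a] (mod int p)"
proof -
  have p1: "p > 1" using p prime_gt_1_nat by blast
  define b where "b = nat (a mod int p)"
  have b: "int b = a mod int p" using p1 by (simp add: b_def)
  have "coprime (int b) (int p)" unfolding b using a p1 by simp
  hence cb: "coprime b p" by simp
  have "b \<noteq> 0" using cb p1 by (auto intro!: Nat.gr0I)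
  moreover have "int b < int p" unfolding b using p1 by simp
  ultimately have "b \<in> totatives p" using cb by (auto simp: totatives_def)
  then obtain i where "g ^ i mod p = b"
    using residue_primroot_is_generator[OF p1 g] unfolding bij_betw_def by force
  hence "[g ^ i = b] (mod p)" using \<open>int b < int p\<close> by (auto simp: cong_def)
  hence "[int g ^ i = int b] (mod int p)" by (metis cong_int_iff of_nat_power)
  hence "[int g ^ i = a] (mod int p)" unfolding b by (simp add: cong_def)
  thus ?thesis unfolding dlog_def by (rule someI)
qed

lemma dlog_unique:
  assumes p: "prime p" and g: "residue_primroot p g" and c: "[int g ^ i = int g ^ j] (mod int p)"
  shows "[int i = int j] (mod int (p - 1))"
proof -
  have "[g ^ i = g ^ j] (mod p)" using c by (metis cong_int_iff of_nat_power)
  moreover have "coprime p g" "ord p g = p - 1" using g p by (auto simp: residue_primroot_def totient_prime)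
  ultimately have "[i = j] (mod (p - 1))" using order_divides_expdiff[of p g i j] by simp
  thus ?thesis by (simp add: cong_int_iff)
qed

lemma primroot_char_character:
  assumes p: "prime p" "odd p" and g: "residue_primroot p g"
  shows "dirichlet_character p (primroot_char p g j)"
  unfolding dirichlet_character_def
proof (intro conjI allI)
  have p1: "p > 1" using p prime_gt_1_nat by blast
  have N: "p - 1 > 0" using p1 by simp
  show "1 \<le> p" using p1 by simp
  fix a b :: int
  show "primroot_char p g j (a * b) = primroot_char p g j a * primroot_char p g j b"
  proof (cases "coprime a (int p) \<and> coprime b (int p)")
    case True
    hence ab: "coprime (a * b) (int p)" by simp
    have "[int g ^ dlog p g (a * b) = int g ^ dlog p g a * int g ^ dlog p g b] (mod int p)"
      using dlog_cong[OF p(1) g ab] cong_mult[OF dlog_cong[OF p(1) g, of a] dlog_cong[OF p(1) g, of b]] True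
      by (meson cong_sym cong_trans)
    hence "[int g ^ dlog p g (a * b) = int g ^ (dlog p g a + dlog p g b)] (mod int p)" by (simp add: power_add)
    from dlog_unique[OF p(1) g this]
    have "[int j * int (dlog p g (a * b)) = int j * int (dlog p g a + dlog p g b)] (mod int (p - 1))"
      by (rule cong_scalar_left)
    from unit_root_cong[OF N this] show ?thesis using True ab
      by (simp add: primroot_char_def unit_root_add ring_distribs)
  qed (auto simp: primroot_char_def)
next
  fix a :: int
  have "dlog p g (a + int p) = dlog p g a" by (simp add: dlog_def cong_def)
  moreover have "coprime (a + int p) (int p) \<longleftrightarrow> coprime a (int p)"
    by (metis coprime_iff_gcd_eq_1 gcd_add1)
  ultimately show "primroot_char p g j (a + int p) = primroot_char p g j a" by (simp add: primroot_char_def)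
  have "unit_root (p - 1) x \<noteq> 0" for x by (metis norm_unit_root norm_zero zero_neq_one)
  thus "(primroot_char p g j a \<noteq> 0) = coprime a (int p)" by (simp add: primroot_char_def)
qed

text \<open>The powers of a primitive root run through the non-zero residues.\<close>

lemma sum_over_primroot_powers:
  fixes F :: "int \<Rightarrow> 'a :: comm_monoid_add"
  assumes p: "prime p" and g: "residue_primroot p g" and per: "\<And>a. F (a + int p) = F a"
  shows "(\<Sum>a\<in>{1..<int p}. F a) = (\<Sum>i<p - 1. F (int g ^ i))"
proof -
  have p1: "p > 1" using p prime_gt_1_nat by blast
  have tot: "totatives p = {0<..<p}" using p by (rule totatives_prime)
  have "(\<Sum>i<p - 1. F (int g ^ i)) = (\<Sum>i<totient p. F (int (g ^ i mod p)))"
    using p periodic_int_mod[of F "int p", OF per] by (simp add: totient_prime zmod_int)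
  also have "\<dots> = (\<Sum>a\<in>totatives p. F (int a))"
    by (rule sum.reindex_bij_betw[OF residue_primroot_is_generator[OF p1 g]])
  also have "\<dots> = (\<Sum>a\<in>{1..<int p}. F a)" unfolding tot
    by (rule sum.reindex_bij_witness[of _ nat int]) auto
  finally show ?thesis ..
qed

lemma square_wave_periodic: "square_wave p (a + int p) = square_wave p a"
  by (simp add: square_wave_def)

text \<open>Let \<open>N = p - 1\<close> and read the square wave on powers of \<open>g\<close> as a function \<open>v\<close> of period
  \<open>N\<close>. Fourier inversion for \<open>v\<close> and summation over the arguments \<open>i m\<close> keep exactly the
  frequencies \<open>j\<close> with \<open>N dvd j m\<close>, which are the characters with \<open>chi\<^sup>m = 1\<close>.\<close>

lemma power_sum_as_char_sums:
  assumes p: "prime p" "odd p" and g: "residue_primroot p g"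
  shows "(\<Sum>k\<in>{1..<int p}. of_real (square_wave p (k ^ m)) :: complex)
      = (\<Sum>j | j < p - 1 \<and> (p - 1) dvd j * m. \<Sum>a\<in>{0..<int p}. of_real (square_wave p a) * primroot_char p g j a)"
proof -
  have p1: "p > 1" using p prime_gt_1_nat by blast
  define N where "N = p - 1"
  have N: "N > 0" using p1 by (simp add: N_def)
  define v :: "nat \<Rightarrow> complex" where "v = (\<lambda>i. of_real (square_wave p (int g ^ i)))"
  let ?U = "unit_root N"
  have ordg: "[g ^ N = 1] (mod p)" using g p by (metis N_def ord residue_primroot_def totient_prime)
  have vmod: "v (k mod N) = v k" for k
  proof -
    have "[g ^ k = g ^ (k mod N) * (g ^ N) ^ (k div N)] (mod p)"
      by (metis cong_refl mod_mult_div_eq power_add power_mult)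
    moreover have "[g ^ (k mod N) * (g ^ N) ^ (k div N) = g ^ (k mod N) * 1 ^ (k div N)] (mod p)"
      by (intro cong_mult cong_pow ordg cong_refl)
    ultimately have "[g ^ k = g ^ (k mod N)] (mod p)" by (metis cong_trans mult.right_neutral power_one)
    hence "[int g ^ k = int g ^ (k mod N)] (mod int p)" by (metis cong_int_iff of_nat_power)
    thus ?thesis by (simp add: v_def square_wave_def cong_def)
  qed
  define S where "S = (\<lambda>j. \<Sum>l<N. v l * ?U (int j * int l))"
  have S: "(\<Sum>a\<in>{0..<int p}. of_real (square_wave p a) * primroot_char p g j a) = S j" for j
  proof -
    let ?F = "\<lambda>a. of_real (square_wave p a) * primroot_char p g j a"
    have I: "{0..<int p} = insert 0 {1..<int p}" using p1 by auto
    have per: "?F (a + int p) = ?F a" for a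
      using char_periodic[OF primroot_char_character[OF p g]] by (simp add: square_wave_periodic)
    have "(\<Sum>a\<in>{0..<int p}. ?F a) = (\<Sum>a\<in>{1..<int p}. ?F a)"
      unfolding I using p1 by (subst sum.insert) (auto simp: primroot_char_def)
    also have "\<dots> = (\<Sum>l<p - 1. ?F (int g ^ l))" by (rule sum_over_primroot_powers[of p g ?F, OF p(1) g per])
    also have "\<dots> = S j" unfolding S_def N_def[symmetric]
    proof (intro sum.cong refl)
      fix l
      have cop: "coprime (int g ^ l) (int p)" by (rule primroot_coprime_power[OF p(1) g])
      have "[int (dlog p g (int g ^ l)) = int l] (mod int N)"
        unfolding N_def by (rule dlog_unique[OF p(1) g dlog_cong[OF p(1) g cop]])
      hence "?U (int j * int (dlog p g (int g ^ l))) = ?U (int j * int l)"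
        by (intro unit_root_cong[OF N] cong_scalar_left)
      thus "?F (int g ^ l) = v l * ?U (int j * int l)"
        using cop by (simp add: primroot_char_def v_def N_def)
    qed
    finally show ?thesis .
  qed
  have sumU: "(\<Sum>n<N. ?U (int n * x)) = (if int N dvd x then of_nat N else 0)" for x
    using sum_unit_root[OF N, of x] by (simp add: sum_int_interval)
  have inv: "of_nat N * v k = (\<Sum>j<N. S j * ?U (- (int j * int k)))" for k
  proof -
    have "(\<Sum>j<N. S j * ?U (- (int j * int k))) = (\<Sum>j<N. \<Sum>l<N. v l * ?U (int j * (int l - int k)))"
      unfolding S_def sum_distrib_right
      by (intro sum.cong refl) (simp add: right_diff_distrib unit_root_add[symmetric] mult.assoc)
    also have "\<dots> = (\<Sum>l<N. \<Sum>j<N. v l * ?U (int j * (int l - int k)))" by (rule sum.swap)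
    also have "\<dots> = (\<Sum>l<N. if l = k mod N then v l * of_nat N else 0)"
    proof (intro sum.cong refl)
      fix l assume l: "l \<in> {..<N}"
      have "int N dvd (int l - int k) \<longleftrightarrow> l = k mod N"
        using l by (metis lessThan_iff mod_eq_dvd_iff mod_less of_nat_eq_iff zmod_int)
      thus "(\<Sum>j<N. v l * ?U (int j * (int l - int k))) = (if l = k mod N then v l * of_nat N else 0)"
        by (simp add: sum_distrib_left[symmetric] sumU)
    qed
    also have "\<dots> = v (k mod N) * of_nat N" using N by simp
    finally show ?thesis by (simp add: vmod mult.commute)
  qed
  have "(\<Sum>k\<in>{1..<int p}. of_real (square_wave p (k ^ m)) :: complex) = (\<Sum>i<N. v (i * m))"
  proof -
    have "square_wave p ((a + int p) ^ m) = square_wave p (a ^ m)" for a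
      by (simp add: square_wave_def power_mod[of "a + int p", symmetric]) (simp add: power_mod)
    thus ?thesis
      using sum_over_primroot_powers[OF p(1) g, of "\<lambda>k. of_real (square_wave p (k ^ m)) :: complex"]
      by (simp add: v_def N_def power_mult)
  qed
  moreover have "of_nat N * (\<Sum>i<N. v (i * m)) = of_nat N * (\<Sum>j | j < N \<and> N dvd j * m. S j)"
  proof -
    have "of_nat N * (\<Sum>i<N. v (i * m)) = (\<Sum>i<N. \<Sum>j<N. S j * ?U (- (int j * int (i * m))))"
      unfolding sum_distrib_left inv ..
    also have "\<dots> = (\<Sum>j<N. \<Sum>i<N. S j * ?U (int i * (- int (j * m))))"
      by (subst sum.swap) (simp add: mult_ac)
    also have "\<dots> = (\<Sum>j<N. S j * (if int N dvd int (j * m) then of_nat N else 0))"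
      unfolding sum_distrib_left[symmetric] sumU dvd_minus_iff ..
    also have "\<dots> = (\<Sum>j<N. if N dvd j * m then S j * of_nat N else 0)"
      by (intro sum.cong refl) (auto simp: of_nat_dvd_iff simp del: of_nat_mult)
    also have "\<dots> = (\<Sum>j\<in>{j\<in>{..<N}. N dvd j * m}. S j * of_nat N)" by (rule sum.inter_filter[symmetric]) simp
    also have "{j\<in>{..<N}. N dvd j * m} = {j. j < N \<and> N dvd j * m}" by auto
    finally show ?thesis by (simp add: sum_distrib_left mult.commute)
  qed
  hence "(\<Sum>i<N. v (i * m)) = (\<Sum>j | j < N \<and> N dvd j * m. S j)" using N by simp
  ultimately show ?thesis unfolding S N_def by simp
qed

text \<open>The quotients \<open>j m / N\<close> are distinct numbers below \<open>m\<close>.\<close>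

lemma card_annihilated_le:
  assumes "N > 0" "m > 0"
  shows "card {j. j < N \<and> N dvd j * m} \<le> (m::nat)"
proof -
  have "inj_on (\<lambda>j. j * m div N) {j. j < N \<and> N dvd j * m}"
    by (rule inj_onI) (use assms in \<open>auto simp: dvd_div_eq_iff\<close>)
  moreover have "(\<lambda>j. j * m div N) ` {j. j < N \<and> N dvd j * m} \<subseteq> {..<m}"
    using assms by (auto simp: div_less_iff_less_mult mult.commute)
  ultimately show ?thesis using card_inj_on_le[of _ _ "{..<m}"] by fastforce
qed

text \<open>Twice the residue is never equal to \<open>p\<close>, so the condition on the fractional part says
  \<open>w = - 1\<close>. Since \<open>m\<close> is even, the sum over \<open>1 \<le> k < p/2\<close> is half of the sum over all \<open>k\<close>.\<close>

lemma large_residue_count_eq: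
  assumes p: "prime p" "odd p" and m: "even m"
  shows "real (large_residue_count m p) = (real p - 1) / 4 - (\<Sum>k\<in>{1..<int p}. square_wave p (k ^ m)) / 4"
proof -
  obtain h0 where h0: "p = 2 * h0 + 1" using p(2) oddE by blast
  define h where "h = int h0"
  have h: "int p = 2 * h + 1" "h \<ge> 0" by (auto simp: h_def h0)
  have p0: "p > 0" using p prime_gt_0_nat by blast
  have "{k :: int. 1 \<le> k \<and> real_of_int k < real p / 2 \<and> frac (real_of_int k ^ m / real p) > 1 / 2}
      = {k\<in>{1..h}. int p < 2 * (k ^ m mod int p)}"
  proof -
    have "real_of_int k < real p / 2 \<longleftrightarrow> k \<le> h" for k
    proof -
      have "real_of_int k < real p / 2 \<longleftrightarrow> real_of_int (2 * k) < real_of_int (int p)" by auto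
      also have "\<dots> \<longleftrightarrow> 2 * k < int p" by (simp only: of_int_less_iff)
      also have "\<dots> \<longleftrightarrow> k \<le> h" using h by auto
      finally show ?thesis .
    qed
    moreover have "frac (real_of_int k ^ m / real p) > 1 / 2 \<longleftrightarrow> int p < 2 * (k ^ m mod int p)" for k
    proof -
      define D R where "D = k ^ m div int p" and "R = k ^ m mod int p"
      have "real_of_int (k ^ m) = real_of_int (D * int p + R)" by (simp only: D_def R_def div_mult_mod_eq)
      hence km: "real_of_int k ^ m / real p = real_of_int D + real_of_int R / real p"
        using p0 by (simp add: field_simps)
      have "0 \<le> R" "R < int p" using p0 by (auto simp: R_def)
      hence "frac (real_of_int R / real p) = real_of_int R / real p" using p0 by (simp add: frac_eq)
      hence fr: "frac (real_of_int k ^ m / real p) = real_of_int (k ^ m mod int p) / real p"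
        unfolding km by (simp add: R_def)
      have "frac (real_of_int k ^ m / real p) > 1 / 2 \<longleftrightarrow> real_of_int (int p) < real_of_int (2 * (k ^ m mod int p))"
        unfolding fr using p0 by (simp add: field_simps)
      thus ?thesis by (simp only: of_int_less_iff)
    qed
    ultimately show ?thesis by auto
  qed
  hence "real (large_residue_count m p) = (\<Sum>k\<in>{k\<in>{1..h}. int p < 2 * (k ^ m mod int p)}. 1)"
    by (simp add: large_residue_count_def)
  also have "\<dots> = (\<Sum>k\<in>{1..h}. if int p < 2 * (k ^ m mod int p) then 1 else 0)"
    by (rule sum.inter_filter) simp
  also have "\<dots> = (\<Sum>k\<in>{1..h}. (1 - square_wave p (k ^ m)) / 2)"
  proof (intro sum.cong refl)
    fix k
    have "2 * (k ^ m mod int p) \<noteq> int p" using p(2) by (metis dvd_triv_left even_of_nat)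
    thus "(if int p < 2 * (k ^ m mod int p) then 1 else 0) = (1 - square_wave p (k ^ m)) / 2"
      by (auto simp: square_wave_def)
  qed
  also have "\<dots> = real_of_int h / 2 - (\<Sum>k\<in>{1..h}. square_wave p (k ^ m)) / 2"
    using h(2) by (simp add: sum_subtractf diff_divide_distrib sum_divide_distrib)
  also have "(\<Sum>k\<in>{1..h}. square_wave p (k ^ m)) = (\<Sum>k\<in>{1..<int p}. square_wave p (k ^ m)) / 2"
  proof -
    have "(\<Sum>k\<in>{1..<int p}. square_wave p (k ^ m)) = (\<Sum>k\<in>{1..h}. square_wave p (k ^ m)) + (\<Sum>k\<in>{h+1..<int p}. square_wave p (k ^ m))"
      by (subst sum.union_disjoint[symmetric]) (use h in \<open>auto intro!: sum.cong\<close>)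
    also have "(\<Sum>k\<in>{h+1..<int p}. square_wave p (k ^ m)) = (\<Sum>k\<in>{1..h}. square_wave p ((int p - k) ^ m))"
      by (rule sum.reindex_bij_witness[of _ "\<lambda>k. int p - k" "\<lambda>k. int p - k"]) (use h in auto)
    also have "\<dots> = (\<Sum>k\<in>{1..h}. square_wave p (k ^ m))"
    proof (intro sum.cong refl)
      fix k
      have "[int p - k = - k] (mod int p)" by (simp add: cong_iff_dvd_diff)
      hence "[(int p - k) ^ m = (- k) ^ m] (mod int p)" by (rule cong_pow)
      thus "square_wave p ((int p - k) ^ m) = square_wave p (k ^ m)"
        using m by (simp add: square_wave_def cong_def)
    qed
    finally show ?thesis by simp
  qed
  also have "real_of_int h = (real p - 1) / 2" using h0 by (simp add: h_def)
  finally show ?thesis by simp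
qed

lemma large_residue_count_error:
  assumes p: "prime p" "odd p" and m: "even m" "m > 0"
    and B: "\<And>chi. dirichlet_character p chi \<Longrightarrow> chi \<noteq> principal_character p \<Longrightarrow> norm (dirichlet_L p chi 1) \<le> B"
    and B0: "B \<ge> 0"
  shows "\<bar>real (large_residue_count m p) - real p / 4\<bar> \<le> 1 / 4 + real m / 2 * sqrt (real p) * B"
proof -
  have p1: "p > 1" using p prime_gt_1_nat by blast
  obtain g where g: "residue_primroot p g" using prime_primitive_root_exists[OF p1 p(1)] by blast
  let ?S = "\<lambda>j. \<Sum>a\<in>{0..<int p}. of_real (square_wave p a) * primroot_char p g j a"
  let ?J = "{j. j < p - 1 \<and> (p - 1) dvd j * m}"
  have S: "norm (?S j) \<le> 2 * sqrt (real p) * B" for j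
  proof -
    note chi = primroot_char_character[OF p g, of j]
    have "primroot_char p g j (- 1) * primroot_char p g j (- 1) = 1"
      using char_mult[OF chi, of "-1" "-1"] char_one[OF chi] by simp
    hence "primroot_char p g j (- 1) = 1 \<or> primroot_char p g j (- 1) = - 1" by (simp add: square_eq_1_iff)
    thus ?thesis
    proof
      assume "primroot_char p g j (- 1) = 1"
      thus ?thesis using square_wave_char_sum_even[OF p chi] B0 by simp
    next
      assume odd: "primroot_char p g j (- 1) = - 1"
      have "norm (?S j) \<le> 2 * sqrt (real p) * norm (dirichlet_L p (\<lambda>a. cnj (primroot_char p g j a)) 1)"
        by (rule square_wave_char_sum_odd[OF p chi odd])
      also have "\<dots> \<le> 2 * sqrt (real p) * B"
        using odd_char_nonprincipal[of "\<lambda>a. cnj (primroot_char p g j a)" p] odd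
        by (intro mult_left_mono B char_cnj chi) auto
      finally show ?thesis .
    qed
  qed
  have "\<bar>\<Sum>k\<in>{1..<int p}. square_wave p (k ^ m)\<bar> = norm (\<Sum>k\<in>{1..<int p}. of_real (square_wave p (k ^ m)) :: complex)"
    by (simp only: of_real_sum[symmetric] norm_of_real)
  also have "\<dots> = norm (\<Sum>j\<in>?J. ?S j)" by (simp only: power_sum_as_char_sums[OF p g])
  also have "\<dots> \<le> (\<Sum>j\<in>?J. 2 * sqrt (real p) * B)" by (intro sum_norm_le S)
  also have "\<dots> = real (card ?J) * (2 * sqrt (real p) * B)" by simp
  also have "\<dots> \<le> real m * (2 * sqrt (real p) * B)"
    using card_annihilated_le[of "p - 1" m] p1 m B0 by (intro mult_right_mono) auto
  finally have "\<bar>\<Sum>k\<in>{1..<int p}. square_wave p (k ^ m)\<bar> \<le> real m * (2 * sqrt (real p) * B)" .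
  thus ?thesis unfolding large_residue_count_eq[OF p m(1)] by (simp add: abs_le_iff field_simps)
qed

section \<open>Littlewood's bound and the conclusion\<close>

text \<open>Both functions have a simple pole at \<open>1\<close>.\<close>

lemma zeta_near_one:
  "\<exists>K\<ge>1. \<forall>e. 0 < e \<and> e \<le> 1 \<longrightarrow>
     Re (dseries mangoldt (of_real (1 + e))) \<le> K / e \<and> Re (dseries (\<lambda>_. 1) (of_real (1 + e))) \<le> K / e"
proof -
  let ?D = "dseries (\<lambda>_. 1)"
  note one = bounded_mult_one
  obtain H where H: "H holomorphic_on UNIV" "H 1 = 1" "\<And>s. Re s > 1 \<Longrightarrow> H s = (s - 1) * ?D s"
    using periodic_dseries_entire[of 1 "\<lambda>_. 1"] by auto
  have "bounded ((\<lambda>t. H (of_real t)) ` {1..2::real})"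
  proof (intro compact_imp_bounded compact_continuous_image)
    show "continuous_on {1..2::real} (\<lambda>t. H (of_real t))"
      by (rule continuous_on_compose2[OF holomorphic_on_imp_continuous_on[OF H(1)]]) (auto intro: continuous_intros)
  qed auto
  then obtain K1 where "\<forall>z\<in>(\<lambda>t. H (of_real t)) ` {1..2::real}. norm z \<le> K1"
    unfolding bounded_iff by blast
  hence K1: "\<And>t. t \<in> {1..2::real} \<Longrightarrow> norm (H (of_real t)) \<le> K1" by blast
  have z: "Re (?D (of_real (1 + e))) \<le> K1 / e" if e: "0 < e" "e \<le> 1" for e :: real
  proof -
    have "norm (H (of_real (1 + e))) = e * norm (?D (of_real (1 + e)))"
      using e by (subst H(3)) (auto simp: norm_mult)
    moreover have "norm (H (of_real (1 + e))) \<le> K1" using e by (intro K1) auto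
    ultimately have "norm (?D (of_real (1 + e))) \<le> K1 / e" using e by (simp add: field_simps)
    thus ?thesis using complex_Re_le_cmod order_trans by blast
  qed
  have P: "dseries mangoldt (of_real (1 + t)) = - (deriv ?D (of_real (1 + t)) / ?D (of_real (1 + t)))" if "t > 0" for t
    using logderiv_dseries[OF one, of "of_real (1 + t)"] that by simp
  have "\<exists>k::nat. ((\<lambda>t. of_real t * (deriv ?D (1 + of_real t) / ?D (1 + of_real t)))
            \<longlongrightarrow> of_nat k - 1) (at_right (0::real)) \<and> (k = 0 \<longleftrightarrow> H 1 \<noteq> 0)"
    using dseries_logderiv_limit[OF one H(1,3), of 1] by simp
  hence "((\<lambda>t. of_real t * (deriv ?D (1 + of_real t) / ?D (1 + of_real t))) \<longlongrightarrow> - 1) (at_right (0::real))"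
    using H(2) by auto
  hence "\<forall>\<^sub>F t in at_right 0. dist (of_real t * (deriv ?D (1 + of_real t) / ?D (1 + of_real t))) (- 1) < 1"
    by (rule tendstoD) simp
  then obtain d where d: "d > 0" "\<And>t. 0 < t \<Longrightarrow> t < d \<Longrightarrow>
     norm (of_real t * (deriv ?D (1 + of_real t) / ?D (1 + of_real t)) + 1) < 1"
    unfolding eventually_at_right_field by (auto simp: dist_norm)
  have small: "Re (dseries mangoldt (of_real (1 + t))) \<le> 2 / t" if t: "0 < t" "t < d" for t
  proof -
    let ?w = "of_real t * (deriv ?D (1 + of_real t) / ?D (1 + of_real t))"
    have "norm ?w \<le> 2" using d(2)[OF t] norm_triangle_ineq4[of "?w + 1" 1] by simp
    hence "t * norm (dseries mangoldt (of_real (1 + t))) \<le> 2"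
      unfolding P[OF t(1)] using t by (simp add: norm_mult norm_divide)
    moreover have "t * Re (dseries mangoldt (of_real (1 + t))) \<le> t * norm (dseries mangoldt (of_real (1 + t)))"
      using t complex_Re_le_cmod by (intro mult_left_mono) auto
    ultimately have "t * Re (dseries mangoldt (of_real (1 + t))) \<le> 2" by linarith
    thus ?thesis using t by (simp only: pos_le_divide_eq mult.commute)
  qed
  define K where "K = Max {1, 2, 4 / d, K1}"
  have K: "1 \<le> K" "2 \<le> K" "4 / d \<le> K" "K1 \<le> K" by (auto simp: K_def)
  have "Re (dseries mangoldt (of_real (1 + e))) \<le> K / e" if e: "0 < e" "e \<le> 1" for e
  proof (cases "e < d")
    case True
    have "2 / e \<le> K / e" using K e by (intro divide_right_mono) auto
    thus ?thesis using small[OF e(1) True] by linarith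
  next
    case False
    have "Re (dseries mangoldt (of_real (1 + e))) \<le> norm (deriv ?D (of_real (1 + e)) / ?D (of_real (1 + e)))"
      unfolding P[OF e(1)] using complex_Re_le_cmod[of "- (deriv ?D (of_real (1 + e)) / ?D (of_real (1 + e)))"]
      by (simp only: norm_minus_cancel)
    also have "\<dots> \<le> Re (dseries mangoldt (of_real (1 + d / 2)))"
      using d False by (intro norm_logderiv_dseries_le one) auto
    also have "\<dots> \<le> 2 / (d / 2)" using d by (intro small) auto
    also have "\<dots> \<le> K" using K by simp
    also have "K \<le> K / e" using e K by (simp add: le_divide_eq mult_left_le)
    finally show ?thesis .
  qed
  moreover have "Re (?D (of_real (1 + e))) \<le> K / e" if e: "0 < e" "e \<le> 1" for e
  proof -
    have "K1 / e \<le> K / e" using K e by (intro divide_right_mono) auto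
    thus ?thesis using z[OF e] by linarith
  qed
  ultimately show ?thesis using K(1) by blast
qed

text \<open>Zeros with \<open>Re s < 1\<close> are excluded by the Riemann hypothesis, those with \<open>Re s > 1\<close> and
  \<open>Re s = 1\<close> unconditionally, except for \<open>s = 1\<close>.\<close>

lemma dirichlet_L_nonzero:
  assumes grh: generalized_riemann_hypothesis
    and chi: "dirichlet_character q chi" and np: "chi \<noteq> principal_character q"
    and L1: "dirichlet_L q chi 1 \<noteq> 0" and s: "Re s > 1 / 2"
  shows "dirichlet_L q chi s \<noteq> 0"
proof -
  let ?a = "\<lambda>n. chi (int n)"
  note L = dirichlet_L_spec[OF chi np]
  note bm = char_bounded_mult[OF chi]
  consider "Re s > 1" | "Re s < 1" | "Re s = 1" "Im s \<noteq> 0" | "s = 1"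
    by (cases "Re s > 1"; cases "Re s < 1"; cases "Im s = 0") (auto simp: complex_eq_iff)
  thus ?thesis
  proof cases
    case 1
    thus ?thesis using L(3)[OF 1] dseries_nonzero[OF bm 1] by simp
  next
    case 2
    thus ?thesis using grh chi s unfolding generalized_riemann_hypothesis_def by force
  next
    case 3
    define H where "H = (\<lambda>s. (s - 1) * dirichlet_L q chi s)"
    have "H (1 + \<i> * of_real (Im s)) \<noteq> 0"
    proof (rule nonvanishing_line_one[of ?a q])
      show "chi (int n) = 0 \<or> norm (chi (int n)) = 1" for n
        using char_norm[OF chi, of "int n"] char_zero_iff[OF chi, of "int n"] by auto
      show "q \<ge> 1" using chi by (simp add: dirichlet_character_def)
      show "chi (int (n + q)) = chi (int n)" for n using char_periodic[OF chi, of "int n"] by simp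
      show "H holomorphic_on UNIV" unfolding H_def by (intro holomorphic_intros L)
    qed (use bm L(3) 3 in \<open>auto simp: H_def\<close>)
    moreover have "1 + \<i> * of_real (Im s) = s" using 3 by (simp add: complex_eq_iff)
    ultimately show ?thesis by (simp add: H_def)
  qed (use L1 in simp)
qed

text \<open>The inequality \<open>1 \<le> log log q\<close> is recorded because it makes the bound non-negative.\<close>

lemma littlewood_L1_bound:
  assumes grh: generalized_riemann_hypothesis
  shows "\<exists>C q0. C > 0 \<and> (\<forall>q chi. q \<ge> q0 \<longrightarrow> dirichlet_character q chi \<longrightarrow> chi \<noteq> principal_character q \<longrightarrow>
     1 \<le> ln (ln (real q)) \<and> norm (dirichlet_L q chi 1) \<le> C * ln (ln (real q)))"
proof -
  obtain K where K: "K \<ge> 1" "\<And>e. 0 < e \<Longrightarrow> e \<le> 1 \<Longrightarrow> Re (dseries mangoldt (of_real (1 + e))) \<le> K / e"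
     "\<And>e. 0 < e \<Longrightarrow> e \<le> 1 \<Longrightarrow> Re (dseries (\<lambda>_. 1) (of_real (1 + e))) \<le> K / e"
    using zeta_near_one by blast
  obtain C1 where C1: "C1 > 0" "\<And>a B L s. (\<And>N. norm (\<Sum>j<N. a (Suc j)) \<le> B) \<Longrightarrow> L holomorphic_on UNIV \<Longrightarrow>
    (\<And>s. Re s > 1 \<Longrightarrow> (\<lambda>n. a (Suc n) / of_nat (Suc n) powr s) sums L s) \<Longrightarrow> s \<in> ball (2::complex) (4/3)
    \<Longrightarrow> norm (L s :: complex) \<le> C1 * B"
    using bounded_partial_sums_dseries_le by blast
  define C2 where "C2 = max 1 (2 * C1)"
  define C3 where "C3 = (ln 1200 + 1) / ln (6/5) + (1::real)"
  \<comment> \<open>\<open>C3\<close> will bound \<open>e N\<close>\<close>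
  define C where "C = K * exp (K * exp (2 * C3))"
  define q0 where "q0 = nat \<lceil>max (exp (exp 2)) (8 * C2)\<rceil>"
  have C2: "C2 \<ge> 1" "2 * C1 \<le> C2" by (auto simp: C2_def)
  have l65: "ln (6/5 :: real) > 0" by simp
  have "1 \<le> ln (ln (real q)) \<and> norm (dirichlet_L q chi 1) \<le> C * ln (ln (real q))"
    if q: "q \<ge> q0" and chi: "dirichlet_character q chi" and np: "chi \<noteq> principal_character q" for q chi
  proof -
    have q': "real q \<ge> exp (exp 2)" "real q \<ge> 8 * C2" using q by (auto simp: q0_def nat_le_iff ceiling_le_iff)
    have lq: "ln (real q) \<ge> exp 2" using q' by (smt (verit) exp_gt_zero ln_exp ln_le_cancel_iff)
    have llq: "ln (ln (real q)) \<ge> 2" using lq by (smt (verit) exp_gt_zero ln_exp ln_le_cancel_iff)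
    define l where "l = ln (ln (real q))"
    define e where "e = 1 / l"
    have l: "l \<ge> 2" using llq by (simp add: l_def)
    have e: "0 < e" "e \<le> 1 / 2" using l by (auto simp: e_def field_simps)
    have qpos: "real q > 0" using q'(1) by (smt (verit) exp_gt_zero)
    let ?L = "dirichlet_L q chi" and ?a = "\<lambda>n. chi (int n)"
    note L = dirichlet_L_spec[OF chi np]
    note bm = char_bounded_mult[OF chi]
    have "norm (?L 1) \<le> C * l"
    proof (cases "?L 1 = 0")
      case True
      thus ?thesis using l K(1) by (simp add: C_def)
    next
      case False
      define M where "M = C2 * real q"
      \<comment> \<open>\<open>X\<close> is the least exponent with \<open>(6/5) powr X \<ge> 1200 log q\<close>, and \<open>ln (8 M) \<le> 2 log q\<close>\<close>
      define X where "X = ln (1200 * ln (real q)) / ln (6/5)"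
      define N where "N = nat \<lceil>X\<rceil>"
      have lq0: "ln (real q) > 0" using lq by (smt (verit) exp_gt_zero)
      have q1: "real q \<ge> 1" using q'(2) C2 by linarith
      have M1: "M \<ge> 1" unfolding M_def using C2(1) q1 mult_mono[of 1 C2 1 "real q"] by simp
      have lM: "ln (8 * M) \<le> 2 * ln (real q)"
      proof -
        have "8 * M \<le> real q * real q" unfolding M_def using q' qpos mult_right_mono[of "8 * C2" "real q" "real q"] by simp
        hence "ln (8 * M) \<le> ln (real q * real q)" using M1 by (subst ln_le_cancel_iff) (use qpos in auto)
        thus ?thesis using qpos by (simp add: ln_mult)
      qed
      have X0: "X = (ln 1200 + l) / ln (6/5)" using lq0 by (simp add: X_def l_def ln_mult)
      have lnpos: "ln (1200::real) \<ge> 0" by simp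
      have Xl: "X \<le> (ln 1200 + 1) / ln (6/5) * l"
      proof -
        have "ln 1200 * 1 \<le> ln (1200::real) * l" using l lnpos by (intro mult_left_mono) auto
        hence "ln 1200 + l \<le> (ln 1200 + 1) * l" by (simp add: algebra_simps)
        thus ?thesis unfolding X0 using l65 by (simp add: divide_right_mono)
      qed
      have Xpos: "X \<ge> 0" unfolding X0 using l lnpos l65 by simp
      have NX: "X \<le> real N" "real N \<le> X + 1" unfolding N_def using Xpos by (auto simp: of_nat_nat intro: order_trans)
      have NC: "2 * e * real N \<le> 2 * C3"
      proof -
        have "real N \<le> C3 * l" using NX(2) Xl l by (simp add: C3_def ring_distribs)
        hence "e * real N \<le> e * (C3 * l)" using e by (intro mult_left_mono) auto
        also have "e * (C3 * l) = C3" using l by (simp add: e_def)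
        finally show ?thesis by simp
      qed
      have N: "(6/5) ^ N \<ge> 600 * ln (8 * M)"
      proof -
        have "600 * ln (8 * M) \<le> 1200 * ln (real q)" using lM by simp
        also have "\<dots> = exp (X * ln (6/5))" using lq0 l65 by (simp add: X_def)
        also have "\<dots> \<le> exp (real N * ln (6/5))" using NX l65 by simp
        also have "\<dots> = (6/5) ^ N" by (simp add: exp_of_nat_mult)
        finally show ?thesis .
      qed
      have "norm (?L 1) \<le> norm (?L (1 + of_real e)) * exp (K * exp (2 * e * real N))"
      proof (rule littlewood_disc[OF L(1) _ _ M1 _ e K(1) _ N])
        fix s :: complex
        show "?L s \<noteq> 0" if "s \<in> ball 2 (3/2)"
        proof (rule dirichlet_L_nonzero[OF grh chi np False])
          show "Re s > 1 / 2" using that abs_Re_le_cmod[of "2 - s"] by (simp add: dist_norm)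
        qed
        show "norm (?L s) \<le> M" if "s \<in> ball 2 (4/3)"
        proof -
          have "norm (?L s) \<le> C1 * (2 * real q)"
            by (rule C1(2)[of ?a, OF char_partial_sums[OF chi np] L(1) L(2) that])
          also have "\<dots> \<le> M" unfolding M_def using C2(2) qpos mult_right_mono[of "2 * C1" C2 "real q"] by simp
          finally show ?thesis .
        qed
        show "norm (deriv ?L s / ?L s) \<le> K / e" if s: "Re s \<ge> 1 + e"
        proof -
          have s1: "Re s > 1" using s e by simp
          have "deriv ?L s = deriv (dseries ?a) s"
            by (rule complex_derivative_transform_within_open[OF holomorphic_on_subset[OF L(1)]
                 dseries_holomorphic[of ?a, OF bounded_mult_growth(1)[OF bm]] open_halfspace_Re_gt[of 1]])
               (use s1 L(3) in auto)
          hence "norm (deriv ?L s / ?L s) = norm (deriv (dseries ?a) s / dseries ?a s)"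
            using L(3)[OF s1] by simp
          also have "\<dots> \<le> Re (dseries mangoldt (of_real (1 + e)))"
            using e s by (intro norm_logderiv_dseries_le(1) bm) auto
          also have "\<dots> \<le> K / e" using e by (intro K(2)) auto
          finally show ?thesis .
        qed
      qed (use norm_dseries_2_ge[OF bm] L(3)[of 2] in auto)
      also have "norm (?L (1 + of_real e)) \<le> K / e"
      proof -
        have "?L (1 + of_real e) = dseries ?a (1 + of_real e)" using e by (intro L(3)) auto
        also have "norm \<dots> \<le> Re (dseries (\<lambda>_. 1) (of_real (1 + e)))"
          using e by (intro norm_logderiv_dseries_le(2) bm) auto
        also have "\<dots> \<le> K / e" using e by (intro K(3)) auto
        finally show ?thesis .
      qed
      also have "K / e * exp (K * exp (2 * e * real N)) \<le> K / e * exp (K * exp (2 * C3))"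
        using NC K(1) e by (intro mult_left_mono) auto
      also have "\<dots> = C * l" by (simp add: C_def e_def)
      finally show ?thesis by simp
    qed
    thus ?thesis using l by (simp add: l_def)
  qed
  moreover have "C > 0" using K(1) by (simp add: C_def)
  ultimately show ?thesis by blast
qed

lemma ln_ln_3_pos: "ln (ln (3::real)) > 0"
proof -
  have "exp 1 < (3::real)" using e_less_272 by simp
  hence "1 < ln (3::real)" by (metis exp_gt_zero ln_exp ln_less_cancel_iff zero_less_numeral)
  thus ?thesis by simp
qed

theorem theorem1p7:
  fixes m :: nat
  assumes "generalized_riemann_hypothesis"
    and "m \<ge> 2" and "even m"
  shows "\<exists>c::real. c > 0 \<and>
    (\<forall>p::nat. prime p \<and> odd p \<longrightarrow>
       \<bar>real (large_residue_count m p) - real p / 4\<bar> \<le> c * (sqrt (real p) * ln (ln (real p))))"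
proof -
  obtain C q0 where C: "C > 0" "\<And>q chi. q \<ge> q0 \<Longrightarrow> dirichlet_character q chi \<Longrightarrow> chi \<noteq> principal_character q \<Longrightarrow>
     1 \<le> ln (ln (real q)) \<and> norm (dirichlet_L q chi 1) \<le> C * ln (ln (real q))"
    using littlewood_L1_bound[OF assms(1)] by blast
  define d where "d = ln (ln (3::real))"
  \<comment> \<open>the first part serves for \<open>p \<ge> q0\<close>; below \<open>q0\<close> the error is trivially at most
      \<open>p\<close>, while the right-hand side without \<open>c\<close> is at least \<open>d = log log 3 > 0\<close>\<close>
  define c where "c = (1 / (4 * d) + real m / 2 * C) + real q0 / d"
  have d: "d > 0" using ln_ln_3_pos by (simp add: d_def)
  have mC: "0 \<le> real m / 2 * C" using C(1) by simp
  have c: "c > 0" using d mC by (simp add: c_def add_pos_nonneg)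
  have "\<bar>real (large_residue_count m p) - real p / 4\<bar> \<le> c * (sqrt (real p) * ln (ln (real p)))"
    if p: "prime p" "odd p" for p
  proof -
    have p3: "p \<ge> 3" using p prime_gt_1_nat[of p] by (cases "p = 2") auto
    define l where "l = ln (ln (real p))"
    have "ln 3 \<le> ln (real p)" using p3 by simp
    moreover have "ln 3 > (0::real)" by simp
    ultimately have ld: "l \<ge> d" unfolding l_def d_def by (subst ln_le_cancel_iff) linarith+
    have Cl: "0 \<le> C * l" using C(1) d ld by simp
    have sp: "sqrt (real p) \<ge> 1" using p3 by simp
    have sl: "d \<le> sqrt (real p) * l" using mult_mono[of 1 "sqrt (real p)" d l] sp ld d by simp
    show ?thesis
    proof (cases "p \<ge> q0")
      case True
      have "\<bar>real (large_residue_count m p) - real p / 4\<bar> \<le> 1 / 4 + real m / 2 * sqrt (real p) * (C * l)"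
        using p assms C(2) True Cl unfolding l_def by (intro large_residue_count_error) auto
      also have "1 / 4 \<le> 1 / (4 * d) * (sqrt (real p) * l)" using sl d by (simp add: field_simps)
      also have "1 / (4 * d) * (sqrt (real p) * l) + real m / 2 * sqrt (real p) * (C * l)
         = (1 / (4 * d) + real m / 2 * C) * (sqrt (real p) * l)" by (simp add: algebra_simps)
      also have "\<dots> \<le> c * (sqrt (real p) * l)"
        using sl d by (intro mult_right_mono) (auto simp: c_def)
      finally show ?thesis by (simp add: l_def)
    next
      case False
      have "\<bar>\<Sum>k\<in>{1..<int p}. square_wave p (k ^ m)\<bar> \<le> (\<Sum>k\<in>{1..<int p}. 1)"
        by (rule order_trans[OF sum_abs sum_mono]) (simp add: square_wave_def)
      also have "\<dots> = real p - 1" using p3 by simp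
      finally have "\<bar>\<Sum>k\<in>{1..<int p}. square_wave p (k ^ m)\<bar> \<le> real p - 1" .
      moreover have "\<bar>(x - 1) / 4 - S / 4 - x / 4\<bar> \<le> x" if "\<bar>S\<bar> \<le> x - 1" for S x :: real
        using that by (intro abs_leI) (simp_all add: abs_le_iff field_simps)
      ultimately have "\<bar>real (large_residue_count m p) - real p / 4\<bar> \<le> real p"
        unfolding large_residue_count_eq[OF p assms(3)] by blast
      also have "\<dots> \<le> real q0 / d * d" using False d by simp
      also have "\<dots> \<le> c * (sqrt (real p) * l)"
        using sl d mC by (intro mult_mono) (auto simp: c_def)
      finally show ?thesis by (simp add: l_def)
    qed
  qed
  thus ?thesis using c by blast
qed

end
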